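(* Let $d\ge 1$ and $k\ge 1$ be integers, let $X_1,X_2,\dots$ be iid random points in $\mathbb{R}^d$ with a density $f$ that is a.e. continuous and bounded, and let $\mathcal{X}_n=\{X_1,\dots,X_n\}$. Let $(r_n)$ be a sequence of positive numbers with $n r_n^d\to 0$ as $n\to\infty$. Suppose that $n^{k+2}r_n^{d(k+1)}\to 0$ as $n\to\infty$. Let $\xi_{k,n}$ be the $k$th persistence diagram of the scaled Čech filtration $\big(\check{C}(\mathcal{X}_n,r_nt),\,t\ge 0\big)$, viewed as a point process on $\Delta_L=\{(x,y):0\le x<y\le\infty\}$. Then, as $n\to\infty$, $$\big(n^{k+2}r_n^{d(k+1)}\big)^{-1}\,\mathbb{P}(\xi_{k,n}\in\cdot)\ \to\ C_k\,\lambda\Big\{\mathbf{y}\in(\mathbb{R}^d)^{k+1}:\ \delta_{(b(0,\mathbf{y}),\,d(0,\mathbf{y}))}\in\cdot\Big\}\quad\text{in }\mathcal{M}_0,$$ where $\mathbf{y}=(y_1,\dots,y_{k+1})$ and, for $\mathbf{x}=(x_1,\dots,x_{k+2})\in(\mathbb{R}^d)^{k+2}$, $$b(\mathbf{x})=\inf\{t\ge0:h_t(\mathbf{x})=1\},\qquad d(\mathbf{x})=\inf\{t\ge b(\mathbf{x}):h_t(\mathbf{x})=0\},$$ with the convention $\inf\emptyset=\infty$.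
   Context: **Čech complex and filtration.** $B(x,\rho)$ is the closed ball in $\mathbb{R}^d$ with center $x$ and radius $\rho$. For a finite set $\mathcal{X}\subset\mathbb{R}^d$ and $r\ge 0$, the Čech complex $\check{C}(\mathcal{X},r)$ has the points of $\mathcal{X}$ as $0$-simplices, and for $m\ge1$ the points $x_{i_0},\dots,x_{i_m}\in\mathcal{X}$ form an $m$-simplex iff $\bigcap_{j=0}^m B(x_{i_j},r/2)\ne\emptyset$. The Čech filtration over $r_n^{-1}\mathcal{X}_n$ is $\big(\check{C}(r_n^{-1}\mathcal{X}_n,t),t\ge0\big)=\big(\check{C}(\mathcal{X}_n,r_nt),t\ge0\big)$. Homology is taken with coefficients in a fixed field, and $\beta_k$ denotes the $k$th Betti number. **Persistence diagram as a point process.** $\Delta_L=\{(x,y):0\le x<y\le\infty\}$ carries the relative topology of $[0,\infty)\times[0,\infty]$. Let $\big((b_i,d_i)\big)_{i=1}^{n_k}$ be the list (with multiplicity) of the $k$th persistence birth–death pairs of the Čech filtration $\big(\check{C}(\mathcal{X}_n,r_nt),t\ge0\big)$: $b_i$ is the time at which a $k$-cycle first appears and $d_i$ the time at which it is filled in. Put $\xi_{k,n}=\sum_i\delta_{(b_i,d_i)}$, regarded as a random element of $M_p(\Delta_L)$, the space of Radon point measures on $\Delta_L$ with the vague topology. **Indicator and constants.** For $\mathbf{x}=(x_1,\dots,x_{k+2})\in(\mathbb{R}^d)^{k+2}$ and $r\ge0$, $$h_r(\mathbf{x})=\mathbf{1}\big\{\beta_k(\check{C}(\{x_1,\dots,x_{k+2}\},r))=1\big\},$$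 so that $h_r(\mathbf x)=1$ iff every $k+1$ of the balls $B(x_j,r/2)$ have a common point but all $k+2$ do not. $\lambda$ is Lebesgue measure on $(\mathbb{R}^d)^{k+1}$ and $C_k=\frac{1}{(k+2)!}\int_{\mathbb{R}^d}f(x)^{k+2}dx$. When $b(0,\mathbf{y})=\infty$, the measure $\delta_{(b(0,\mathbf{y}),d(0,\mathbf{y}))}$ is read as the null measure on $\Delta_L$. **$\mathcal{M}_0$-convergence.** Let $\emptyset\in M_p(\Delta_L)$ denote the null measure and $B_{\emptyset,r}$ the open ball of radius $r>0$ around $\emptyset$ in a metric inducing the vague topology (under which $M_p(\Delta_L)$ is complete and separable). $\mathcal{M}_0=\mathcal{M}_0(M_p(\Delta_L))$ is the space of Borel measures on $M_p(\Delta_L)$ whose restriction to $M_p(\Delta_L)\setminus B_{\emptyset,r}$ is finite for all $r>0$. $\mathcal{C}_0$ is the space of continuous bounded real-valued functions on $M_p(\Delta_L)$ that vanish in a neighborhood of $\emptyset$. For $m_n,m\in\mathcal{M}_0$, $m_n\to m$ in $\mathcal{M}_0$ means $\int\varphi\,dm_n\to\int\varphi\,dm$ for all $\varphi\in\mathcal{C}_0$. *)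

theory Defs
  imports "HOL-Probability.Probability" "HOL-Library.Function_Algebras"
begin

section \<open>Simplicial homology over a field and persistence\<close>

text \<open>
  A simplicial complex is the set of its nonempty finite simplices. An oriented \<open>p\<close>-chain is a
  finitely supported function on the orderings \<open>[v\<^sub>0, \<dots>, v\<^sub>p]\<close> of the \<open>p\<close>-simplices that changes sign
  under odd permutations; it suffices to ask this for adjacent transpositions.
  The function that is the sign of the ordering on the simplex \<open>[v\<^sub>0, \<dots>, v\<^sub>p]\<close> and zero elsewhere
  is the elementary chain of that oriented simplex. No ordering of the vertex set is needed, and
  the field may have characteristic two.
\<close>

definition chains :: "nat \<Rightarrow> 'a set set \<Rightarrow> ('a list \<Rightarrow> 'f::field) set" where
  "chains p K = {c. finite {xs. c xs \<noteq> 0} \<and>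
     (\<forall>xs. c xs \<noteq> 0 \<longrightarrow> length xs = p + 1 \<and> distinct xs \<and> set xs \<in> K) \<and>
     (\<forall>us v w vs. c (us @ w # v # vs) = - c (us @ v # w # vs))}"

text \<open>
  On elementary chains this is \<open>\<partial>[v\<^sub>0, \<dots>, v\<^sub>p] = (\<Sum>i. (-1)^i [v\<^sub>0, \<dots>, v\<^sub>p without v\<^sub>i])\<close>:
  moving \<open>v\<^sub>i\<close> to the front costs the sign \<open>(-1)^i\<close>. Homology is unreduced, so the boundary of a
  0-chain, which would live on the empty list, is zero.
\<close>

definition boundary :: "('a list \<Rightarrow> 'f::field) \<Rightarrow> 'a list \<Rightarrow> 'f" where
  "boundary c ys = (if ys = [] then 0 else \<Sum>v | c (v # ys) \<noteq> 0. c (v # ys))"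

definition cycles :: "nat \<Rightarrow> 'a set set \<Rightarrow> ('a list \<Rightarrow> 'f::field) set" where
  "cycles p K = {c \<in> chains p K. boundary c = (\<lambda>_. 0)}"

definition boundaries :: "nat \<Rightarrow> 'a set set \<Rightarrow> ('a list \<Rightarrow> 'f::field) set" where
  "boundaries p K = boundary ` chains (p + 1) K"

definition chain_scale :: "'f::field \<Rightarrow> ('a list \<Rightarrow> 'f) \<Rightarrow> 'a list \<Rightarrow> 'f" where
  "chain_scale a c = (\<lambda>xs. a * c xs)"

global_interpretation chain: vector_space "chain_scale :: 'f::field \<Rightarrow> ('a list \<Rightarrow> 'f) \<Rightarrow> _"
  defines chain_dim = chain.dim
  by unfold_locales (auto simp: chain_scale_def algebra_simps fun_eq_iff)

text \<open>The Betti number is the dimension of \<open>H\<^sub>p(K) = Z\<^sub>p(K) / B\<^sub>p(K)\<close>, for a finite complex \<open>K\<close>.\<close>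

definition betti :: "'f::field itself \<Rightarrow> nat \<Rightarrow> 'a set set \<Rightarrow> nat" where
  "betti F p K = chain_dim (cycles p K :: ('a list \<Rightarrow> 'f) set) -
                 chain_dim (boundaries p K :: ('a list \<Rightarrow> 'f) set)"

text \<open>
  For finite complexes \<open>K \<subseteq> L\<close>, the rank of \<open>H\<^sub>p(K) \<rightarrow> H\<^sub>p(L)\<close>, whose image is
  \<open>Z\<^sub>p(K) / (Z\<^sub>p(K) \<inter> B\<^sub>p(L))\<close>.
\<close>

definition persistent_betti :: "'f::field itself \<Rightarrow> nat \<Rightarrow> 'a set set \<Rightarrow> 'a set set \<Rightarrow> nat" where
  "persistent_betti F p K L = chain_dim (cycles p K :: ('a list \<Rightarrow> 'f) set) -
                 chain_dim (cycles p K \<inter> boundaries p L :: ('a list \<Rightarrow> 'f) set)"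

text \<open>
  A filtration is a family \<open>K t\<close>, \<open>t \<ge> 0\<close>, of complexes increasing in \<open>t\<close>; \<open>before K t\<close> is the
  complex just before time \<open>t\<close> (empty if \<open>t = 0\<close>, the final complex if \<open>t = \<infinity>\<close>).
\<close>

definition before :: "(real \<Rightarrow> 'a set set) \<Rightarrow> ereal \<Rightarrow> 'a set set" where
  "before K t = (\<Union>s\<in>{s. 0 \<le> s \<and> ereal s < t}. K s)"

text \<open>
  The multiplicity of the birth-death pair \<open>(b, d)\<close>, \<open>0 \<le> b < d \<le> \<infinity>\<close>, in the \<open>p\<close>th persistence
  diagram of \<open>K\<close>: the number of independent \<open>p\<close>-classes that are born at \<open>b\<close> and die entering
  \<open>K d\<close>, that is, the usual
  \<open>(\<beta>\<^sup>i\<^sup>,\<^sup>j\<^sup>-\<^sup>1 - \<beta>\<^sup>i\<^sup>-\<^sup>1\<^sup>,\<^sup>j\<^sup>-\<^sup>1) - (\<beta>\<^sup>i\<^sup>,\<^sup>j - \<beta>\<^sup>i\<^sup>-\<^sup>1\<^sup>,\<^sup>j)\<close> at the critical times \<open>b\<close> (index \<open>i\<close>) and \<open>d\<close>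
  (index \<open>j\<close>). For \<open>d = \<infinity>\<close> these are the classes born at \<open>b\<close> that never die. It is meant for
  filtrations of a finite complex that are right-continuous in \<open>t\<close>.
\<close>

definition persistence_mult ::
    "'f::field itself \<Rightarrow> nat \<Rightarrow> (real \<Rightarrow> 'a set set) \<Rightarrow> real \<times> ereal \<Rightarrow> nat" where
  "persistence_mult F p K = (\<lambda>(b, d). nat (
      (int (persistent_betti F p (K b) (before K d)) -
       int (persistent_betti F p (before K (ereal b)) (before K d))) -
      (if d = \<infinity> then 0 else
       int (persistent_betti F p (K b) (K (real_of_ereal d))) -
       int (persistent_betti F p (before K (ereal b)) (K (real_of_ereal d))))))"


section \<open>The Cech complex, and the birth and death times of a tuple\<close>

definition cech :: "'a::euclidean_space set \<Rightarrow> real \<Rightarrow> 'a set set" where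
  "cech S r = (\<lambda>x. {x}) ` S \<union>
     {\<sigma>. \<sigma> \<subseteq> S \<and> finite \<sigma> \<and> 2 \<le> card \<sigma> \<and> (\<Inter>x\<in>\<sigma>. cball x (r / 2)) \<noteq> {}}"

text \<open>Tuples \<open>x = (x\<^sub>0, \<dots>, x\<^sub>k\<^sub>+\<^sub>1)\<close> are functions on \<open>{..<k + 2}\<close>.\<close>

definition cycle_ind ::
    "'f::field itself \<Rightarrow> nat \<Rightarrow> real \<Rightarrow> (nat \<Rightarrow> 'a::euclidean_space) \<Rightarrow> nat" where
  "cycle_ind F k r x = of_bool (betti F k (cech (x ` {..<k + 2}) r) = 1)"

definition birth :: "'f::field itself \<Rightarrow> nat \<Rightarrow> (nat \<Rightarrow> 'a::euclidean_space) \<Rightarrow> ereal" where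
  "birth F k x = Inf {ereal t | t. 0 \<le> t \<and> cycle_ind F k t x = 1}"

definition death :: "'f::field itself \<Rightarrow> nat \<Rightarrow> (nat \<Rightarrow> 'a::euclidean_space) \<Rightarrow> ereal" where
  "death F k x = Inf {ereal t | t. 0 \<le> t \<and> birth F k x \<le> ereal t \<and> cycle_ind F k t x = 0}"


section \<open>Point measures and the vague topology\<close>

definition borel_of :: "'a topology \<Rightarrow> 'a measure" where
  "borel_of T = sigma (topspace T) {U. openin T U}"

text \<open>\<open>dirac_sum T m\<close> is the measure \<open>\<Sum>p. m p \<cdot> \<delta>\<^sub>p\<close> on the Borel sets of \<open>T\<close>.\<close>

definition dirac_sum :: "'a topology \<Rightarrow> ('a \<Rightarrow> nat) \<Rightarrow> 'a measure" where
  "dirac_sum T m =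
     distr (density (count_space (topspace T)) (\<lambda>p. of_nat (m p))) (borel_of T) (\<lambda>p. p)"

definition radon_point_measures :: "'a topology \<Rightarrow> 'a measure set" where
  "radon_point_measures T = {dirac_sum T m | m.
     countable {p \<in> topspace T. m p \<noteq> 0} \<and>
     (\<forall>K. compactin T K \<longrightarrow> emeasure (dirac_sum T m) K < \<infinity>)}"

definition CK_plus :: "'a topology \<Rightarrow> ('a \<Rightarrow> real) set" where
  "CK_plus T = {g. continuous_map T euclideanreal g \<and> (\<forall>x\<in>topspace T. 0 \<le> g x) \<and>
     (\<exists>K. compactin T K \<and> (\<forall>x\<in>topspace T - K. g x = 0))}"

text \<open>The coarsest topology for which every \<open>N \<mapsto> \<integral>g dN\<close>, \<open>g \<in> CK_plus T\<close>, is continuous.\<close>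

definition vague_topology :: "'a topology \<Rightarrow> 'a measure topology" where
  "vague_topology T = topology_generated_by
     {{N \<in> radon_point_measures T. (\<integral>x. g x \<partial>N) \<in> U} | g U. g \<in> CK_plus T \<and> open U}"

definition null_point_measure :: "'a topology \<Rightarrow> 'a measure" where
  "null_point_measure T = null_measure (borel_of T)"


section \<open>Convergence in \<open>\<M>\<^sub>0\<close>\<close>

definition vague_metric :: "'a topology \<Rightarrow> ('a measure \<Rightarrow> 'a measure \<Rightarrow> real) \<Rightarrow> bool" where
  "vague_metric T \<rho> \<longleftrightarrow> Metric_space (radon_point_measures T) \<rho> \<and>
     Metric_space.mtopology (radon_point_measures T) \<rho> = vague_topology T \<and>
     Metric_space.mcomplete (radon_point_measures T) \<rho> \<and>
     separable_space (vague_topology T)"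

definition M0_measures ::
    "'a topology \<Rightarrow> ('a measure \<Rightarrow> 'a measure \<Rightarrow> real) \<Rightarrow> 'a measure measure set" where
  "M0_measures T \<rho> = {m. sets m = sets (borel_of (vague_topology T)) \<and>
     (\<forall>r>0. emeasure m (radon_point_measures T -
        Metric_space.mball (radon_point_measures T) \<rho> (null_point_measure T) r) < \<infinity>)}"

definition C0_functions :: "'a topology \<Rightarrow> ('a measure \<Rightarrow> real) set" where
  "C0_functions T = {\<phi>. continuous_map (vague_topology T) euclideanreal \<phi> \<and>
     bounded (\<phi> ` radon_point_measures T) \<and>
     (\<exists>U. openin (vague_topology T) U \<and> null_point_measure T \<in> U \<and> (\<forall>N\<in>U. \<phi> N = 0))}"

definition M0_converges :: "'a topology \<Rightarrow> ('a measure \<Rightarrow> 'a measure \<Rightarrow> real) \<Rightarrow>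
    (nat \<Rightarrow> 'a measure measure) \<Rightarrow> 'a measure measure \<Rightarrow> bool" where
  "M0_converges T \<rho> m m' \<longleftrightarrow> (\<forall>n. m n \<in> M0_measures T \<rho>) \<and> m' \<in> M0_measures T \<rho> \<and>
     (\<forall>\<phi>\<in>C0_functions T. (\<lambda>n. \<integral>N. \<phi> N \<partial>m n) \<longlonglongrightarrow> (\<integral>N. \<phi> N \<partial>m'))"


section \<open>Persistence diagrams as point processes\<close>

definition DeltaL :: "(real \<times> ereal) topology" where
  "DeltaL = top_of_set {(x, y). 0 \<le> x \<and> ereal x < y}"

text \<open>The persistence diagram of \<open>(cech S (r * t), t \<ge> 0)\<close>.\<close>

definition cech_diagram :: "'f::field itself \<Rightarrow> nat \<Rightarrow> real \<Rightarrow> 'a::euclidean_space set \<Rightarrow>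
    (real \<times> ereal) measure" where
  "cech_diagram F k r S = dirac_sum DeltaL (persistence_mult F k (\<lambda>t. cech S (r * t)))"

text \<open>The Dirac measure at the birth and death times of a tuple, null if it is never born.\<close>

definition tuple_diagram :: "'f::field itself \<Rightarrow> nat \<Rightarrow> (nat \<Rightarrow> 'a::euclidean_space) \<Rightarrow>
    (real \<times> ereal) measure" where
  "tuple_diagram F k x = (if birth F k x = \<infinity> then null_point_measure DeltaL
     else return (borel_of DeltaL) (real_of_ereal (birth F k x), death F k x))"

end

theory Submission
  imports Defs
begin

text \<open>
  For small \<open>r\<^sub>n\<close> a persistence pair with bounded birth time needs \<open>k + 2\<close> points within distance
  of order \<open>r\<^sub>n\<close>, and a test function in \<open>C\<^sub>0\<close> only sees pairs with bounded birth time near the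
  null measure. Let \<open>T\<^sub>n\<close> tend to infinity slowly. Up to probability \<open>o(n\<^sup>k\<^sup>+\<^sup>2 r\<^sub>n\<^sup>d\<^sup>(\<^sup>k\<^sup>+\<^sup>1\<^sup>))\<close> at most one
  such cluster exists even at the scale \<open>r\<^sub>n T\<^sub>n\<close>, and then the diagram agrees with the Dirac
  measure of the cluster for all birth times up to \<open>T\<^sub>n\<close>, because a cycle of \<open>k + 2\<close> points born at
  time \<open>b\<close> dies by time \<open>2b\<close>. Since \<open>T\<^sub>n\<close> tends to infinity, this agreement is vague convergence.
  By exchangeability it remains to integrate over the first \<open>k + 2\<close> points; writing them as
  \<open>x, x + r\<^sub>n y\<^sub>1, \<dots>, x + r\<^sub>n y\<^sub>k\<^sub>+\<^sub>1\<close> with all other points kept random, the integrands converge almost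
  everywhere, and dominated convergence applies directly, without a portmanteau theorem.
\<close>

section \<open>Homology of complexes with a single potential cycle\<close>

text \<open>A test function in C0 vanishes near the null measure, so it is nonzero only if some pair
  is born up to a fixed time \<open>T0\<close>. Its value, however, may depend on pairs born
  arbitrarily late, so isolation at a fixed multiple of \<open>r n\<close> would not determine it.
  The scale of isolation has to grow, and only as slowly as the factor
  \<open>T n ^ (DIM('a) * (2 * k + 2))\<close> in the crowding bound permits. For a fixed rescaled
  configuration isolation need not hold for all large \<open>n\<close>; it fails on a set of
  vanishing weight, where the integrand is replaced by its limit before domination is applied. A
  second obstacle is measurability: the atoms of the diagram move and merge with the points. The
  multiplicities depend only on the order of the Cech times of finitely many index sets, which is
  why homology is shown invariant under relabelling. In \<open>C\<^sub>k\<close> the factorial comes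
  from \<open>n choose (k + 2)\<close>, and the power of \<open>f\<close> from its continuity at the
  base point.\<close>

definition alternating :: "('a list \<Rightarrow> 'f::field) \<Rightarrow> bool" where
  "alternating c \<longleftrightarrow> (\<forall>us v w vs. c (us @ w # v # vs) = - c (us @ v # w # vs))"

lemma alternatingD: "alternating c \<Longrightarrow> c (us @ w # v # vs) = - c (us @ v # w # vs)"
  unfolding alternating_def by blast

lemma chains_iff:
  "c \<in> chains p K \<longleftrightarrow> finite {xs. c xs \<noteq> 0} \<and>
    (\<forall>xs. c xs \<noteq> 0 \<longrightarrow> length xs = p + 1 \<and> distinct xs \<and> set xs \<in> K) \<and> alternating c"
  unfolding chains_def alternating_def by blast

text \<open>One adjacent transposition per position. Only vanishing is tracked, so the sign of the
  move may be dropped.\<close>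

lemma alternating_front:
  assumes "alternating c"
  shows "c (us @ x # vs) = 0 \<longleftrightarrow> c (x # us @ vs) = 0"
proof (induction us arbitrary: vs rule: rev_induct)
  case (snoc u us)
  have "c ((us @ [u]) @ x # vs) = - c (us @ x # u # vs)"
    using alternatingD[OF assms, of us x u vs] by simp
  then show ?case using snoc.IH[of "u # vs"] by simp
qed simp

lemma alternating_Cons: "alternating c \<Longrightarrow> alternating (\<lambda>xs. c (x # xs))"
  unfolding alternating_def by (metis append_Cons)

text \<open>The induction varies \<open>c\<close>: once the head \<open>x\<close> is pulled to the
  front of \<open>ys\<close>, the tails are compared for the alternating function that prepends
  \<open>x\<close>.\<close>

lemma alternating_permute_zero:
  assumes "alternating c" "mset xs = mset ys" "c xs = 0"
  shows "c ys = 0"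
  using assms
proof (induction xs arbitrary: c ys)
  case (Cons x xs)
  have "x \<in> set ys"
    using Cons.prems(2) by (metis list.set_intros(1) set_mset_mset)
  then obtain us vs where ys: "ys = us @ x # vs"
    by (auto simp: in_set_conv_decomp)
  have "mset xs = mset (us @ vs)"
    using Cons.prems(2) by (simp add: ys)
  then have "c (x # us @ vs) = 0"
    by (rule Cons.IH[OF alternating_Cons[OF Cons.prems(1)] _ Cons.prems(3)])
  then show ?case
    using alternating_front[OF Cons.prems(1)] by (simp add: ys)
qed simp

lemma alternating_permute_zero':
  assumes "alternating c" "distinct xs" "distinct ys" "set xs = set ys" "c xs = 0"
  shows "c ys = 0"
  using assms alternating_permute_zero by (metis set_eq_iff_mset_eq_distinct)

lemma chains_alternating: "c \<in> chains p K \<Longrightarrow> alternating c"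
  by (simp add: chains_iff)

lemma alternating_boundary: "alternating c \<Longrightarrow> alternating (boundary c)"
  unfolding alternating_def boundary_def
proof (intro allI)
  fix us v w vs
  assume "\<forall>us v w vs. c (us @ w # v # vs) = - c (us @ v # w # vs)"
  then have *: "c (x # us @ w # v # vs) = - c (x # us @ v # w # vs)" for x
    by (metis append_Cons)
  show "(if us @ w # v # vs = [] then 0 else sum (\<lambda>x. c (x # us @ w # v # vs)) {x. c (x # us @ w # v # vs) \<noteq> 0}) =
    - (if us @ v # w # vs = [] then 0 else sum (\<lambda>x. c (x # us @ v # w # vs)) {x. c (x # us @ v # w # vs) \<noteq> 0})"
    by (simp add: * sum_negf)
qed

section \<open>Signs of orderings and elementary chains\<close>

text \<open>The sign of the permutation that sorts the list by \<open>h\<close>: the exponents add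
  up to the number of inversions. An injective \<open>h\<close> stands in for a vertex order, which
  the type \<open>'a\<close> does not have.\<close>

primrec orientation :: "('a \<Rightarrow> nat) \<Rightarrow> 'a list \<Rightarrow> 'f::field" where
  "orientation h [] = 1"
| "orientation h (v # vs) = (-1) ^ card {w \<in> set vs. h w < h v} * orientation h vs"

text \<open>Only the pair \<open>v\<close>, \<open>w\<close> changes its relative order, so the
  number of inversions changes by one; \<open>h v \<noteq> h w\<close> excludes a tie.\<close>

lemma orientation_swap:
  assumes "distinct (us @ v # w # vs)" "h v \<noteq> h w"
  shows "orientation h (us @ w # v # vs) = - orientation h (us @ v # w # vs)"
  using assms
proof (induction us)
  case Nil
  have *: "card {x \<in> set (v # vs). h x < h w} =
      card {x \<in> set vs. h x < h w} + of_bool (h v < h w)" if "v \<notin> set vs" for v w vs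
  proof -
    have "{x \<in> set (v # vs). h x < h w} =
        (if h v < h w then insert v {x \<in> set vs. h x < h w} else {x \<in> set vs. h x < h w})"
      by auto
    then show ?thesis using that by simp
  qed
  have "h v < h w \<longleftrightarrow> \<not> h w < h v"
    using Nil by auto
  then show ?case
    using Nil *[of v vs w] *[of w vs v] by (cases "h v < h w") (simp_all add: algebra_simps)
next
  case (Cons u us)
  have "set (us @ w # v # vs) = set (us @ v # w # vs)"
    by auto
  with Cons show ?case by (simp del: set_append)
qed

lemma orientation_nonzero: "orientation h xs \<noteq> 0"
  by (induction xs) auto

text \<open>The elementary chain of the simplex \<open>A\<close> with the orientation given by
  \<open>h\<close>.\<close>

definition simplex_chain :: "('a \<Rightarrow> nat) \<Rightarrow> 'a set \<Rightarrow> 'a list \<Rightarrow> 'f::field" where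
  "simplex_chain h A xs = (if distinct xs \<and> set xs = A then orientation h xs else 0)"

lemma alternating_simplex_chain:
  fixes A :: "'a set"
  assumes "inj_on h A"
  shows "alternating (simplex_chain h A)"
  unfolding alternating_def
proof (intro allI)
  fix us vs :: "'a list" and v w :: 'a
  have set: "set (us @ w # v # vs) = set (us @ v # w # vs)"
    by auto
  have dist: "distinct (us @ w # v # vs) = distinct (us @ v # w # vs)"
    by auto
  show "simplex_chain h A (us @ w # v # vs) = - simplex_chain h A (us @ v # w # vs)"
  proof (cases "distinct (us @ v # w # vs) \<and> set (us @ v # w # vs) = A")
    case True
    then have "v \<noteq> w" "v \<in> A" "w \<in> A" by auto
    then have "h v \<noteq> h w" using assms by (auto simp: inj_on_def)
    then show ?thesis
      using True orientation_swap[of us v w vs h] set dist by (simp add: simplex_chain_def)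
  next
    case False
    then show ?thesis using set dist by (auto simp: simplex_chain_def)
  qed
qed

lemma finite_lists_in: "finite A \<Longrightarrow> finite {xs. distinct xs \<and> set xs \<subseteq> A}"
  using finite_subset_distinct[of A] by (simp add: conj_commute)

lemma chainsI:
  assumes "finite A" "alternating c"
    and "\<And>xs. c xs \<noteq> 0 \<Longrightarrow> length xs = p + 1 \<and> distinct xs \<and> set xs \<in> K \<and> set xs \<subseteq> A"
  shows "c \<in> chains p K"
proof -
  have "{xs. c xs \<noteq> 0} \<subseteq> {xs. distinct xs \<and> set xs \<subseteq> A}"
    using assms(3) by blast
  then have "finite {xs. c xs \<noteq> 0}"
    using finite_lists_in[OF assms(1)] finite_subset by blast
  then show ?thesis
    using assms by (auto simp: chains_iff)
qed

lemma simplex_chain_in_chains: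
  assumes "finite A" "card A = p + 1" "A \<in> K" "inj_on h A"
  shows "simplex_chain h A \<in> chains p K"
  using assms alternating_simplex_chain[OF assms(4)]
  by (intro chainsI[of A]) (auto simp: simplex_chain_def distinct_card split: if_splits)

text \<open>On an ordered facet only the one missing vertex can be prepended, so the sum that
  defines the boundary has a single term.\<close>

lemma boundary_simplex_chain:
  assumes "distinct ys" "ys \<noteq> []" "v \<notin> set ys" "insert v (set ys) = A"
  shows "boundary (simplex_chain h A) ys = (simplex_chain h A (v # ys) :: 'f::field)"
proof -
  have "{x. simplex_chain h A (x # ys) \<noteq> (0::'f)} = {v}"
    using assms by (auto simp: simplex_chain_def orientation_nonzero)
  then show ?thesis using assms(2) unfolding boundary_def by simp
qed

lemma boundary_simplex_chain_support:
  assumes "boundary (simplex_chain h A) ys \<noteq> (0::'f::field)"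
  obtains v where "distinct ys" "ys \<noteq> []" "v \<notin> set ys" "insert v (set ys) = A"
proof -
  obtain v where "simplex_chain h A (v # ys) \<noteq> (0::'f)" "ys \<noteq> []"
    using assms unfolding boundary_def by (metis (mono_tags, lifting) sum.not_neutral_contains_not_neutral)
  then show ?thesis by (intro that[of v]) (auto simp: simplex_chain_def split: if_splits)
qed

text \<open>A list \<open>zs\<close> that matters misses exactly two vertices \<open>u\<close> and
  \<open>v\<close> of \<open>A\<close>. The two terms of the sum are the values on
  \<open>v # u # zs\<close> and \<open>u # v # zs\<close>, which are opposite. No division by two
  occurs, so characteristic two is included.\<close>

lemma boundary_boundary_simplex_chain:
  fixes A :: "'a set"
  assumes "inj_on h A"
  shows "boundary (boundary (simplex_chain h A)) = (\<lambda>_. 0 :: 'f::field)"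
proof
  fix zs
  let ?z = "boundary (simplex_chain h A) :: 'a list \<Rightarrow> 'f"
  show "boundary ?z zs = 0"
  proof (cases "zs = [] \<or> (\<forall>u. ?z (u # zs) = 0)")
    case True
    then show ?thesis unfolding boundary_def[of ?z] by auto
  next
    case False
    then obtain u where u: "zs \<noteq> []" "?z (u # zs) \<noteq> 0" by blast
    then obtain v where v: "distinct (u # zs)" "v \<notin> set (u # zs)" "insert v (set (u # zs)) = A"
      by (elim boundary_simplex_chain_support)
    have z: "?z (u # zs) = simplex_chain h A (v # u # zs)" "?z (v # zs) = simplex_chain h A (u # v # zs)"
      using v by (auto intro!: boundary_simplex_chain)
    have "?z (v # zs) = - ?z (u # zs)"
      using alternatingD[OF alternating_simplex_chain[OF assms], of "[]" u v zs] unfolding z append_Nil .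
    moreover have "{x. ?z (x # zs) \<noteq> 0} = {u, v}"
    proof (intro equalityI subsetI)
      fix x assume "x \<in> {x. ?z (x # zs) \<noteq> 0}"
      then have "?z (x # zs) \<noteq> 0" by simp
      then obtain y where y: "distinct (x # zs)" "y \<notin> set (x # zs)" "insert y (set (x # zs)) = A"
        by (rule boundary_simplex_chain_support)
      then show "x \<in> {u, v}" using v by auto
    qed (use u \<open>?z (v # zs) = - ?z (u # zs)\<close> in auto)
    ultimately show ?thesis
      using v u unfolding boundary_def[of ?z] by auto
  qed
qed

text \<open>The faces of \<open>A\<close> are linked by common subfaces, on which a cycle has two opposite values.\<close>

lemma cycle_zero_if_zero_on_face:
  fixes A :: "'a set"
  assumes k: "k \<ge> 1" and A: "finite A" "card A = k + 2"
    and c: "alternating c" "\<And>xs. c xs \<noteq> 0 \<Longrightarrow> length xs = k + 1 \<and> distinct xs \<and> set xs \<subseteq> A"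
    and bd: "boundary c = (\<lambda>_. 0)"
    and xs: "length xs = k + 1" "distinct xs" "set xs \<subseteq> A" "c xs = 0"
  shows "c = (\<lambda>_. 0)"
proof
  fix ys
  show "c ys = 0"
  proof (rule ccontr)
    assume ys0: "c ys \<noteq> 0"
    then have ys: "length ys = k + 1" "distinct ys" "set ys \<subseteq> A" using c(2) by auto
    have "card (A - set xs) = 1" "card (A - set ys) = 1"
      using xs ys A by (simp_all add: card_Diff_subset distinct_card)
    then obtain v w where v: "A - set xs = {v}" and w: "A - set ys = {w}"
      by (auto simp: card_1_singleton_iff)
    have "v \<noteq> w"
    proof
      assume "v = w"
      then have "set xs = set ys" using v w xs ys by blast
      then show False using alternating_permute_zero'[OF c(1) xs(2) ys(2)] xs ys0 by simp
    qed
    \<comment> \<open>The face \<open>xs\<close> omits \<open>v\<close> and \<open>ys\<close> omits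
      \<open>w\<close>; \<open>zs\<close> orders the subface they share. Among the lists
      \<open>x # zs\<close> only \<open>v # zs\<close> will carry a nonzero value, so nothing
      cancels it in the boundary at \<open>zs\<close>.\<close>
    obtain zs where zs: "set zs = A - {v, w}" "distinct zs"
      using finite_distinct_list[of "A - {v,w}"] A by auto
    have vw: "v \<in> A" "w \<in> A" using v w by auto
    then have "card (A - {v, w}) = k" using A \<open>v \<noteq> w\<close> by (simp add: card_Diff_subset)
    then have "length zs = k" using zs by (metis distinct_card)
    \<comment> \<open>The boundary is 0 on the empty list by definition, so a nonempty common
      subface is needed; this is where \<open>k \<ge> 1\<close> enters.\<close>
    then have "zs \<noteq> []" using k by auto
    have "set (w # zs) = set xs" using zs v vw \<open>v \<noteq> w\<close> xs by auto
    then have w0: "c (w # zs) = 0"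
      using alternating_permute_zero'[OF c(1) xs(2), of "w # zs"] xs zs by auto
    have "set (v # zs) = set ys" using zs w vw \<open>v \<noteq> w\<close> ys by auto
    then have v0: "c (v # zs) \<noteq> 0"
      using alternating_permute_zero'[OF c(1) _ ys(2), of "v # zs"] ys0 zs by auto
    have "{x. c (x # zs) \<noteq> 0} = {v}"
    proof (intro equalityI subsetI)
      fix x assume x: "x \<in> {x. c (x # zs) \<noteq> 0}"
      then have "x \<in> A" "x \<notin> set zs" using c(2)[of "x # zs"] by auto
      then show "x \<in> {v}" using zs w0 x by auto
    qed (use v0 in auto)
    then have "boundary c zs = c (v # zs)" using \<open>zs \<noteq> []\<close> unfolding boundary_def by simp
    then show False using v0 bd by simp
  qed
qed

text \<open>The support of a cycle has no free facet: a single term in the boundary at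
  \<open>ys\<close> could not cancel.\<close>

lemma cycle_neighbour:
  assumes "k \<ge> 1" "c \<in> cycles k K" "c (u # ys) \<noteq> 0"
  obtains w where "w \<noteq> u" "c (w # ys) \<noteq> 0"
proof (rule ccontr)
  assume *: "\<not> thesis"
  have "{x. c (x # ys) \<noteq> 0} = {u}" using * that assms by blast
  moreover have "length (u # ys) = k + 1" using assms by (auto simp: cycles_def chains_iff)
  ultimately have "boundary c ys = c (u # ys)" using assms(1) unfolding boundary_def by auto
  then show False using assms by (auto simp: cycles_def)
qed

text \<open>The combinatorial content of a nonzero cycle: two simplices with a common facet, hence
  \<open>k + 2\<close> linked vertices. The cluster arguments start from this.\<close>

lemma cycles_nonzeroD:
  assumes "k \<ge> 1" "c \<in> cycles k K" "c xs \<noteq> 0"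
  obtains u w ys where "xs = u # ys" "u \<noteq> w" "length ys = k" "distinct (u # ys)" "distinct (w # ys)"
    "set (u # ys) \<in> K" "set (w # ys) \<in> K"
proof -
  obtain u ys where xs: "xs = u # ys" 
    using assms by (cases xs) (auto simp: cycles_def chains_iff)
  obtain w where "w \<noteq> u" "c (w # ys) \<noteq> 0" using cycle_neighbour assms xs by metis
  moreover have "length zs = k + 1 \<and> distinct zs \<and> set zs \<in> K" if "c zs \<noteq> 0" for zs
    using assms that by (auto simp: cycles_def chains_iff)
  ultimately show ?thesis using assms(3) xs that[of u ys w] by fastforce
qed

section \<open>The vector space of chains\<close>

lemma zero_in_chains: "(\<lambda>_. 0) \<in> chains p K"
  by (simp add: chains_iff alternating_def)

lemma zero_in_cycles: "(\<lambda>_. 0) \<in> cycles p K"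
  by (simp add: cycles_def zero_in_chains boundary_def fun_eq_iff)

lemma boundary_zero: "boundary (\<lambda>_. 0) = (\<lambda>_. 0)"
  by (simp add: boundary_def fun_eq_iff)

lemma boundary_scale: "boundary (chain_scale a c) = chain_scale a (boundary c)"
proof (cases "a = 0")
  case False
  then show ?thesis by (simp add: boundary_def chain_scale_def fun_eq_iff sum_distrib_left)
qed (simp add: boundary_def chain_scale_def fun_eq_iff)

lemma chain_scale_in_chains: "c \<in> chains p K \<Longrightarrow> chain_scale a c \<in> chains p K"
proof -
  assume c: "c \<in> chains p K"
  then have "finite {xs. chain_scale a c xs \<noteq> 0}"
    by (auto simp: chains_iff chain_scale_def elim!: rev_finite_subset)
  moreover have "alternating (chain_scale a c)"
    unfolding alternating_def chain_scale_def
  proof (intro allI)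
    fix us v w vs
    show "a * c (us @ w # v # vs) = - (a * c (us @ v # w # vs))"
      using alternatingD[OF chains_alternating[OF c], of us w v vs] by simp
  qed
  ultimately show ?thesis using c by (auto simp: chains_iff chain_scale_def)
qed

lemma chain_scale_in_cycles: "c \<in> cycles p K \<Longrightarrow> chain_scale a c \<in> cycles p K"
  using chain_scale_in_chains[of c p K a] boundary_scale[of a c] by (simp add: cycles_def) (simp add: chain_scale_def)

lemma chain_dim_zero: "chain_dim {\<lambda>_. 0 :: 'f::field} = 0"
  using chain.dim_le_card[of "{\<lambda>_. 0}" "{} :: ('a list \<Rightarrow> 'f) set"]
  by (simp add: zero_fun_def chain_dim_def)

lemma chain_dim_span_singleton:
  fixes z :: "'a list \<Rightarrow> 'f::field"
  assumes "z \<noteq> (\<lambda>_. 0)"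
  shows "chain_dim (chain.span {z}) = 1"
proof -
  have "\<not> chain.dependent {z}"
    using assms by (simp add: chain.independent_insert zero_fun_def)
  then show ?thesis
    using chain.dim_span_eq_card_independent[of "{z}"] by (simp add: chain_dim_def)
qed

lemma span_singleton_scale: "chain.span {z} = range (\<lambda>a. chain_scale a z)"
  by (rule chain.span_singleton)

text \<open>The range of summation in \<open>boundary\<close> depends on the chain, so all three
  sums are first extended to the union of the two finite supports.\<close>

lemma boundary_diff:
  assumes "c \<in> chains p K" "c' \<in> chains p K"
  shows "boundary (\<lambda>xs. c xs - c' xs) = (\<lambda>ys. boundary c ys - boundary c' ys)"
proof
  fix ys
  have fin: "finite {x. d (x # ys) \<noteq> 0}" if "d \<in> chains p K" for d :: "'a list \<Rightarrow> 'b"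
  proof -
    have "finite {xs. d xs \<noteq> 0}" using that by (simp add: chains_iff)
    then have "finite ((\<lambda>x. x # ys) -` {xs. d xs \<noteq> 0})" by (rule finite_vimageI) (auto simp: inj_def)
    then show ?thesis by (simp add: vimage_def)
  qed
  let ?S = "{x. c (x # ys) \<noteq> 0} \<union> {x. c' (x # ys) \<noteq> 0}"
  have S: "finite ?S" using fin assms by blast
  have "(\<Sum>x | c (x # ys) - c' (x # ys) \<noteq> 0. c (x # ys) - c' (x # ys)) = (\<Sum>x\<in>?S. c (x # ys) - c' (x # ys))"
    using S by (intro sum.mono_neutral_left) auto
  also have "\<dots> = (\<Sum>x\<in>?S. c (x # ys)) - (\<Sum>x\<in>?S. c' (x # ys))" by (rule sum_subtractf)
  also have "(\<Sum>x\<in>?S. c (x # ys)) = (\<Sum>x | c (x # ys) \<noteq> 0. c (x # ys))"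
    using S by (intro sum.mono_neutral_right) auto
  also have "(\<Sum>x\<in>?S. c' (x # ys)) = (\<Sum>x | c' (x # ys) \<noteq> 0. c' (x # ys))"
    using S by (intro sum.mono_neutral_right) auto
  finally show "boundary (\<lambda>xs. c xs - c' xs) ys = boundary c ys - boundary c' ys"
    by (simp add: boundary_def)
qed

lemma chains_diff:
  assumes "c \<in> chains p K" "c' \<in> chains p K"
  shows "(\<lambda>xs. c xs - c' xs) \<in> chains p K"
proof -
  have "{xs. c xs - c' xs \<noteq> 0} \<subseteq> {xs. c xs \<noteq> 0} \<union> {xs. c' xs \<noteq> 0}" by auto
  moreover have "finite ({xs. c xs \<noteq> 0} \<union> {xs. c' xs \<noteq> 0})" using assms by (simp add: chains_iff)
  ultimately have "finite {xs. c xs - c' xs \<noteq> 0}" using finite_subset by blast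
  moreover have "length xs = p + 1 \<and> distinct xs \<and> set xs \<in> K" if "c xs - c' xs \<noteq> 0" for xs
  proof -
    have "c xs \<noteq> 0 \<or> c' xs \<noteq> 0" using that by auto
    then show ?thesis using assms unfolding chains_iff by blast
  qed
  moreover have "alternating (\<lambda>xs. c xs - c' xs)"
    unfolding alternating_def
  proof (intro allI)
    fix us v w vs
    show "c (us @ w # v # vs) - c' (us @ w # v # vs) = - (c (us @ v # w # vs) - c' (us @ v # w # vs))"
      using alternatingD[OF chains_alternating[OF assms(1)], of us w v vs]
        alternatingD[OF chains_alternating[OF assms(2)], of us w v vs] by simp
  qed
  ultimately show ?thesis unfolding chains_iff by blast
qed

lemma ex_inj_nat: "finite A \<Longrightarrow> \<exists>h::'a \<Rightarrow> nat. inj_on h A"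
  using finite_imp_inj_to_nat_seg by blast

lemma boundary_simplex_chain_nonzero:
  fixes A :: "'a set"
  assumes "finite A" "card A \<ge> 2"
  shows "boundary (simplex_chain h A) \<noteq> (\<lambda>_. 0 :: 'b::field)"
proof -
  obtain v where "v \<in> A" using assms by fastforce
  obtain ys where ys: "set ys = A - {v}" "distinct ys"
    using finite_distinct_list[of "A - {v}"] assms by auto
  have "card (A - {v}) \<ge> 1" using assms \<open>v \<in> A\<close> by simp
  then have "set ys \<noteq> {}" unfolding ys(1) by force
  then have "ys \<noteq> []" by auto
  moreover have v: "v \<notin> set ys" "insert v (set ys) = A"
    unfolding ys(1) using \<open>v \<in> A\<close> by (simp_all add: insert_absorb)
  ultimately have "boundary (simplex_chain h A) ys = (simplex_chain h A (v # ys) :: 'b)"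
    by (rule boundary_simplex_chain[OF ys(2)])
  moreover have "simplex_chain h A (v # ys) \<noteq> (0::'b)"
    using ys(2) v unfolding simplex_chain_def by (simp add: orientation_nonzero)
  ultimately show ?thesis by auto
qed

lemma boundary_simplex_chain_in_cycles:
  fixes A :: "'a set"
  assumes "finite A" "card A = k + 2" "inj_on h A" "\<forall>a\<in>A. A - {a} \<in> K"
  shows "(boundary (simplex_chain h A) :: 'a list \<Rightarrow> 'b::field) \<in> cycles k K"
proof -
  have "boundary (simplex_chain h A :: _ \<Rightarrow> 'b) \<in> chains k K"
  proof (rule chainsI[OF assms(1)])
    show "alternating (boundary (simplex_chain h A :: _ \<Rightarrow> 'b))"
      using alternating_boundary alternating_simplex_chain[OF assms(3)] by blast
    fix xs assume "boundary (simplex_chain h A :: _ \<Rightarrow> 'b) xs \<noteq> 0"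
    then obtain v where v: "distinct xs" "v \<notin> set xs" "insert v (set xs) = A"
      by (elim boundary_simplex_chain_support)
    then have "set xs = A - {v}" "v \<in> A" by auto
    moreover have "card (A - {v}) = k + 1" using assms \<open>v \<in> A\<close> by simp
    ultimately show "length xs = k + 1 \<and> distinct xs \<and> set xs \<in> K \<and> set xs \<subseteq> A"
      using v assms(4) distinct_card[of xs] by auto
  qed
  then show ?thesis using boundary_boundary_simplex_chain[OF assms(3)] by (auto simp: cycles_def)
qed

section \<open>Cycle spaces and Betti numbers when a single cycle is possible\<close>

lemma cycles_subset:
  assumes k: "k \<ge> 1"
    and link: "\<And>u w ys. u \<noteq> w \<Longrightarrow> length ys = k \<Longrightarrow> distinct (u # ys) \<Longrightarrow> distinct (w # ys) \<Longrightarrow>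
      set (u # ys) \<in> K \<Longrightarrow> set (w # ys) \<in> K \<Longrightarrow> insert u (insert w (set ys)) = A"
    and c: "c \<in> cycles k K" "c xs \<noteq> 0"
  shows "length xs = k + 1 \<and> distinct xs \<and> set xs \<subseteq> A"
proof -
  obtain u w ys where *: "xs = u # ys" "u \<noteq> w" "length ys = k" "distinct (u # ys)" "distinct (w # ys)"
      "set (u # ys) \<in> K" "set (w # ys) \<in> K"
    using cycles_nonzeroD[OF k c] .
  then show ?thesis using link[OF *(2-)] by auto
qed

text \<open>By \<open>link\<close> every cycle is supported on the facets of \<open>A\<close>, even
  if \<open>K\<close> has other simplices, and then one facet determines it. If all facets are
  present, subtracting the multiple of the boundary of \<open>A\<close> that matches on one facet
  leaves zero. If a facet is missing, the cycle vanishes there and hence everywhere.\<close>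

lemma cycles_eq_span:
  fixes A :: "'a set"
  assumes k: "k \<ge> 1" and A: "finite A" "card A = k + 2" "inj_on h A"
    and link: "\<And>u w ys. u \<noteq> w \<Longrightarrow> length ys = k \<Longrightarrow> distinct (u # ys) \<Longrightarrow> distinct (w # ys) \<Longrightarrow>
      set (u # ys) \<in> K \<Longrightarrow> set (w # ys) \<in> K \<Longrightarrow> insert u (insert w (set ys)) = A"
  shows "cycles k K = (if \<forall>a\<in>A. A - {a} \<in> K then chain.span {boundary (simplex_chain h A)} else {\<lambda>_. 0 :: 'f::field})"
proof -
  let ?z = "boundary (simplex_chain h A) :: 'a list \<Rightarrow> 'f"
  note supp = cycles_subset[OF k link]
  have zero: "c = (\<lambda>_. 0)" if c: "c \<in> cycles k K" and xs: "length xs = k + 1" "distinct xs" "set xs \<subseteq> A" "c xs = 0"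
    for c :: "'a list \<Rightarrow> 'f" and xs
  proof (rule cycle_zero_if_zero_on_face[where c=c, OF k A(1,2) _ _ _ xs])
    show "alternating c" "boundary c = (\<lambda>_. 0)" using c chains_alternating by (auto simp: cycles_def)
    show "length ys = k + 1 \<and> distinct ys \<and> set ys \<subseteq> A" if "c ys \<noteq> 0" for ys
      using supp c that by blast
  qed
  show ?thesis
  proof (cases "\<forall>a\<in>A. A - {a} \<in> K")
    case True
    have z: "?z \<in> cycles k K" by (rule boundary_simplex_chain_in_cycles[OF A True])
    have "?z \<noteq> (\<lambda>_. 0)" using A by (intro boundary_simplex_chain_nonzero) auto
    then obtain xs where xs0: "?z xs \<noteq> 0" by (meson ext)
    then have xs: "length xs = k + 1" "distinct xs" "set xs \<subseteq> A" using supp z by blast+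
    have "cycles k K = chain.span {?z}"
    proof (intro equalityI subsetI)
      fix c :: "'a list \<Rightarrow> 'f" assume c: "c \<in> cycles k K"
      define a where "a = c xs / ?z xs"
      have "(\<lambda>ys. c ys - chain_scale a ?z ys) \<in> cycles k K"
        using c z chains_diff[of c k K "chain_scale a ?z"] boundary_diff[of c k K "chain_scale a ?z"]
          chain_scale_in_chains[of ?z k K a]
        by (auto simp: cycles_def boundary_scale) (auto simp: chain_scale_def)
      from zero[OF this xs] have "(\<lambda>ys. c ys - chain_scale a ?z ys) = (\<lambda>_. 0)"
        using xs0 by (simp add: chain_scale_def a_def)
      then have "c = chain_scale a ?z"
        by (intro ext) (simp add: fun_eq_iff)
      then show "c \<in> chain.span {?z}" unfolding span_singleton_scale by blast
    next
      fix c assume "c \<in> chain.span {?z}"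
      then obtain a where "c = chain_scale a ?z" unfolding span_singleton_scale by blast
      then show "c \<in> cycles k K"
        using z chain_scale_in_cycles by blast
    qed
    then show ?thesis using True by simp
  next
    case False
    then obtain a where a: "a \<in> A" "A - {a} \<notin> K" by blast
    obtain xs where xs: "set xs = A - {a}" "distinct xs" using finite_distinct_list[of "A - {a}"] A by auto
    have "length xs = k + 1" using distinct_card[OF xs(2)] xs(1) A a by simp
    then have "c = (\<lambda>_. 0)" if c: "c \<in> cycles k K" for c :: "'a list \<Rightarrow> 'f"
    proof (rule zero[OF c])
      show "c xs = 0" using c a(2) xs(1) unfolding cycles_def chains_iff by auto
    qed (use xs in auto)
    then show ?thesis using False zero_in_cycles[of k K] by auto
  qed
qed

lemma boundaries_trivial:
  fixes L :: "'a set set"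
  assumes "\<And>\<sigma>. \<sigma> \<in> L \<Longrightarrow> card \<sigma> \<noteq> k + 2"
  shows "boundaries k L = {\<lambda>_. 0 :: 'f::field}"
proof -
  have "c = (\<lambda>_. 0)" if "c \<in> chains (k + 1) L" for c :: "'a list \<Rightarrow> 'f"
  proof (rule ccontr)
    assume "c \<noteq> (\<lambda>_. 0)"
    then obtain xs where "c xs \<noteq> 0" by (meson ext)
    then have "length xs = k + 2" "distinct xs" "set xs \<in> L" using that by (auto simp: chains_iff)
    then show False using assms[of "set xs"] by (simp add: distinct_card)
  qed
  then have "chains (k + 1) L = {\<lambda>_. 0 :: 'f}" using zero_in_chains by blast
  then show ?thesis unfolding boundaries_def by (simp only: image_insert image_empty boundary_zero)
qed

lemma span_simplex_subset_boundaries: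
  fixes A :: "'a set"
  assumes "finite A" "card A = k + 2" "inj_on h A" "A \<in> L"
  shows "chain.span {boundary (simplex_chain h A) :: 'a list \<Rightarrow> 'b::field} \<subseteq> boundaries k L"
proof
  fix c :: "'a list \<Rightarrow> 'b" assume "c \<in> chain.span {boundary (simplex_chain h A)}"
  then obtain a where "c = boundary (chain_scale a (simplex_chain h A))"
    unfolding span_singleton_scale by (auto simp: boundary_scale)
  moreover have "chain_scale a (simplex_chain h A :: 'a list \<Rightarrow> 'b) \<in> chains (k + 1) L"
    using assms by (intro chain_scale_in_chains simplex_chain_in_chains) auto
  ultimately show "c \<in> boundaries k L" by (auto simp: boundaries_def)
qed

text \<open>The dichotomy asked of \<open>L\<close> avoids comparing the cycle with boundaries of
  other simplices: either \<open>A\<close> itself bounds the cycle, or \<open>L\<close> has no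
  simplex on \<open>k + 2\<close> vertices and hence no nonzero boundary. It is asked only if all
  facets lie in \<open>K\<close>, since otherwise there is no cycle to kill.\<close>

lemma persistent_betti_single:
  fixes F :: "'f::field itself" and A :: "'a set"
  assumes k: "k \<ge> 1" and A: "finite A" "card A = k + 2"
    and link: "\<And>u w ys. u \<noteq> w \<Longrightarrow> length ys = k \<Longrightarrow> distinct (u # ys) \<Longrightarrow> distinct (w # ys) \<Longrightarrow>
      set (u # ys) \<in> K \<Longrightarrow> set (w # ys) \<in> K \<Longrightarrow> insert u (insert w (set ys)) = A"
    and L: "(\<forall>a\<in>A. A - {a} \<in> K) \<Longrightarrow> A \<in> L \<or> (\<forall>\<sigma>\<in>L. card \<sigma> \<noteq> k + 2)"
  shows "persistent_betti F k K L = of_bool ((\<forall>a\<in>A. A - {a} \<in> K) \<and> A \<notin> L)"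
proof -
  obtain h :: "'a \<Rightarrow> nat" where h: "inj_on h A" using ex_inj_nat A by blast
  let ?z = "boundary (simplex_chain h A) :: 'a list \<Rightarrow> 'f"
  have Z: "cycles k K = (if \<forall>a\<in>A. A - {a} \<in> K then chain.span {?z} else {\<lambda>_. 0})"
    by (rule cycles_eq_span[OF k A h]) (rule link)
  have zn: "?z \<noteq> (\<lambda>_. 0)" using A by (intro boundary_simplex_chain_nonzero) auto
  have zero: "(\<lambda>_. 0) \<in> boundaries k L"
    unfolding boundaries_def by (rule image_eqI[where x="\<lambda>_. 0"]) (simp_all add: boundary_zero zero_in_chains)
  show ?thesis
  proof (cases "\<forall>a\<in>A. A - {a} \<in> K")
    case True
    then have Z': "cycles k K = chain.span {?z}" using Z by simp
    show ?thesis
    proof (cases "A \<in> L")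
      case True': True
      then have "cycles k K \<inter> boundaries k L = chain.span {?z}"
        using span_simplex_subset_boundaries[OF A h] Z' by blast
      then show ?thesis using Z' True True' by (simp add: persistent_betti_def)
    next
      case False
      then have "boundaries k L = {\<lambda>_. 0 :: 'f}" using L[OF True] by (intro boundaries_trivial) auto
      then have "cycles k K \<inter> boundaries k L = {\<lambda>_. 0 :: 'f}" using zero_in_cycles by blast
      then show ?thesis using Z' True False chain_dim_span_singleton[OF zn]
        by (simp add: persistent_betti_def chain_dim_zero)
    qed
  next
    case False
    have "cycles k K = {\<lambda>_. 0 :: 'f}" by (rule trans[OF Z if_not_P[OF False]])
    then show ?thesis using False by (auto simp: persistent_betti_def chain_dim_zero)
  qed
qed

lemma cycles_trivial:
  fixes K :: "'a set set"
  assumes "k \<ge> 1"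
    and "\<And>u w ys. u \<noteq> w \<Longrightarrow> length ys = k \<Longrightarrow> distinct (u # ys) \<Longrightarrow> distinct (w # ys) \<Longrightarrow>
      set (u # ys) \<in> K \<Longrightarrow> set (w # ys) \<in> K \<Longrightarrow> False"
  shows "cycles k K = {\<lambda>_. 0 :: 'f::field}"
proof -
  have "c = (\<lambda>_. 0)" if c: "c \<in> cycles k K" for c :: "'a list \<Rightarrow> 'f"
  proof (rule ccontr)
    assume "c \<noteq> (\<lambda>_. 0)"
    then obtain xs where "c xs \<noteq> 0" by (meson ext)
    then obtain u w ys where "xs = u # ys" and *: "u \<noteq> w" "length ys = k" "distinct (u # ys)" "distinct (w # ys)"
        "set (u # ys) \<in> K" "set (w # ys) \<in> K"
      by (rule cycles_nonzeroD[OF assms(1) c])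
    show False by (rule assms(2)[OF *])
  qed
  then show ?thesis using zero_in_cycles by blast
qed

lemma persistent_betti_trivial:
  fixes F :: "'f::field itself" and K :: "'a set set"
  assumes "cycles k K = {\<lambda>_. 0 :: 'f}"
  shows "persistent_betti F k K L = 0"
  using assms zero_in_cycles by (simp add: persistent_betti_def chain_dim_zero)

lemma betti_trivial:
  fixes F :: "'f::field itself" and K :: "'a set set"
  assumes "cycles k K = {\<lambda>_. 0 :: 'f}"
  shows "betti F k K = 0"
  using assms by (simp add: betti_def chain_dim_zero)

text \<open>\<open>betti\<close> subtracts the dimension of all boundaries, so it has to be known
  that boundaries are cycles. Inside \<open>Pow A\<close> the top chains are multiples of one
  elementary chain, for which the double boundary is already known to vanish.\<close>

lemma chains_top_simplex:
  fixes c :: "'a list \<Rightarrow> 'b::field"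
  assumes A: "finite A" "card A = k + 2" "inj_on h A" and K: "K \<subseteq> Pow A"
    and c: "c \<in> chains (k + 1) K"
  shows "\<exists>a. c = chain_scale a (simplex_chain h A)"
proof -
  let ?e = "simplex_chain h A :: 'a list \<Rightarrow> 'b"
  obtain xs where xs: "set xs = A" "distinct xs" using finite_distinct_list[OF A(1)] by blast
  then have e0: "?e xs \<noteq> 0" by (simp add: simplex_chain_def orientation_nonzero)
  define a where "a = c xs / ?e xs"
  have alt: "alternating (\<lambda>ys. c ys - a * ?e ys)"
    unfolding alternating_def
  proof (intro allI)
    fix us v w vs
    show "c (us @ w # v # vs) - a * ?e (us @ w # v # vs) = - (c (us @ v # w # vs) - a * ?e (us @ v # w # vs))"
      using alternatingD[OF chains_alternating[OF c], of us w v vs]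
        alternatingD[OF alternating_simplex_chain[OF A(3), where 'b='b], of us w v vs] by simp
  qed
  have "c ys - a * ?e ys = 0" for ys
  proof (cases "distinct ys \<and> set ys = A")
    case True
    then show ?thesis using alternating_permute_zero'[OF alt xs(2), of ys] xs e0 by (simp add: a_def)
  next
    case False
    have "c ys = 0"
    proof (rule ccontr)
      assume "c ys \<noteq> 0"
      then have "length ys = k + 2" "distinct ys" "set ys \<subseteq> A" using c K by (auto simp: chains_iff)
      then show False using False A by (metis card_subset_eq distinct_card)
    qed
    then show ?thesis using False by (auto simp: simplex_chain_def)
  qed
  then have "c = chain_scale a ?e" by (simp add: chain_scale_def fun_eq_iff)
  then show ?thesis by blast
qed

text \<open>The case \<open>L = K\<close> of \<open>persistent_betti_single\<close>: once boundaries
  are cycles, the intersection in \<open>persistent_betti\<close> is the space of all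
  boundaries.\<close>

lemma betti_single:
  fixes F :: "'f::field itself" and A :: "'a set"
  assumes k: "k \<ge> 1" and A: "finite A" "card A = k + 2" and K: "K \<subseteq> Pow A"
    and faces: "A \<in> K \<Longrightarrow> \<forall>a\<in>A. A - {a} \<in> K"
  shows "betti F k K = of_bool ((\<forall>a\<in>A. A - {a} \<in> K) \<and> A \<notin> K)"
proof -
  obtain h :: "'a \<Rightarrow> nat" where h: "inj_on h A" using ex_inj_nat A by blast
  have full: "\<sigma> = A" if "\<sigma> \<subseteq> A" "card \<sigma> = k + 2" for \<sigma> using that A card_subset_eq by metis
  have link: "insert u (insert w (set ys)) = A" if "u \<noteq> w" "length ys = k" "distinct (u # ys)" "distinct (w # ys)"
      "set (u # ys) \<in> K" "set (w # ys) \<in> K" for u w ys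
    using that K by (intro full) (auto simp: distinct_card)
  have Z: "cycles k K = (if \<forall>a\<in>A. A - {a} \<in> K then chain.span {boundary (simplex_chain h A) :: 'a list \<Rightarrow> 'f} else {\<lambda>_. 0})"
    by (rule cycles_eq_span[OF k A h]) (rule link)
  have "\<sigma> = A" if "\<sigma> \<in> K" "card \<sigma> = k + 2" for \<sigma> using full that K by blast
  then have "persistent_betti F k K K = of_bool ((\<forall>a\<in>A. A - {a} \<in> K) \<and> A \<notin> K)"
    by (intro persistent_betti_single[OF k A link]) auto
  moreover have "boundaries k K \<subseteq> (cycles k K :: ('a list \<Rightarrow> 'f) set)"
  proof (cases "A \<in> K")
    case True
    show ?thesis
    proof
      fix c :: "'a list \<Rightarrow> 'f" assume "c \<in> boundaries k K"
      then obtain e where "c = boundary e" "e \<in> chains (k + 1) K" by (auto simp: boundaries_def)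
      moreover obtain a where "e = chain_scale a (simplex_chain h A)"
        using chains_top_simplex[OF A h K] \<open>e \<in> _\<close> by blast
      ultimately have "c = chain_scale a (boundary (simplex_chain h A))" by (simp add: boundary_scale)
      then have "c \<in> chain.span {boundary (simplex_chain h A)}" unfolding span_singleton_scale by (intro range_eqI)
      then show "c \<in> cycles k K" using Z faces[OF True] by simp
    qed
  next
    case False
    then have "boundaries k K = {\<lambda>_. 0 :: 'f}"
      using \<open>\<And>\<sigma>. \<sigma> \<in> K \<Longrightarrow> card \<sigma> = k + 2 \<Longrightarrow> \<sigma> = A\<close> by (intro boundaries_trivial) blast
    then show ?thesis using zero_in_cycles by auto
  qed
  ultimately show ?thesis by (simp add: betti_def persistent_betti_def Int_absorb1)
qed

section \<open>Invariance under relabelling\<close>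

text \<open>Relabelling pulls chains back along \<open>map \<pi>\<close>, from the relabelled
  complex to the original one. For a bijection of the whole types the boundary sum is merely
  reindexed. These invariances serve the measurability of the diagram.\<close>

lemma boundary_relabel:
  assumes "bij \<pi>"
  shows "boundary (\<lambda>xs. c (map \<pi> xs)) = (\<lambda>ys. boundary c (map \<pi> ys))"
proof
  fix ys
  have "(\<Sum>v | c (\<pi> v # map \<pi> ys) \<noteq> 0. c (\<pi> v # map \<pi> ys)) = (\<Sum>v | c (v # map \<pi> ys) \<noteq> 0. c (v # map \<pi> ys))"
  proof (rule sum.reindex_bij_betw)
    show "bij_betw \<pi> {v. c (\<pi> v # map \<pi> ys) \<noteq> 0} {v. c (v # map \<pi> ys) \<noteq> 0}"
      using assms by (intro bij_betwI[where g="inv \<pi>"]) (auto simp: bij_is_inj bij_is_surj surj_f_inv_f)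
  qed
  then show "boundary (\<lambda>xs. c (map \<pi> xs)) ys = boundary c (map \<pi> ys)"
    by (simp add: boundary_def)
qed

lemma chains_relabel_sub:
  assumes "bij \<pi>" "c \<in> chains p ((`) \<pi> ` K)"
  shows "(\<lambda>xs. c (map \<pi> xs)) \<in> chains p K"
proof -
  have inj: "inj \<pi>" using assms bij_is_inj by blast
  have "finite (map \<pi> -` {xs. c xs \<noteq> 0})"
    using assms(2) inj by (intro finite_vimageI) (auto simp: chains_iff)
  then have "finite {xs. c (map \<pi> xs) \<noteq> 0}" by (simp add: vimage_def)
  moreover have "length xs = p + 1 \<and> distinct xs \<and> set xs \<in> K" if "c (map \<pi> xs) \<noteq> 0" for xs
  proof -
    have "length (map \<pi> xs) = p + 1 \<and> distinct (map \<pi> xs) \<and> set (map \<pi> xs) \<in> (`) \<pi> ` K"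
      using assms(2) that unfolding chains_iff by blast
    then show ?thesis using inj by (auto simp: distinct_map inj_image_eq_iff)
  qed
  moreover have "alternating (\<lambda>xs. c (map \<pi> xs))"
    using alternatingD[OF chains_alternating[OF assms(2)]] unfolding alternating_def map_append list.map by blast
  ultimately show ?thesis unfolding chains_iff by blast
qed

lemma chains_relabel:
  fixes K :: "'a set set" and \<pi> :: "'a \<Rightarrow> 'b"
  assumes "bij \<pi>"
  shows "chains p K = (\<lambda>c xs. c (map \<pi> xs)) ` chains p ((`) \<pi> ` K)"
proof (intro equalityI subsetI)
  fix c :: "'a list \<Rightarrow> 'c" assume c: "c \<in> chains p K"
  have "bij (inv \<pi>)" using assms bij_imp_bij_inv by blast
  moreover have "(`) (inv \<pi>) ` (`) \<pi> ` K = K"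
    using assms by (simp add: image_image bij_is_inj image_inv_f_f)
  ultimately have "(\<lambda>xs. c (map (inv \<pi>) xs)) \<in> chains p ((`) \<pi> ` K)"
    using c chains_relabel_sub[of "inv \<pi>" c p "(`) \<pi> ` K"] by simp
  moreover have "c = (\<lambda>xs. (\<lambda>xs. c (map (inv \<pi>) xs)) (map \<pi> xs))"
    using assms by (simp add: bij_is_inj)
  ultimately show "c \<in> (\<lambda>c xs. c (map \<pi> xs)) ` chains p ((`) \<pi> ` K)" by (intro image_eqI)
qed (use chains_relabel_sub[OF assms] in auto)

lemma inj_relabel:
  assumes "bij \<pi>"
  shows "inj (\<lambda>c xs. c (map \<pi> xs))"
proof (rule injI)
  fix c d :: "'b list \<Rightarrow> 'c" assume "(\<lambda>xs. c (map \<pi> xs)) = (\<lambda>xs. d (map \<pi> xs))"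
  then have "c (map \<pi> (map (inv \<pi>) xs)) = d (map \<pi> (map (inv \<pi>) xs))" for xs by metis
  moreover have "map \<pi> (map (inv \<pi>) xs) = xs" for xs
    using assms by (auto intro!: map_idI simp: bij_is_surj surj_f_inv_f)
  ultimately show "c = d" by auto
qed

lemma cycles_relabel:
  assumes "bij \<pi>"
  shows "cycles p K = (\<lambda>c xs. c (map \<pi> xs)) ` cycles p ((`) \<pi> ` K)"
proof -
  have "boundary (\<lambda>xs. c (map \<pi> xs)) = (\<lambda>_. 0) \<longleftrightarrow> boundary c = (\<lambda>_. 0)" for c :: "_ \<Rightarrow> 'c"
    using inj_eq[OF inj_relabel[OF assms, where 'c='c], of "boundary c" "\<lambda>_. 0"] unfolding boundary_relabel[OF assms] by simp
  then show ?thesis unfolding cycles_def chains_relabel[OF assms, of p K] by auto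
qed

lemma boundaries_relabel:
  assumes "bij \<pi>"
  shows "boundaries p K = (\<lambda>c xs. c (map \<pi> xs)) ` boundaries p ((`) \<pi> ` K)"
  unfolding boundaries_def chains_relabel[OF assms, of "p+1" K] image_image
  by (simp add: boundary_relabel[OF assms])

text \<open>An injective linear map carries a basis to a basis.\<close>

lemma chain_dim_relabel:
  fixes \<pi> :: "'a \<Rightarrow> 'b" and V :: "('b list \<Rightarrow> 'f::field) set"
  assumes "bij \<pi>"
  shows "chain_dim ((\<lambda>c xs. c (map \<pi> xs)) ` V) = chain_dim V"
proof -
  let ?T = "\<lambda>c xs. c (map \<pi> xs) :: 'f"
  interpret T: Vector_Spaces.linear "chain_scale :: 'f \<Rightarrow> ('b list \<Rightarrow> 'f) \<Rightarrow> _" "chain_scale :: 'f \<Rightarrow> ('a list \<Rightarrow> 'f) \<Rightarrow> _" ?T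
    by unfold_locales (auto simp: chain_scale_def plus_fun_def)
  obtain B where B: "B \<subseteq> V" "\<not> chain.dependent B" "V \<subseteq> chain.span B" "card B = chain_dim V"
    using chain.basis_exists[of V] unfolding chain_dim_def by metis
  have inj: "inj ?T" by (rule inj_relabel[OF assms])
  have "\<not> chain.dependent (?T ` B)"
    using T.independent_injective_image[OF B(2)] inj by (simp add: inj_on_subset)
  moreover have "?T ` V \<subseteq> chain.span (?T ` B)" using B(3) T.span_image by blast
  moreover have "card (?T ` B) = card B" using inj by (simp add: card_image inj_on_subset)
  ultimately have "chain.dim (?T ` V) = card B"
    using B(1) by (intro chain.dim_unique[of "?T ` B"]) auto
  then show ?thesis using B(4) by (simp add: chain_dim_def)
qed

lemma persistent_betti_relabel:
  fixes \<pi> :: "'a \<Rightarrow> 'b"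
  assumes "bij \<pi>"
  shows "persistent_betti F p ((`) \<pi> ` K) ((`) \<pi> ` L) = persistent_betti F p K L"
proof -
  let ?T = "\<lambda>(c :: 'b list \<Rightarrow> 'c) xs. c (map \<pi> xs)"
  have "cycles p K \<inter> boundaries p L = ?T ` (cycles p ((`) \<pi> ` K) \<inter> boundaries p ((`) \<pi> ` L))"
    unfolding cycles_relabel[OF assms, of p K] boundaries_relabel[OF assms, of p L]
    by (rule image_Int[OF inj_relabel[OF assms], symmetric])
  then show ?thesis
    unfolding persistent_betti_def cycles_relabel[OF assms, of p K]
    by (simp add: chain_dim_relabel[OF assms])
qed

section \<open>The Cech filtration\<close>

text \<open>The least \<open>t\<close> at which the balls of radius \<open>t / 2\<close> around the
  points share a point, that is, twice the radius of the smallest enclosing ball. It encodes the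
  filtration by one number per simplex.\<close>

definition cech_time :: "'a::euclidean_space set \<Rightarrow> real" where
  "cech_time \<sigma> = Inf {t. 0 \<le> t \<and> (\<exists>c. \<forall>x\<in>\<sigma>. dist x c \<le> t / 2)}"

lemma cech_time_exists:
  fixes \<sigma> :: "'a::euclidean_space set"
  assumes "finite \<sigma>"
  shows "\<exists>t\<ge>0. \<exists>c. \<forall>x\<in>\<sigma>. dist x c \<le> t / 2"
proof -
  obtain B where B: "\<forall>x\<in>\<sigma>. norm x \<le> B"
    using finite_imp_bounded[OF assms] by (auto simp: bounded_iff)
  show ?thesis
    by (intro exI[of _ "2 * \<bar>B\<bar>"] conjI exI[of _ 0]) (use B in \<open>auto intro: order_trans\<close>)
qed

lemma cech_time_le:
  assumes "0 \<le> t" "\<And>x. x \<in> \<sigma> \<Longrightarrow> dist x c \<le> t / 2"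
  shows "cech_time \<sigma> \<le> t"
  unfolding cech_time_def
  by (rule cInf_lower) (use assms in \<open>auto intro!: bdd_belowI[of _ 0]\<close>)

lemma cech_time_nonneg: "finite \<sigma> \<Longrightarrow> 0 \<le> cech_time \<sigma>"
  unfolding cech_time_def using cech_time_exists[of \<sigma>] by (intro cInf_greatest) auto

text \<open>The sets \<open>C n\<close> of centres that work at a slightly later time are nonempty,
  compact and decreasing, so they have a common point. Attainment turns membership in the complex at
  \<open>t\<close> into \<open>cech_time \<sigma> \<le> t\<close>.\<close>

lemma cech_time_attained:
  assumes "finite \<sigma>" "\<sigma> \<noteq> {}"
  shows "\<exists>c. \<forall>x\<in>\<sigma>. dist x c \<le> cech_time \<sigma> / 2"
proof -
  define C where "C n = (\<Inter>x\<in>\<sigma>. cball x ((cech_time \<sigma> + inverse (real (Suc n))) / 2))" for n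
  have "C n \<noteq> {}" for n
  proof -
    have "cech_time \<sigma> < cech_time \<sigma> + inverse (real (Suc n))" by simp
    then have "Inf {t. 0 \<le> t \<and> (\<exists>c. \<forall>x\<in>\<sigma>. dist x c \<le> t / 2)} < cech_time \<sigma> + inverse (real (Suc n))"
      by (simp only: cech_time_def)
    moreover have "{t. 0 \<le> t \<and> (\<exists>c. \<forall>x\<in>\<sigma>. dist x c \<le> t / 2)} \<noteq> {}"
      using cech_time_exists[OF assms(1)] by blast
    ultimately obtain t where t: "t \<in> {t. 0 \<le> t \<and> (\<exists>c. \<forall>x\<in>\<sigma>. dist x c \<le> t / 2)}"
        "t < cech_time \<sigma> + inverse (real (Suc n))"
      by (metis (no_types, lifting) cInf_lessD)
    then obtain c where "\<forall>x\<in>\<sigma>. dist x c \<le> t / 2" by blast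
    then have "dist x c \<le> (cech_time \<sigma> + inverse (real (Suc n))) / 2" if "x \<in> \<sigma>" for x
      using t(2) that by (meson divide_right_mono less_imp_le order_trans zero_le_numeral)
    then have "c \<in> C n" by (simp add: C_def)
    then show ?thesis by blast
  qed
  moreover have "compact (C n)" for n
    unfolding C_def using assms by (intro compact_Inter) auto
  moreover have "C n \<subseteq> C m" if "m \<le> n" for m n
  proof -
    have "inverse (real (Suc n)) \<le> inverse (real (Suc m))"
      using that by (intro le_imp_inverse_le) auto
    then show ?thesis unfolding C_def by (intro INF_mono') (simp add: subset_cball)
  qed
  ultimately have "(\<Inter>n. C n) \<noteq> {}" by (intro compact_nest)
  then obtain c where c: "\<And>n. c \<in> C n" by blast
  have "dist x c \<le> cech_time \<sigma> / 2" if "x \<in> \<sigma>" for x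
  proof -
    have "dist x c \<le> (cech_time \<sigma> + inverse (real (Suc n))) / 2" for n
      using c[of n] that by (auto simp: C_def)
    moreover have "(\<lambda>n. (cech_time \<sigma> + inverse (real (Suc n))) / 2) \<longlonglongrightarrow> (cech_time \<sigma> + 0) / 2"
      by (intro tendsto_intros LIMSEQ_inverse_real_of_nat) simp
    ultimately show ?thesis using LIMSEQ_le_const[of _ _ "dist x c"] by fastforce
  qed
  then show ?thesis by blast
qed

lemma cech_time_le_iff:
  assumes "finite \<sigma>" "\<sigma> \<noteq> {}" "0 \<le> t"
  shows "cech_time \<sigma> \<le> t \<longleftrightarrow> (\<exists>c. \<forall>x\<in>\<sigma>. dist x c \<le> t / 2)"
proof
  assume "cech_time \<sigma> \<le> t"
  then show "\<exists>c. \<forall>x\<in>\<sigma>. dist x c \<le> t / 2"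
    using cech_time_attained[OF assms(1,2)] by (meson divide_right_mono order_trans zero_le_numeral)
qed (use cech_time_le[OF assms(3)] in blast)

text \<open>Finiteness turns the strict bounds into one maximum below \<open>t / 2\<close>. The
  measurability proof exploits that the balls are now open.\<close>

lemma cech_time_less_iff:
  assumes "finite \<sigma>" "\<sigma> \<noteq> {}"
  shows "cech_time \<sigma> < t \<longleftrightarrow> (\<exists>c. \<forall>x\<in>\<sigma>. dist x c < t / 2)"
proof
  assume "cech_time \<sigma> < t"
  then have "cech_time \<sigma> / 2 < t / 2" by simp
  then show "\<exists>c. \<forall>x\<in>\<sigma>. dist x c < t / 2"
    using cech_time_attained[OF assms(1,2)] by (meson order_le_less_trans)
next
  assume "\<exists>c. \<forall>x\<in>\<sigma>. dist x c < t / 2"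
  then obtain c where c: "\<forall>x\<in>\<sigma>. dist x c < t / 2" by blast
  define m where "m = Max ((\<lambda>x. dist x c) ` \<sigma>)"
  have m: "dist x c \<le> m" if "x \<in> \<sigma>" for x
    unfolding m_def using assms that by (intro Max_ge) auto
  have "m \<in> (\<lambda>x. dist x c) ` \<sigma>" unfolding m_def using assms by (intro Max_in) auto
  then have m2: "m < t / 2" using c by auto
  have "0 \<le> m" using m assms(2) by (meson all_not_in_conv order_trans zero_le_dist)
  then have "cech_time \<sigma> \<le> 2 * m" using m by (intro cech_time_le) auto
  then show "cech_time \<sigma> < t" using m2 by simp
qed

lemma cech_time_mono:
  assumes "finite \<tau>" "\<sigma> \<subseteq> \<tau>" "\<sigma> \<noteq> {}"
  shows "cech_time \<sigma> \<le> cech_time \<tau>"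
proof -
  obtain c where "\<forall>x\<in>\<tau>. dist x c \<le> cech_time \<tau> / 2"
    using cech_time_attained[of \<tau>] assms by blast
  then show ?thesis using assms by (intro cech_time_le) (auto intro: cech_time_nonneg)
qed

lemma cech_time_singleton: "cech_time {x} = 0"
  by (rule antisym) (auto intro: cech_time_le cech_time_nonneg)

lemma dist_le_cech_time:
  assumes "finite \<sigma>" "x \<in> \<sigma>" "y \<in> \<sigma>"
  shows "dist x y \<le> cech_time \<sigma>"
proof -
  obtain c where c: "\<forall>x\<in>\<sigma>. dist x c \<le> cech_time \<sigma> / 2"
    using cech_time_attained[of \<sigma>] assms by blast
  have "dist x y \<le> dist x c + dist y c" by (rule dist_triangle2)
  moreover have "dist x c \<le> cech_time \<sigma> / 2" "dist y c \<le> cech_time \<sigma> / 2" using c assms by auto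
  ultimately show ?thesis by linarith
qed

text \<open>Any point of \<sigma> serves as a centre with radius \<open>D\<close>; the factor 2
  converts a radius into a time.\<close>

lemma cech_time_le_diameter:
  assumes "\<sigma> \<noteq> {}" "\<And>x y. x \<in> \<sigma> \<Longrightarrow> y \<in> \<sigma> \<Longrightarrow> dist x y \<le> D"
  shows "cech_time \<sigma> \<le> 2 * D"
proof -
  obtain c where c: "c \<in> \<sigma>" using assms by blast
  then have "0 \<le> D" using assms(2)[of c c] by simp
  then show ?thesis using assms c by (intro cech_time_le) auto
qed

text \<open>Each inequality transports an optimal centre, once through the map and once through its
  inverse.\<close>

lemma cech_time_affine:
  fixes a :: "'a::euclidean_space"
  assumes r: "r > 0" and "finite \<sigma>" "\<sigma> \<noteq> {}"
  shows "cech_time ((\<lambda>z. a + r *\<^sub>R z) ` \<sigma>) = r * cech_time \<sigma>"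
proof (rule antisym)
  have dist: "dist (a + r *\<^sub>R x) (a + r *\<^sub>R y) = r * dist x y" for x y :: 'a
  proof -
    have "(a + r *\<^sub>R x) - (a + r *\<^sub>R y) = r *\<^sub>R (x - y)" by (simp add: scaleR_diff_right)
    then show ?thesis using r unfolding dist_norm by (simp only: norm_scaleR abs_of_pos)
  qed
  obtain c where c: "\<forall>x\<in>\<sigma>. dist x c \<le> cech_time \<sigma> / 2"
    using cech_time_attained assms by blast
  show "cech_time ((\<lambda>z. a + r *\<^sub>R z) ` \<sigma>) \<le> r * cech_time \<sigma>"
  proof (rule cech_time_le)
    show "dist x (a + r *\<^sub>R c) \<le> r * cech_time \<sigma> / 2" if x: "x \<in> (\<lambda>z. a + r *\<^sub>R z) ` \<sigma>" for x
    proof -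
      obtain z where z: "z \<in> \<sigma>" "x = a + r *\<^sub>R z" using x by blast
      have "r * dist z c \<le> r * (cech_time \<sigma> / 2)" using c z r by (intro mult_left_mono) auto
      then show ?thesis unfolding z(2) dist by simp
    qed
    show "0 \<le> r * cech_time \<sigma>" using r cech_time_nonneg[OF assms(2)] by simp
  qed
  let ?t = "cech_time ((\<lambda>z. a + r *\<^sub>R z) ` \<sigma>)"
  obtain c' where c': "\<forall>x\<in>\<sigma>. dist (a + r *\<^sub>R x) c' \<le> ?t / 2"
    using cech_time_attained[of "(\<lambda>z. a + r *\<^sub>R z) ` \<sigma>"] assms by auto
  define c'' where "c'' = (1 / r) *\<^sub>R (c' - a)"
  have "c' = a + r *\<^sub>R c''" using r by (simp add: c''_def)
  then have *: "\<forall>x\<in>\<sigma>. r * dist x c'' \<le> ?t / 2" using c' unfolding \<open>c' = a + r *\<^sub>R c''\<close> dist by blast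
  have "cech_time \<sigma> \<le> ?t / r"
  proof (rule cech_time_le)
    show "0 \<le> ?t / r" using r assms by (simp add: cech_time_nonneg)
    show "dist x c'' \<le> ?t / r / 2" if "x \<in> \<sigma>" for x
    proof -
      have "r * dist x c'' \<le> ?t / 2" using * that by blast
      then show ?thesis using r by (simp add: field_simps)
    qed
  qed
  then show "r * cech_time \<sigma> \<le> ?t" using r by (simp add: field_simps)
qed

text \<open>A nonempty open intersection of balls meets a countable dense set, so the event of a
  strict inequality is a countable union of events with a fixed centre.\<close>

lemma borel_measurable_cech_time:
  fixes X :: "'i \<Rightarrow> 'w \<Rightarrow> 'a::euclidean_space"
  assumes J: "finite J" and X: "\<And>i. i \<in> J \<Longrightarrow> X i \<in> borel_measurable N"
  shows "(\<lambda>\<omega>. cech_time ((\<lambda>i. X i \<omega>) ` J)) \<in> borel_measurable N"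
proof (cases "J = {}")
  case False
  obtain D :: "'a set" where D: "countable D" "\<And>U. open U \<Longrightarrow> U \<noteq> {} \<Longrightarrow> \<exists>d\<in>D. d \<in> U"
    by (metis countable_dense_setE)
  show ?thesis
  proof (rule borel_measurableI_less)
    fix t
    have "{\<omega>\<in>space N. cech_time ((\<lambda>i. X i \<omega>) ` J) < t} =
        (\<Union>c\<in>D. {\<omega>\<in>space N. \<forall>i\<in>J. dist (X i \<omega>) c < t / 2})"
    proof (intro equalityI subsetI)
      fix \<omega> assume \<omega>: "\<omega> \<in> {\<omega>\<in>space N. cech_time ((\<lambda>i. X i \<omega>) ` J) < t}"
      then have "\<exists>c. \<forall>i\<in>J. dist (X i \<omega>) c < t / 2"
        using cech_time_less_iff[of "(\<lambda>i. X i \<omega>) ` J" t] J False by auto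
      then obtain c' where "\<forall>i\<in>J. dist (X i \<omega>) c' < t / 2" by blast
      then have "c' \<in> (\<Inter>i\<in>J. ball (X i \<omega>) (t / 2))" by simp
      then have "(\<Inter>i\<in>J. ball (X i \<omega>) (t / 2)) \<noteq> {}" by blast
      moreover have "open (\<Inter>i\<in>J. ball (X i \<omega>) (t / 2))" using J by auto
      ultimately obtain c where "c \<in> D" "c \<in> (\<Inter>i\<in>J. ball (X i \<omega>) (t / 2))" using D(2) by blast
      then show "\<omega> \<in> (\<Union>c\<in>D. {\<omega>\<in>space N. \<forall>i\<in>J. dist (X i \<omega>) c < t / 2})" using \<omega> by auto
    next
      fix \<omega> assume "\<omega> \<in> (\<Union>c\<in>D. {\<omega>\<in>space N. \<forall>i\<in>J. dist (X i \<omega>) c < t / 2})"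
      then show "\<omega> \<in> {\<omega>\<in>space N. cech_time ((\<lambda>i. X i \<omega>) ` J) < t}"
        using cech_time_less_iff[of "(\<lambda>i. X i \<omega>) ` J" t] J False by auto
    qed
    moreover have meas: "{\<omega>\<in>space N. \<forall>i\<in>J. dist (X i \<omega>) c < t / 2} \<in> sets N" for c
      using J X by (intro sets.sets_Collect_finite_All' ) (auto simp: False)
    ultimately show "{\<omega>\<in>space N. cech_time ((\<lambda>i. X i \<omega>) ` J) < t} \<in> sets N"
      by (simp only: sets.countable_UN''[OF D(1) meas])
  qed
qed simp

section \<open>The Cech complexes as sublevel families\<close>

text \<open>Parametrised by a set of admissible times: \<open>{..t}\<close> gives the complex at
  \<open>t\<close>, \<open>{..<t}\<close> the one just before \<open>t\<close>, and
  \<open>{c. ereal (c / r) < d}\<close> also covers \<open>d = \<infinity>\<close>. One lemma can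
  then treat all four persistent Betti numbers of a multiplicity.\<close>

definition cech_at :: "'a::euclidean_space set \<Rightarrow> real set \<Rightarrow> 'a set set" where
  "cech_at S U = {\<sigma>. \<sigma> \<subseteq> S \<and> \<sigma> \<noteq> {} \<and> cech_time \<sigma> \<in> U}"

lemma cech_at_cong:
  assumes "\<And>\<sigma>. \<sigma> \<subseteq> S \<Longrightarrow> \<sigma> \<noteq> {} \<Longrightarrow> cech_time \<sigma> \<in> U \<longleftrightarrow> cech_time \<sigma> \<in> V"
  shows "cech_at S U = cech_at S V"
  unfolding cech_at_def using assms by blast

text \<open>A single point has Cech time 0, so the separate clause for vertices in
  \<open>cech\<close> is absorbed.\<close>

lemma cech_eq_cech_at:
  assumes "finite S" "0 \<le> t"
  shows "cech S t = cech_at S {..t}"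
proof (rule set_eqI)
  fix \<sigma>
  show "\<sigma> \<in> cech S t \<longleftrightarrow> \<sigma> \<in> cech_at S {..t}"
  proof (cases "\<sigma> \<subseteq> S \<and> \<sigma> \<noteq> {}")
    case True
    then have fin: "finite \<sigma>" using assms finite_subset by blast
    have "(\<Inter>x\<in>\<sigma>. cball x (t / 2)) \<noteq> {} \<longleftrightarrow> cech_time \<sigma> \<le> t"
    proof -
      have "(\<Inter>x\<in>\<sigma>. cball x (t / 2)) \<noteq> {} \<longleftrightarrow> (\<exists>c. c \<in> (\<Inter>x\<in>\<sigma>. cball x (t / 2)))" by blast
      also have "\<dots> \<longleftrightarrow> (\<exists>c. \<forall>x\<in>\<sigma>. dist x c \<le> t / 2)" by simp
      finally show ?thesis using cech_time_le_iff[OF fin _ assms(2)] True by simp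
    qed
    moreover have "card \<sigma> \<ge> 2 \<or> (\<exists>x\<in>S. \<sigma> = {x})"
    proof -
      have "card \<sigma> \<noteq> 0" using True fin by auto
      then have "card \<sigma> \<ge> 2 \<or> card \<sigma> = 1" by linarith
      then show ?thesis using True by (auto simp: card_1_singleton_iff)
    qed
    moreover have "{x} \<in> cech S t" if "x \<in> S" for x using that by (auto simp: cech_def)
    moreover have "cech_time \<sigma> \<le> t" if "\<exists>x\<in>S. \<sigma> = {x}"
      using that assms(2) by (auto simp: cech_time_singleton)
    ultimately show ?thesis
      using True fin unfolding cech_def cech_at_def by blast
  next
    case False
    then show ?thesis by (auto simp: cech_def cech_at_def)
  qed
qed

lemma before_cech:
  assumes "finite S" "r > 0"
  shows "before (\<lambda>t. cech S (r * t)) d = cech_at S {c. ereal (c / r) < d}"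
proof (rule set_eqI)
  fix \<sigma>
  have "\<sigma> \<in> before (\<lambda>t. cech S (r * t)) d \<longleftrightarrow> (\<exists>s\<ge>0. ereal s < d \<and> \<sigma> \<in> cech_at S {..r * s})"
    using assms cech_eq_cech_at[OF assms(1)] by (auto simp: before_def)
  also have "\<dots> \<longleftrightarrow> \<sigma> \<in> cech_at S {c. ereal (c / r) < d}"
  proof
    assume "\<exists>s\<ge>0. ereal s < d \<and> \<sigma> \<in> cech_at S {..r * s}"
    then obtain s where s: "ereal s < d" "\<sigma> \<subseteq> S" "\<sigma> \<noteq> {}" "cech_time \<sigma> \<le> r * s" by (auto simp: cech_at_def)
    then have "cech_time \<sigma> / r \<le> s" using assms by (simp add: field_simps)
    then have "ereal (cech_time \<sigma> / r) < d" using s(1) by (meson ereal_less_eq(3) order_le_less_trans)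
    then show "\<sigma> \<in> cech_at S {c. ereal (c / r) < d}" using s by (auto simp: cech_at_def)
  next
    assume "\<sigma> \<in> cech_at S {c. ereal (c / r) < d}"
    then have *: "\<sigma> \<subseteq> S" "\<sigma> \<noteq> {}" "ereal (cech_time \<sigma> / r) < d" by (auto simp: cech_at_def)
    moreover have "0 \<le> cech_time \<sigma> / r"
      using assms * finite_subset cech_time_nonneg[of \<sigma>] by fastforce
    ultimately show "\<exists>s\<ge>0. ereal s < d \<and> \<sigma> \<in> cech_at S {..r * s}"
      using assms(2) by (intro exI[of _ "cech_time \<sigma> / r"]) (auto simp: cech_at_def)
  qed
  finally show "\<sigma> \<in> before (\<lambda>t. cech S (r * t)) d \<longleftrightarrow> \<sigma> \<in> cech_at S {c. ereal (c / r) < d}" .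
qed

lemma persistence_mult_cech:
  assumes "finite S" "r > 0" "0 \<le> b" "ereal b < d"
  shows "persistence_mult F k (\<lambda>t. cech S (r * t)) (b, d) =
    (let L = cech_at S {c. ereal (c / r) < d}; L' = cech_at S {..r * real_of_ereal d};
         K = cech_at S {..r * b}; K' = cech_at S {..<r * b} in
      nat ((int (persistent_betti F k K L) - int (persistent_betti F k K' L)) -
        (if d = \<infinity> then 0 else int (persistent_betti F k K L') - int (persistent_betti F k K' L'))))"
proof -
  have "cech S (r * b) = cech_at S {..r * b}" using assms by (intro cech_eq_cech_at) auto
  moreover have "{c. ereal (c / r) < ereal b} = {..<r * b}" using assms by (auto simp: field_simps)
  moreover have "cech S (r * real_of_ereal d) = cech_at S {..r * real_of_ereal d}"
    using assms by (intro cech_eq_cech_at) (auto intro!: mult_nonneg_nonneg real_of_ereal_pos intro: order_trans[of _ "ereal b"])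
  ultimately show ?thesis
    using assms unfolding persistence_mult_def Let_def prod.case before_cech[OF assms(1,2)] by simp
qed

text \<open>If no simplex appears at time \<open>r * b\<close>, the complexes at \<open>b\<close>
  and before \<open>b\<close> coincide and the differences cancel; likewise at \<open>d\<close>. The
  diagram of a finite set therefore has finitely many atoms.\<close>

lemma persistence_mult_finite:
  fixes S :: "'a::euclidean_space set"
  assumes "finite S" "r > 0" "0 \<le> b" "ereal b < d"
    and "persistence_mult F k (\<lambda>t. cech S (r * t)) (b, d) \<noteq> 0"
  shows "\<exists>\<sigma>. \<sigma> \<subseteq> S \<and> \<sigma> \<noteq> {} \<and> b = cech_time \<sigma> / r"
    and "d \<noteq> \<infinity> \<Longrightarrow> \<exists>\<sigma>. \<sigma> \<subseteq> S \<and> \<sigma> \<noteq> {} \<and> d = ereal (cech_time \<sigma> / r)"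
proof -
  note m = persistence_mult_cech[OF assms(1-4), of F k]
  show "\<exists>\<sigma>. \<sigma> \<subseteq> S \<and> \<sigma> \<noteq> {} \<and> b = cech_time \<sigma> / r"
  proof (rule ccontr)
    assume *: "\<nexists>\<sigma>. \<sigma> \<subseteq> S \<and> \<sigma> \<noteq> {} \<and> b = cech_time \<sigma> / r"
    have "cech_at S {..r * b} = cech_at S {..<r * b}"
    proof (rule cech_at_cong)
      fix \<sigma> assume "\<sigma> \<subseteq> S" "\<sigma> \<noteq> {}"
      with * have "b \<noteq> cech_time \<sigma> / r" by blast
      then have "cech_time \<sigma> \<noteq> r * b" using assms(2) by (simp add: field_simps)
      then show "cech_time \<sigma> \<in> {..r * b} \<longleftrightarrow> cech_time \<sigma> \<in> {..<r * b}" by (simp add: less_le)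
    qed
    then show False using assms(5) unfolding m by (simp add: Let_def)
  qed
  show "\<exists>\<sigma>. \<sigma> \<subseteq> S \<and> \<sigma> \<noteq> {} \<and> d = ereal (cech_time \<sigma> / r)" if fin: "d \<noteq> \<infinity>"
  proof (rule ccontr)
    assume *: "\<nexists>\<sigma>. \<sigma> \<subseteq> S \<and> \<sigma> \<noteq> {} \<and> d = ereal (cech_time \<sigma> / r)"
    obtain e where e: "d = ereal e" using fin assms(4) by (cases d) auto
    have "cech_at S {c. ereal (c / r) < d} = cech_at S {..r * real_of_ereal d}"
    proof (rule cech_at_cong)
      fix \<sigma> assume "\<sigma> \<subseteq> S" "\<sigma> \<noteq> {}"
      with * have "d \<noteq> ereal (cech_time \<sigma> / r)" by blast
      then have "cech_time \<sigma> \<noteq> r * e" using assms(2) by (auto simp: e)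
      then show "cech_time \<sigma> \<in> {c. ereal (c / r) < d} \<longleftrightarrow> cech_time \<sigma> \<in> {..r * real_of_ereal d}"
        using assms(2) by (simp add: e field_simps less_le)
    qed
    then show False using assms(5) fin unfolding m by (simp add: Let_def)
  qed
qed

section \<open>Multiplicities and the order of the Cech times\<close>

text \<open>Relabelling needs a bijection of the whole type. The complements of \<open>S\<close> and
  \<open>S'\<close> in their union have equal size and are matched arbitrarily; everything else is
  fixed.\<close>

lemma bij_extension:
  fixes S S' :: "'a set"
  assumes "finite S" "finite S'" "bij_betw f S S'"
  obtains \<pi> where "bij \<pi>" "\<And>x. x \<in> S \<Longrightarrow> \<pi> x = f x"
proof -
  let ?U = "S \<union> S'"
  have "card (?U - S) = card (?U - S')"
    using assms bij_betw_same_card[OF assms(3)] by (simp add: card_Diff_subset)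
  then obtain g where g: "bij_betw g (?U - S) (?U - S')"
    using finite_same_card_bij[of "?U - S" "?U - S'"] assms by auto
  define \<pi> where "\<pi> x = (if x \<in> S then f x else if x \<in> ?U then g x else x)" for x
  have "bij_betw \<pi> S S'" using assms(3) by (rule bij_betw_cong[THEN iffD1, rotated]) (simp add: \<pi>_def)
  moreover have "bij_betw \<pi> (?U - S) (?U - S')"
    using g by (rule bij_betw_cong[THEN iffD1, rotated]) (auto simp: \<pi>_def)
  ultimately have "bij_betw \<pi> (S \<union> (?U - S)) (S' \<union> (?U - S'))"
    by (rule bij_betw_combine) auto
  moreover have "bij_betw \<pi> (- ?U) (- ?U)"
    by (rule bij_betw_cong[THEN iffD1, OF _ bij_betw_id]) (auto simp: \<pi>_def)
  ultimately have "bij_betw \<pi> (S \<union> (?U - S) \<union> - ?U) (S' \<union> (?U - S') \<union> - ?U)"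
    by (rule bij_betw_combine) auto
  moreover have "S \<union> (?U - S) \<union> - ?U = UNIV" "S' \<union> (?U - S') \<union> - ?U = UNIV" by auto
  ultimately have "bij \<pi>" by simp
  then show ?thesis by (rule that) (simp add: \<pi>_def)
qed

lemma cech_at_relabel:
  fixes x x' :: "'i \<Rightarrow> 'a::euclidean_space"
  assumes "bij \<pi>" "\<And>i. i \<in> I \<Longrightarrow> \<pi> (x i) = x' i"
    and "\<And>a. a \<subseteq> I \<Longrightarrow> a \<noteq> {} \<Longrightarrow> cech_time (x ` a) \<in> U \<longleftrightarrow> cech_time (x' ` a) \<in> U'"
  shows "(`) \<pi> ` cech_at (x ` I) U = cech_at (x' ` I) U'"
proof -
  have eq: "cech_at (y ` I) V = (`) y ` {a. a \<subseteq> I \<and> a \<noteq> {} \<and> cech_time (y ` a) \<in> V}" for y :: "'i \<Rightarrow> 'z::euclidean_space" and V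
    by (auto simp: cech_at_def subset_image_iff)
  have im: "\<pi> ` x ` a = x' ` a" if "a \<subseteq> I" for a
    using assms(2) that by (force simp: image_image)
  show ?thesis
    unfolding eq image_image[of "(`) \<pi>" "(`) x"]
  proof (rule image_cong)
    show "{a. a \<subseteq> I \<and> a \<noteq> {} \<and> cech_time (x ` a) \<in> U} = {a. a \<subseteq> I \<and> a \<noteq> {} \<and> cech_time (x' ` a) \<in> U'}"
      using assms(3) by blast
  qed (use im in blast)
qed

text \<open>Equal orders of the Cech times induce a bijection of the points that carries each of the
  four complexes in the multiplicity for \<open>x\<close> onto its counterpart for
  \<open>x'\<close>. The death is a function \<open>d\<close> of the configuration, so that it is
  transported as well; \<open>b = {}\<close> encodes an infinite death.\<close>

lemma persistence_mult_order_type: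
  fixes x x' :: "nat \<Rightarrow> 'a::euclidean_space"
  assumes r: "r > 0" and I: "finite I"
    and order: "\<And>a b. a \<subseteq> I \<Longrightarrow> b \<subseteq> I \<Longrightarrow> a \<noteq> {} \<Longrightarrow> b \<noteq> {} \<Longrightarrow>
      cech_time (x ` a) \<le> cech_time (x ` b) \<longleftrightarrow> cech_time (x' ` a) \<le> cech_time (x' ` b)"
    and a: "a \<subseteq> I" "a \<noteq> {}" and b: "b \<subseteq> I"
    and death: "\<And>y. d y = (if b = {} then \<infinity> else ereal (cech_time (y ` b) / r))"
    and born: "ereal (cech_time (x ` a) / r) < d x"
  shows "persistence_mult F k (\<lambda>t. cech (x ` I) (r * t)) (cech_time (x ` a) / r, d x) =
    persistence_mult F k (\<lambda>t. cech (x' ` I) (r * t)) (cech_time (x' ` a) / r, d x')"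
proof -
  \<comment> \<open>Coincidence of points is visible in the order too: a vertex has time 0, an edge
    at least the distance of its ends.\<close>
  have zero: "y i = y j \<longleftrightarrow> cech_time (y ` {i, j}) \<le> cech_time (y ` {i})" for y :: "nat \<Rightarrow> 'a" and i j
  proof
    assume "cech_time (y ` {i, j}) \<le> cech_time (y ` {i})"
    have "dist (y i) (y j) \<le> cech_time (y ` {i, j})" by (rule dist_le_cech_time) auto
    also have "\<dots> \<le> cech_time (y ` {i})" by fact
    finally show "y i = y j" by (simp add: cech_time_singleton)
  qed simp
  have coincide: "x i = x j \<longleftrightarrow> x' i = x' j" if "i \<in> I" "j \<in> I" for i j
    unfolding zero using that by (intro order) auto
  define f where "f z = x' (SOME i. i \<in> I \<and> x i = z)" for z
  have f: "f (x i) = x' i" if "i \<in> I" for i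
  proof -
    have "(SOME j. j \<in> I \<and> x j = x i) \<in> I \<and> x (SOME j. j \<in> I \<and> x j = x i) = x i"
      by (rule someI[of _ i]) (use that in auto)
    then show ?thesis unfolding f_def using coincide[OF _ that] by blast
  qed
  have "bij_betw f (x ` I) (x' ` I)"
    unfolding bij_betw_def inj_on_def using f coincide by (auto simp: image_image)
  then obtain \<pi> where \<pi>: "bij \<pi>" "\<And>i. i \<in> I \<Longrightarrow> \<pi> (x i) = x' i"
    using bij_extension[of "x ` I" "x' ` I" f] I f by (metis finite_imageI imageI)
  note relabel = cech_at_relabel[OF \<pi>]
  have born': "ereal (cech_time (x' ` a) / r) < d x'"
  proof (cases "b = {}")
    case False
    then have "cech_time (x ` a) < cech_time (x ` b)" using born r unfolding death by (simp add: divide_less_cancel)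
    then have "cech_time (x' ` a) < cech_time (x' ` b)" using order[OF b a(1) False a(2)] by linarith
    then show ?thesis using False r by (simp add: death divide_strict_right_mono)
  qed (simp add: death)
  have less: "cech_time (x ` a) < cech_time (x ` b) \<longleftrightarrow> cech_time (x' ` a) < cech_time (x' ` b)"
    if "a \<subseteq> I" "b \<subseteq> I" "a \<noteq> {}" "b \<noteq> {}" for a b
    using order[OF that(2,1,4,3)] by linarith
  have nonneg: "0 \<le> cech_time (y ` a) / r" for y :: "nat \<Rightarrow> 'a"
    using I a r finite_subset[of a I] by (intro divide_nonneg_pos cech_time_nonneg) auto
  have bd: "ereal (c / r) < d y \<longleftrightarrow> b = {} \<or> c < cech_time (y ` b)" for c and y :: "nat \<Rightarrow> 'a"
    using r by (simp add: death divide_less_cancel)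
  have 1: "(`) \<pi> ` cech_at (x ` I) {..r * (cech_time (x ` a) / r)} = cech_at (x' ` I) {..r * (cech_time (x' ` a) / r)}"
    using r order a by (intro relabel) auto
  have 2: "(`) \<pi> ` cech_at (x ` I) {..<r * (cech_time (x ` a) / r)} = cech_at (x' ` I) {..<r * (cech_time (x' ` a) / r)}"
    using r less a by (intro relabel) auto
  have 3: "(`) \<pi> ` cech_at (x ` I) {c. ereal (c / r) < d x} = cech_at (x' ` I) {c. ereal (c / r) < d x'}"
    using less b unfolding bd by (intro relabel) auto
  have 4: "(`) \<pi> ` cech_at (x ` I) {..r * real_of_ereal (d x)} = cech_at (x' ` I) {..r * real_of_ereal (d x')}" if "b \<noteq> {}"
    using order b r that by (intro relabel) (auto simp: death)
  have fin: "finite (y ` I)" for y :: "nat \<Rightarrow> 'a" using I by simp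
  have inf: "d y = \<infinity> \<longleftrightarrow> b = {}" for y :: "nat \<Rightarrow> 'a" by (simp add: death)
  show ?thesis
    unfolding persistence_mult_cech[OF fin r nonneg born] persistence_mult_cech[OF fin r nonneg born'] Let_def inf
    by (simp only: 1[symmetric] 2[symmetric] 3[symmetric] persistent_betti_relabel[OF \<pi>(1)])
      (simp add: 4[symmetric] persistent_betti_relabel[OF \<pi>(1)])
qed

section \<open>Birth and death of a tuple\<close>

text \<open>The time at which the last facet appears. Facets are formed from index sets rather than
  from point sets, so repeated points need no special treatment.\<close>

definition tuple_birth :: "nat \<Rightarrow> (nat \<Rightarrow> 'a::euclidean_space) \<Rightarrow> real" where
  "tuple_birth k x = Max ((\<lambda>i. cech_time (x ` ({..<k + 2} - {i}))) ` {..<k + 2})"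

definition tuple_death :: "nat \<Rightarrow> (nat \<Rightarrow> 'a::euclidean_space) \<Rightarrow> real" where
  "tuple_death k x = cech_time (x ` {..<k + 2})"

lemma face_nonempty: "x ` ({..<k + 2} - {i :: nat}) \<noteq> {}"
proof -
  have "(if i = 0 then 1 else 0) \<in> {..<k + 2} - {i}" by auto
  then show ?thesis by blast
qed

lemma tuple_birth_le_death: "tuple_birth k x \<le> tuple_death k x"
  unfolding tuple_birth_def tuple_death_def
  by (subst Max_le_iff) (auto intro!: cech_time_mono simp: face_nonempty[simplified])

lemma tuple_birth_nonneg: "0 \<le> tuple_birth k x"
proof -
  have "0 \<le> cech_time (x ` ({..<k + 2} - {0}))" by (intro cech_time_nonneg) simp
  also have "\<dots> \<le> tuple_birth k x" unfolding tuple_birth_def by (intro Max_ge) auto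
  finally show ?thesis .
qed

text \<open>There are \<open>k + 2 \<ge> 3\<close> indices, so some facet contains both
  \<open>i\<close> and \<open>j\<close>.\<close>

lemma dist_le_tuple_birth:
  assumes "k \<ge> 1" "i < k + 2" "j < k + 2"
  shows "dist (x i) (x j) \<le> tuple_birth k x"
proof -
  have "\<not> {..<k + 2} \<subseteq> {i, j}"
  proof
    assume "{..<k + 2} \<subseteq> {i, j}"
    then have "card {..<k + 2} \<le> card {i, j}" by (intro card_mono) auto
    also have "\<dots> \<le> 2" by (simp add: card_insert_if)
    finally show False using assms by simp
  qed
  then obtain l where l: "l < k + 2" "l \<noteq> i" "l \<noteq> j" by auto
  have "dist (x i) (x j) \<le> cech_time (x ` ({..<k + 2} - {l}))"
    using assms l by (intro dist_le_cech_time) auto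
  also have "\<dots> \<le> tuple_birth k x" unfolding tuple_birth_def using l by (intro Max_ge) auto
  finally show ?thesis .
qed

text \<open>The birth time bounds the diameter, and twice a diameter bounds a Cech time. This factor
  2 enters the scale of isolation.\<close>

lemma tuple_death_le: "k \<ge> 1 \<Longrightarrow> tuple_death k x \<le> 2 * tuple_birth k x"
  unfolding tuple_death_def by (rule cech_time_le_diameter) (auto intro: dist_le_tuple_birth)

text \<open>Dropping one of two equal points leaves the image unchanged, so one facet is the whole
  simplex. Degenerate tuples thus have lifetime zero and need not be excluded as a null set.\<close>

lemma tuple_birth_eq_death:
  assumes "\<not> inj_on x {..<k + 2}"
  shows "tuple_birth k x = tuple_death k x"
proof (rule antisym[OF tuple_birth_le_death])
  obtain i j where ij: "i < k + 2" "j < k + 2" "i \<noteq> j" "x i = x j"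
    using assms by (auto simp: inj_on_def)
  have "x ` {..<k + 2} = x ` ({..<k + 2} - {i})"
  proof (intro equalityI subsetI)
    fix z assume "z \<in> x ` {..<k + 2}"
    then obtain l where "l < k + 2" "z = x l" by auto
    then show "z \<in> x ` ({..<k + 2} - {i})" using ij by (cases "l = i") auto
  qed auto
  then have "tuple_death k x = cech_time (x ` ({..<k + 2} - {i}))" by (simp add: tuple_death_def)
  also have "\<dots> \<le> tuple_birth k x" unfolding tuple_birth_def using ij by (intro Max_ge) auto
  finally show "tuple_death k x \<le> tuple_birth k x" .
qed

text \<open>As \<open>U\<close> is closed downwards, the maximum over the facets stands for all of
  them.\<close>

lemma tuple_faces:
  assumes inj: "inj_on x {..<k + 2}" and sub: "x ` {..<k + 2} \<subseteq> S"
    and down: "\<And>u v. u \<in> U \<Longrightarrow> v \<le> u \<Longrightarrow> v \<in> U"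
  shows "(\<forall>a\<in>x ` {..<k + 2}. x ` {..<k + 2} - {a} \<in> cech_at S U) \<longleftrightarrow> tuple_birth k x \<in> U"
proof -
  have face: "x ` {..<k + 2} - {x i} = x ` ({..<k + 2} - {i})" if "i < k + 2" for i
    using inj that by (auto simp: inj_on_def)
  have mem: "x ` ({..<k + 2} - {i}) \<in> cech_at S U \<longleftrightarrow> cech_time (x ` ({..<k + 2} - {i})) \<in> U" for i
    using face_nonempty[of x k i] sub unfolding cech_at_def by blast
  have "(\<forall>a\<in>x ` {..<k + 2}. x ` {..<k + 2} - {a} \<in> cech_at S U) \<longleftrightarrow>
      (\<forall>i<k + 2. cech_time (x ` ({..<k + 2} - {i})) \<in> U)"
    using face mem by auto
  also have "\<dots> \<longleftrightarrow> tuple_birth k x \<in> U"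
  proof
    have "tuple_birth k x \<in> (\<lambda>i. cech_time (x ` ({..<k + 2} - {i}))) ` {..<k + 2}"
      unfolding tuple_birth_def by (intro Max_in) auto
    then show "\<forall>i<k + 2. cech_time (x ` ({..<k + 2} - {i})) \<in> U \<Longrightarrow> tuple_birth k x \<in> U" by auto
    show "\<forall>i<k + 2. cech_time (x ` ({..<k + 2} - {i})) \<in> U" if "tuple_birth k x \<in> U"
      using down[OF that] unfolding tuple_birth_def by (auto intro!: Max_ge)
  qed
  finally show ?thesis .
qed

lemma tuple_simplex:
  assumes "x ` {..<k + 2} \<subseteq> S"
  shows "x ` {..<k + 2} \<in> cech_at S U \<longleftrightarrow> tuple_death k x \<in> U"
  using assms by (auto simp: cech_at_def tuple_death_def)

lemma cycle_ind_eq: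
  fixes F :: "'f::field itself" and x :: "nat \<Rightarrow> 'b::euclidean_space"
  assumes "k \<ge> 1" "0 \<le> t"
  shows "cycle_ind F k t x = of_bool (tuple_birth k x \<le> t \<and> t < tuple_death k x)"
proof -
  let ?A = "x ` {..<k + 2}"
  have K: "cech ?A t = cech_at ?A {..t}" using assms by (intro cech_eq_cech_at) auto
  show ?thesis
  proof (cases "inj_on x {..<k + 2}")
    case True
    have faces: "(\<forall>a\<in>?A. ?A - {a} \<in> cech_at ?A {..t}) \<longleftrightarrow> tuple_birth k x \<le> t"
      using tuple_faces[OF True subset_refl, of "{..t}"] by auto
    have full: "?A \<in> cech_at ?A {..t} \<longleftrightarrow> tuple_death k x \<le> t"
      using tuple_simplex[OF subset_refl, of x k "{..t}"] by simp
    have "betti F k (cech_at ?A {..t}) = of_bool ((\<forall>a\<in>?A. ?A - {a} \<in> cech_at ?A {..t}) \<and> ?A \<notin> cech_at ?A {..t})"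
    proof (rule betti_single[OF assms(1)])
      show "card ?A = k + 2" using True by (simp add: card_image)
      show "\<forall>a\<in>?A. ?A - {a} \<in> cech_at ?A {..t}" if "?A \<in> cech_at ?A {..t}"
        using that tuple_birth_le_death[of k x] unfolding faces full by simp
    qed (auto simp: cech_at_def)
    then show ?thesis unfolding cycle_ind_def K faces full by auto
  next
    case False
    \<comment> \<open>With a repeated point fewer than \<open>k + 2\<close> vertices remain, too few
      for two linked simplices.\<close>
    have "cycles k (cech_at ?A {..t}) = {\<lambda>_. 0 :: 'f}"
    proof (rule cycles_trivial[OF assms(1)])
      fix u w :: 'b and ys :: "'b list"
      assume "u \<noteq> w" "length ys = k" "distinct (u # ys)" "distinct (w # ys)"
        and *: "set (u # ys) \<in> cech_at ?A {..t}" "set (w # ys) \<in> cech_at ?A {..t}"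
      then have "card (set (u # w # ys)) = k + 2" by (simp add: distinct_card)
      moreover have "card (set (u # w # ys)) \<le> card ?A" using * by (intro card_mono) (auto simp: cech_at_def)
      moreover have "card ?A < k + 2"
        using False card_image_le[of "{..<k + 2}" x] eq_card_imp_inj_on[of "{..<k + 2}" x] by fastforce
      ultimately show False by simp
    qed
    then have "betti F k (cech_at ?A {..t}) = 0" by (rule betti_trivial)
    then show ?thesis using tuple_birth_eq_death[OF False] unfolding cycle_ind_def K by auto
  qed
qed

lemma birth_eq:
  assumes "k \<ge> 1"
  shows "birth F k x = (if tuple_birth k x < tuple_death k x then ereal (tuple_birth k x) else \<infinity>)"
proof (cases "tuple_birth k x < tuple_death k x")
  case True
  have "Inf {ereal t | t. 0 \<le> t \<and> cycle_ind F k t x = 1} = ereal (tuple_birth k x)"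
    using True tuple_birth_nonneg[of k x] by (intro Inf_eqI) (auto simp: cycle_ind_eq[OF assms] of_bool_def split: if_splits)
  then show ?thesis using True by (simp add: birth_def)
next
  case False
  then have "{ereal t | t. 0 \<le> t \<and> cycle_ind F k t x = 1} = {}"
    by (auto simp: cycle_ind_eq[OF assms])
  then have "Inf {ereal t | t. 0 \<le> t \<and> cycle_ind F k t x = 1} = \<infinity>" by (simp only: Inf_empty top_ereal_def)
  then show ?thesis using False by (simp add: birth_def)
qed

lemma death_eq:
  assumes "k \<ge> 1" "tuple_birth k x < tuple_death k x"
  shows "death F k x = ereal (tuple_death k x)"
proof -
  have "Inf {ereal t | t. 0 \<le> t \<and> birth F k x \<le> ereal t \<and> cycle_ind F k t x = 0} = ereal (tuple_death k x)"
    using assms(2) tuple_birth_nonneg[of k x] birth_eq[OF assms(1), of F x]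
    by (intro Inf_eqI) (auto simp: cycle_ind_eq[OF assms(1)] of_bool_def split: if_splits)
  then show ?thesis by (simp add: death_def)
qed

lemma tuple_diagram_eq:
  assumes "k \<ge> 1"
  shows "tuple_diagram F k x = (if tuple_birth k x < tuple_death k x
    then return (borel_of DeltaL) (tuple_birth k x, ereal (tuple_death k x)) else null_point_measure DeltaL)"
  using birth_eq[OF assms, of F x] death_eq[OF assms, of x F] by (simp add: tuple_diagram_def)

section \<open>Persistence diagram with one isolated tuple\<close>

definition close_points :: "('i \<Rightarrow> 'a::metric_space) \<Rightarrow> 'i set \<Rightarrow> real \<Rightarrow> bool" where
  "close_points x J \<rho> \<longleftrightarrow> (\<forall>i\<in>J. \<forall>j\<in>J. dist (x i) (x j) \<le> \<rho>)"

text \<open>The two simplices share a vertex since \<open>k \<ge> 1\<close>. Only the distance of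
  \<open>u\<close> and \<open>w\<close> needs the detour through it, whence the factor 2.
  \<open>J\<close> selects one index per point because \<open>x\<close> may repeat points.\<close>

lemma linked_simplices_close:
  fixes x :: "'i \<Rightarrow> 'a::euclidean_space"
  assumes k: "k \<ge> 1" and I: "finite I" and U: "U \<subseteq> {..s}"
    and link: "u \<noteq> w" "length ys = k" "distinct (u # ys)" "distinct (w # ys)"
      "set (u # ys) \<in> cech_at (x ` I) U" "set (w # ys) \<in> cech_at (x ` I) U"
  obtains J where "J \<subseteq> I" "card J = k + 2" "inj_on x J" "x ` J = insert u (insert w (set ys))"
    "close_points x J (2 * s)"
proof -
  let ?B = "insert u (insert w (set ys))"
  have "?B \<subseteq> x ` I" using link by (auto simp: cech_at_def)
  then obtain J where J: "J \<subseteq> I" "inj_on x J" "?B = x ` J" by (auto simp: subset_image_inj)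
  have "card ?B = k + 2" using link by (simp add: distinct_card)
  then have "card J = k + 2" using J card_image by metis
  have d: "dist p q \<le> s" if "p \<in> \<sigma>" "q \<in> \<sigma>" "\<sigma> \<in> cech_at (x ` I) U" "finite \<sigma>" for p q \<sigma>
    using dist_le_cech_time[OF that(4,1,2)] that(3) U by (auto simp: cech_at_def)
  obtain y where y: "y \<in> set ys" using link k by (cases ys) auto
  have s: "0 \<le> s" using d[of u "set (u # ys)" u] link by auto
  have uw: "dist u w \<le> 2 * s"
    using d[of u "set (u # ys)" y] d[of y "set (w # ys)" w] link y dist_triangle[of u w y] by auto
  have "dist p q \<le> 2 * s" if pq: "p \<in> ?B" "q \<in> ?B" for p q
  proof -
    consider "p \<in> set (u # ys)" "q \<in> set (u # ys)" | "p \<in> set (w # ys)" "q \<in> set (w # ys)"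
      | "p = u" "q = w" | "p = w" "q = u" using pq by auto
    then show ?thesis
    proof cases
      case 1
      then show ?thesis using d[OF 1 link(5)] s by auto
    next
      case 2
      then show ?thesis using d[OF 2 link(6)] s by auto
    qed (use uw in \<open>auto simp: dist_commute\<close>)
  qed
  then have "close_points x J (2 * s)" unfolding close_points_def J(3) by blast
  then show ?thesis using that J \<open>card J = k + 2\<close> by metis
qed

text \<open>The scale \<open>2 * s\<close> serves twice. Linked simplices with times up to
  \<open>s\<close> have diameter at most \<open>2 * s\<close>, so only the isolated tuple can carry
  a cycle. A cycle born by \<open>s\<close> dies by \<open>2 * s\<close>, so a simplex on
  \<open>k + 2\<close> vertices that precedes its death also has diameter at most
  \<open>2 * s\<close> and must be the tuple itself.\<close>

lemma persistent_betti_isolated: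
  fixes F :: "'f::field itself" and x :: "nat \<Rightarrow> 'a::euclidean_space"
  assumes k: "k \<ge> 1" and I: "finite I" "{..<k + 2} \<subseteq> I"
    and iso: "\<And>J. J \<subseteq> I \<Longrightarrow> card J = k + 2 \<Longrightarrow> close_points x J (2 * s) \<Longrightarrow> J = {..<k + 2}"
    and U: "U \<subseteq> {..s}" "U \<subseteq> U'"
    and down: "\<And>u v. u \<in> U \<Longrightarrow> v \<le> u \<Longrightarrow> v \<in> U" "\<And>u v. u \<in> U' \<Longrightarrow> v \<le> u \<Longrightarrow> v \<in> U'"
  shows "persistent_betti F k (cech_at (x ` I) U) (cech_at (x ` I) U') =
    of_bool (tuple_birth k x \<in> U \<and> tuple_death k x \<notin> U')"
proof -
  let ?A = "x ` {..<k + 2}"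
  have sub: "?A \<subseteq> x ` I" using I by blast
  have link: "insert u (insert w (set ys)) = ?A \<and> inj_on x {..<k + 2}"
    if link: "u \<noteq> w" "length ys = k" "distinct (u # ys)" "distinct (w # ys)"
      "set (u # ys) \<in> cech_at (x ` I) U" "set (w # ys) \<in> cech_at (x ` I) U" for u w ys
  proof -
    obtain J where J: "J \<subseteq> I" "card J = k + 2" "inj_on x J" "x ` J = insert u (insert w (set ys))"
      "close_points x J (2 * s)"
      using linked_simplices_close[OF k I(1) U(1) link] .
    then have "J = {..<k + 2}" using iso by blast
    then show ?thesis using J by simp
  qed
  show ?thesis
  proof (cases "inj_on x {..<k + 2}")
    case True
    have faces: "(\<forall>a\<in>?A. ?A - {a} \<in> cech_at (x ` I) U) \<longleftrightarrow> tuple_birth k x \<in> U"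
      by (rule tuple_faces[OF True sub down(1)])
    have full: "?A \<in> cech_at (x ` I) U' \<longleftrightarrow> tuple_death k x \<in> U'"
      by (rule tuple_simplex[OF sub])
    have "persistent_betti F k (cech_at (x ` I) U) (cech_at (x ` I) U') =
      of_bool ((\<forall>a\<in>?A. ?A - {a} \<in> cech_at (x ` I) U) \<and> ?A \<notin> cech_at (x ` I) U')"
    proof (rule persistent_betti_single[OF k])
      show "finite ?A" by simp
      show "card ?A = k + 2" using True by (simp add: card_image)
      show "insert u (insert w (set ys)) = ?A"
        if "u \<noteq> w" "length ys = k" "distinct (u # ys)" "distinct (w # ys)"
          "set (u # ys) \<in> cech_at (x ` I) U" "set (w # ys) \<in> cech_at (x ` I) U" for u w ys
        using link[OF that] by blast
      assume "\<forall>a\<in>?A. ?A - {a} \<in> cech_at (x ` I) U"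
      then have "tuple_birth k x \<le> s" using faces U by auto
      then have death: "tuple_death k x \<le> 2 * s" using tuple_death_le[OF k, of x] by linarith
      show "?A \<in> cech_at (x ` I) U' \<or> (\<forall>\<sigma>\<in>cech_at (x ` I) U'. card \<sigma> \<noteq> k + 2)"
      proof (rule ccontr)
        assume "\<not> ?thesis"
        then obtain \<sigma> where \<sigma>: "tuple_death k x \<notin> U'" "\<sigma> \<in> cech_at (x ` I) U'" "card \<sigma> = k + 2"
          unfolding full by blast
        then have "\<sigma> \<subseteq> x ` I" "cech_time \<sigma> \<in> U'" by (auto simp: cech_at_def)
        then obtain J where J: "J \<subseteq> I" "inj_on x J" "\<sigma> = x ` J" by (auto simp: subset_image_inj)
        have "card J = k + 2" using J \<sigma>(3) card_image by metis
        then have "finite J" using card.infinite by fastforce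
        \<comment> \<open>\<open>U'\<close> is closed downwards and misses the death time, so it
          lies strictly below it.\<close>
        have "cech_time \<sigma> < tuple_death k x" using down(2)[OF \<open>cech_time \<sigma> \<in> U'\<close>] \<sigma>(1) by (meson not_le)
        then have "dist (x i) (x j) \<le> 2 * s" if "i \<in> J" "j \<in> J" for i j
          using dist_le_cech_time[of \<sigma> "x i" "x j"] that death \<open>finite J\<close> J by auto
        then have "J = {..<k + 2}" using iso[OF J(1) \<open>card J = k + 2\<close>] by (simp add: close_points_def)
        then show False using \<sigma>(1) \<open>cech_time \<sigma> \<in> U'\<close> J by (simp add: tuple_death_def)
      qed
    qed
    then show ?thesis unfolding faces full .
  next
    case False
    \<comment> \<open>A nonzero cycle would provide an index set on which \<open>x\<close> is
      injective, and isolation identifies this set with \<open>{..<k + 2}\<close>.\<close>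
    have "cycles k (cech_at (x ` I) U) = {\<lambda>_. 0 :: 'f}"
      using link False by (intro cycles_trivial[OF k]) blast
    moreover have "\<not> (tuple_birth k x \<in> U \<and> tuple_death k x \<notin> U')"
      using tuple_birth_eq_death[OF False] U by auto
    ultimately show ?thesis by (simp add: persistent_betti_trivial)
  qed
qed

text \<open>The four persistent Betti numbers are indicators, and their mixed difference is a unit
  mass at the scaled birth and death. Only the birth is limited by \<open>s\<close>; the death
  \<open>d\<close> is free, even infinite.\<close>

lemma persistence_mult_isolated:
  fixes F :: "'f::field itself" and x :: "nat \<Rightarrow> 'a::euclidean_space"
  assumes k: "k \<ge> 1" and I: "finite I" "{..<k + 2} \<subseteq> I"
    and iso: "\<And>J. J \<subseteq> I \<Longrightarrow> card J = k + 2 \<Longrightarrow> close_points x J (2 * s) \<Longrightarrow> J = {..<k + 2}"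
    and r: "r > 0" and b: "0 \<le> b" "ereal b < d" "r * b \<le> s"
  shows "persistence_mult F k (\<lambda>t. cech (x ` I) (r * t)) (b, d) =
    of_bool (b = tuple_birth k x / r \<and> d = ereal (tuple_death k x / r))"
proof -
  let ?B = "tuple_birth k x" and ?D = "tuple_death k x"
  have fin: "finite (x ` I)" using I by simp
  note pb = persistent_betti_isolated[OF k I iso]
  have lt: "ereal (c / r) < d" if "c \<le> r * b" for c
  proof -
    have "c / r \<le> b" using that r by (simp add: field_simps)
    then show ?thesis using b(2) by (meson ereal_less_eq(3) order_le_less_trans)
  qed
  have down: "ereal (v / r) < d" if "ereal (u / r) < d" "v \<le> u" for u v
  proof -
    have "v / r \<le> u / r" using that r by (simp add: divide_right_mono)
    then show ?thesis using that(1) by (meson ereal_less_eq(3) order_le_less_trans)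
  qed
  have rbd: "r * b < r * e" if "d = ereal e" for e using b r that by simp
  have 1: "persistent_betti F k (cech_at (x ` I) {..r * b}) (cech_at (x ` I) {c. ereal (c / r) < d}) =
      of_bool (?B \<le> r * b \<and> \<not> ereal (?D / r) < d)"
    using b lt down by (subst pb) auto
  have 2: "persistent_betti F k (cech_at (x ` I) {..<r * b}) (cech_at (x ` I) {c. ereal (c / r) < d}) =
      of_bool (?B < r * b \<and> \<not> ereal (?D / r) < d)"
    using b lt down by (subst pb) auto
  have 3: "persistent_betti F k (cech_at (x ` I) {..r * b}) (cech_at (x ` I) {..r * e}) =
      of_bool (?B \<le> r * b \<and> \<not> ?D \<le> r * e)" if "d = ereal e" for e
    using b rbd[OF that] by (subst pb) auto
  have 4: "persistent_betti F k (cech_at (x ` I) {..<r * b}) (cech_at (x ` I) {..r * e}) =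
      of_bool (?B < r * b \<and> \<not> ?D \<le> r * e)" if "d = ereal e" for e
    using b rbd[OF that] by (subst pb) auto
  show ?thesis
  proof (cases d)
    case (real e)
    have eqs: "b = ?B / r \<longleftrightarrow> ?B = r * b" "d = ereal (?D / r) \<longleftrightarrow> ?D = r * e" "ereal (?D / r) < d \<longleftrightarrow> ?D < r * e"
      using r real by (auto simp: field_simps)
    have "r * b < r * e" by (rule rbd[OF real])
    then show ?thesis
      unfolding persistence_mult_cech[OF fin r b(1,2)] Let_def 1 2 eqs
      using real by (cases "?B = r * b"; cases "?B < r * b"; cases "?D = r * e"; cases "?D < r * e")
        (simp_all add: 3[OF real] 4[OF real])
  next
    case PInf
    then show ?thesis
      unfolding persistence_mult_cech[OF fin r b(1,2)] Let_def 1 2 by simp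
  qed (use b in auto)
qed

text \<open>A birth at \<open>b\<close> needs a nonzero cycle at that time, and such a cycle links
  \<open>k + 2\<close> vertices.\<close>

lemma persistence_mult_close:
  fixes F :: "'f::field itself" and x :: "'i \<Rightarrow> 'a::euclidean_space"
  assumes k: "k \<ge> 1" and I: "finite I"
    and r: "r > 0" and b: "0 \<le> b" "ereal b < d"
    and nonzero: "persistence_mult F k (\<lambda>t. cech (x ` I) (r * t)) (b, d) \<noteq> 0"
  shows "\<exists>J\<subseteq>I. card J = k + 2 \<and> close_points x J (2 * (r * b))"
proof (rule ccontr)
  assume *: "\<not> ?thesis"
  have cyc: "cycles k (cech_at (x ` I) U) = {\<lambda>_. 0 :: 'f}" if U: "U \<subseteq> {..r * b}" for U
  proof (rule cycles_trivial[OF k])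
    fix u w :: 'a and ys :: "'a list"
    assume link: "u \<noteq> w" "length ys = k" "distinct (u # ys)" "distinct (w # ys)"
      "set (u # ys) \<in> cech_at (x ` I) U" "set (w # ys) \<in> cech_at (x ` I) U"
    obtain J where "J \<subseteq> I" "card J = k + 2" "close_points x J (2 * (r * b))"
      using linked_simplices_close[OF k I U link] .
    then show False using * by blast
  qed
  have pb: "persistent_betti F k (cech_at (x ` I) U) L = 0" if "U \<subseteq> {..r * b}" for U L
    by (rule persistent_betti_trivial[OF cyc[OF that]])
  have "{..<r * b} \<subseteq> {..r * b}" by auto
  then have "persistence_mult F k (\<lambda>t. cech (x ` I) (r * t)) (b, d) = 0"
    unfolding persistence_mult_cech[OF finite_imageI[OF I] r b] Let_def by (simp add: pb)
  then show False using nonzero by simp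
qed

section \<open>Point measures\<close>

lemma space_borel_of [simp]: "space (borel_of T) = topspace T"
  unfolding borel_of_def by (rule space_measure_of) (auto dest: openin_subset)

lemma openin_sets_borel_of: "openin T U \<Longrightarrow> U \<in> sets (borel_of T)"
  unfolding borel_of_def by (subst sets_measure_of) (auto dest: openin_subset)

lemma measurable_borel_ofI:
  assumes "\<And>\<omega>. \<omega> \<in> space N \<Longrightarrow> h \<omega> \<in> topspace T"
    and "\<And>U. openin T U \<Longrightarrow> h -` U \<inter> space N \<in> sets N"
  shows "h \<in> measurable N (borel_of T)"
  unfolding borel_of_def using assms by (intro measurable_measure_of) (auto dest: openin_subset)

lemma continuous_map_measurable:
  assumes "continuous_map T euclideanreal g"
  shows "g \<in> borel_measurable (borel_of T)"
proof (rule borel_measurableI)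
  fix S :: "real set" assume "open S"
  then have "openin T {x \<in> topspace T. g x \<in> S}"
    using assms by (simp add: continuous_map_def)
  moreover have "g -` S \<inter> space (borel_of T) = {x \<in> topspace T. g x \<in> S}" by auto
  ultimately show "g -` S \<inter> space (borel_of T) \<in> sets (borel_of T)"
    using openin_sets_borel_of by metis
qed

lemma sets_dirac_sum [simp]: "sets (dirac_sum T m) = sets (borel_of T)"
  by (simp add: dirac_sum_def)

lemma integral_dirac_sum:
  assumes "g \<in> borel_measurable (borel_of T)"
  shows "(\<integral>x. g x \<partial>dirac_sum T m) = (\<integral>p. real (m p) * (g p :: real) \<partial>count_space (topspace T))"
proof -
  have "(\<integral>x. g x \<partial>dirac_sum T m) = (\<integral>x. g x \<partial>density (count_space (topspace T)) (\<lambda>p. ennreal (real (m p))))"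
    unfolding dirac_sum_def using assms
    by (subst integral_distr) (auto simp: ennreal_of_nat_eq_real_of_nat)
  also have "\<dots> = (\<integral>p. real (m p) * g p \<partial>count_space (topspace T))"
    by (subst integral_density) auto
  finally show ?thesis .
qed

lemma emeasure_dirac_sum:
  assumes "A \<in> sets (borel_of T)"
  shows "emeasure (dirac_sum T m) A = (\<integral>\<^sup>+p. of_nat (m p) * indicator A p \<partial>count_space (topspace T))"
proof -
  have "A \<subseteq> topspace T" using sets.sets_into_space[OF assms] by simp
  then show ?thesis
    unfolding dirac_sum_def using assms
    by (subst emeasure_distr) (auto simp: emeasure_density Int_absorb2)
qed

lemma dirac_sum_radon:
  assumes "finite {p \<in> topspace T. m p \<noteq> 0}"
  shows "dirac_sum T m \<in> radon_point_measures T"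
proof -
  have "emeasure (dirac_sum T m) K < \<infinity>" for K
  proof -
    have "emeasure (dirac_sum T m) K \<le> emeasure (dirac_sum T m) (space (dirac_sum T m))"
      by (rule emeasure_space)
    also have "\<dots> = (\<integral>\<^sup>+p. of_nat (m p) * indicator (topspace T) p \<partial>count_space (topspace T))"
      using emeasure_dirac_sum[OF openin_sets_borel_of[OF openin_topspace], of T m]
      by (simp add: dirac_sum_def)
    also have "\<dots> = (\<Sum>p\<in>{p \<in> topspace T. m p \<noteq> 0}. of_nat (m p) * indicator (topspace T) p)"
      using assms by (intro nn_integral_count_space') auto
    also have "\<dots> < \<infinity>" using assms by (auto simp: ennreal_of_nat_eq_real_of_nat ennreal_mult_less_top indicator_def less_top)
    finally show ?thesis .
  qed
  then show ?thesis using assms unfolding radon_point_measures_def by (auto simp: countable_finite)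
qed

lemma null_point_measure_eq: "null_point_measure T = dirac_sum T (\<lambda>_. 0)"
  by (rule measure_eqI) (auto simp: null_point_measure_def emeasure_dirac_sum)

lemma return_eq_dirac_sum:
  assumes "p \<in> topspace T"
  shows "return (borel_of T) p = dirac_sum T (\<lambda>q. of_bool (q = p))"
proof (rule measure_eqI)
  fix A assume "A \<in> sets (return (borel_of T) p)"
  then have A: "A \<in> sets (borel_of T)" by simp
  have "emeasure (dirac_sum T (\<lambda>q. of_bool (q = p))) A =
      (\<integral>\<^sup>+q. of_nat (of_bool (q = p)) * indicator A q \<partial>count_space (topspace T))"
    by (rule emeasure_dirac_sum[OF A])
  also have "\<dots> = (\<Sum>q\<in>{p}. of_nat (of_bool (q = p)) * indicator A q)"
    using assms by (intro nn_integral_count_space') auto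
  finally show "emeasure (return (borel_of T) p) A = emeasure (dirac_sum T (\<lambda>q. of_bool (q = p))) A"
    using A by simp
qed simp

section \<open>Countable base and measurability for the vague topology\<close>

lemma topspace_vague [simp]: "topspace (vague_topology T) = radon_point_measures T"
proof -
  have "(\<lambda>_. 0) \<in> CK_plus T"
    unfolding CK_plus_def by (auto intro!: exI[of _ "{}"])
  then have "{N \<in> radon_point_measures T. (\<integral>x. 0 \<partial>N) \<in> UNIV} \<in>
     {{N \<in> radon_point_measures T. (\<integral>x. g x \<partial>N) \<in> U} | g U. g \<in> CK_plus T \<and> open (U :: real set)}"
    by blast
  then show ?thesis unfolding vague_topology_def by auto
qed

text \<open>\<open>vague_metric\<close> provides a separable metric; balls of radius
  \<open>1 / (n + 1)\<close> around a countable dense set form a base.\<close>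

lemma second_countable_vague:
  assumes "vague_metric T \<rho>"
  shows "second_countable (vague_topology T)"
proof -
  interpret Metric_space "radon_point_measures T" \<rho> using assms by (simp add: vague_metric_def)
  have top: "mtopology = vague_topology T" using assms by (simp add: vague_metric_def)
  obtain C where C: "countable C" "C \<subseteq> topspace mtopology" "mtopology closure_of C = topspace mtopology"
    using assms unfolding vague_metric_def separable_space_def top by blast
  let ?B = "(\<lambda>(c, n). mball c (inverse (real (Suc n)))) ` (C \<times> UNIV)"
  have "second_countable mtopology"
    unfolding second_countable_def
  proof (intro exI[of _ ?B] conjI allI impI)
    show "countable ?B" using C by auto
    show "\<forall>V\<in>?B. openin mtopology V" by auto
    fix U x assume "openin mtopology U \<and> x \<in> U"
    then obtain e where e: "e > 0" "mball x e \<subseteq> U" "x \<in> radon_point_measures T"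
      by (metis openin_mtopology subsetD)
    \<comment> \<open>Half of \<open>e\<close>, because both the distance from \<open>x\<close> to
      the centre \<open>c\<close> and the radius of the ball around \<open>c\<close> count.\<close>
    obtain n where n: "inverse (real (Suc n)) < e / 2" using e(1) reals_Archimedean half_gt_zero by blast
    have "x \<in> mtopology closure_of C" using C e(3) by simp
    moreover have "x \<in> mball x (inverse (real (Suc n)))" using e(3) by simp
    moreover have "openin mtopology (mball x (inverse (real (Suc n))))" by blast
    ultimately obtain c where c: "c \<in> C" "c \<in> mball x (inverse (real (Suc n)))"
      unfolding in_closure_of by blast
    have "mball c (inverse (real (Suc n))) \<subseteq> U"
    proof
      fix y assume "y \<in> mball c (inverse (real (Suc n)))"
      then have "\<rho> x y \<le> \<rho> x c + \<rho> c y" "\<rho> c y < inverse (real (Suc n))" "y \<in> radon_point_measures T"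
        using c e(3) by (auto intro: triangle)
      then have "y \<in> mball x e" using c n e(3) by auto
      then show "y \<in> U" using e by blast
    qed
    moreover have "x \<in> mball c (inverse (real (Suc n)))" using c e(3) by (auto simp: commute)
    ultimately show "\<exists>V\<in>?B. x \<in> V \<and> V \<subseteq> U" using c(1) by blast
  qed
  then show ?thesis by (simp add: top)
qed

text \<open>The Lindeloef property: one member of \<open>K\<close> is chosen for each basic open set
  that fits into some member.\<close>

lemma second_countable_subfamily:
  assumes "second_countable X" "\<And>U. U \<in> K \<Longrightarrow> openin X U"
  obtains K' where "countable K'" "K' \<subseteq> K" "\<Union>K' = \<Union>K"
proof -
  obtain B where B: "countable B" "\<And>U x. openin X U \<Longrightarrow> x \<in> U \<Longrightarrow> \<exists>V\<in>B. x \<in> V \<and> V \<subseteq> U"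
    using assms(1) unfolding second_countable_def by metis
  define f where "f V = (SOME U. U \<in> K \<and> V \<subseteq> U)" for V
  let ?B = "{V\<in>B. \<exists>U\<in>K. V \<subseteq> U}"
  have f: "f V \<in> K" "V \<subseteq> f V" if "V \<in> ?B" for V
    using someI_ex[of "\<lambda>U. U \<in> K \<and> V \<subseteq> U"] that unfolding f_def by auto
  show ?thesis
  proof (rule that[of "f ` ?B"])
    show "countable (f ` ?B)" using B(1) by (auto intro: countable_subset)
    show "f ` ?B \<subseteq> K" using f by blast
    show "\<Union> (f ` ?B) = \<Union> K"
    proof (intro equalityI subsetI)
      fix x assume "x \<in> \<Union> K"
      then obtain U where "U \<in> K" "x \<in> U" by blast
      then obtain V where "V \<in> B" "x \<in> V" "V \<subseteq> U" using B(2) assms(2) by metis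
      then have "V \<in> ?B" using \<open>U \<in> K\<close> by blast
      then show "x \<in> \<Union> (f ` ?B)" using f(2) \<open>x \<in> V\<close> by blast
    qed (use f(1) in blast)
  qed
qed

text \<open>Induction over the generation of the topology from test integrals. The generation admits
  arbitrary unions, which a family of measurable sets does not; the Lindeloef property makes them
  countable.\<close>

lemma measurable_vagueI:
  assumes \<rho>: "vague_metric T \<rho>"
    and radon: "\<And>\<omega>. \<omega> \<in> space N \<Longrightarrow> h \<omega> \<in> radon_point_measures T"
    and meas: "\<And>g. g \<in> CK_plus T \<Longrightarrow> (\<lambda>\<omega>. \<integral>x. g x \<partial>h \<omega>) \<in> borel_measurable N"
  shows "h \<in> measurable N (borel_of (vague_topology T))"
proof (rule measurable_borel_ofI)
  let ?S = "{{N \<in> radon_point_measures T. (\<integral>x. g x \<partial>N) \<in> U} | g U. g \<in> CK_plus T \<and> open (U :: real set)}"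
  fix U assume "openin (vague_topology T) U"
  then have "generate_topology_on ?S U"
    unfolding vague_topology_def by (simp add: openin_topology_generated_by)
  then show "h -` U \<inter> space N \<in> sets N"
  proof induction
    case (Int a b)
    moreover have "h -` (a \<inter> b) \<inter> space N = (h -` a \<inter> space N) \<inter> (h -` b \<inter> space N)" by auto
    ultimately show ?case by simp
  next
    case (UN K)
    have "openin (vague_topology T) V" if "V \<in> K" for V
      using UN(1)[OF that] unfolding vague_topology_def by (simp add: openin_topology_generated_by_iff)
    then obtain K' where K': "countable K'" "K' \<subseteq> K" "\<Union>K' = \<Union>K"
      using second_countable_subfamily[OF second_countable_vague[OF \<rho>]] by metis
    have "h -` \<Union>K \<inter> space N = (\<Union>V\<in>K'. h -` V \<inter> space N)" unfolding K'(3)[symmetric] by auto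
    moreover have "(\<Union>V\<in>K'. h -` V \<inter> space N) \<in> sets N"
      using K' UN(2) by (intro sets.countable_UN'') auto
    ultimately show ?case by simp
  next
    case (Basis s)
    then obtain g V where s: "s = {N \<in> radon_point_measures T. (\<integral>x. g x \<partial>N) \<in> V}" "g \<in> CK_plus T" "open V" by blast
    have "h -` s \<inter> space N = (\<lambda>\<omega>. \<integral>x. g x \<partial>h \<omega>) -` V \<inter> space N" using radon unfolding s(1) by auto
    then show ?case using measurable_sets[OF meas[OF s(2)], of V] s(3) by simp
  qed simp
qed (use radon in simp)

section \<open>Vague neighbourhoods on the half plane of persistence pairs\<close>

lemma topspace_DeltaL [simp]: "topspace DeltaL = {(x, y). 0 \<le> x \<and> ereal x < y}"
  by (simp add: DeltaL_def)

text \<open>Births range over a half line that is not compactified, so a compact set has bounded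
  births, while its deaths may be infinite. Every birth cutoff below originates here.\<close>

lemma CK_plus_birth_bounded:
  assumes "g \<in> CK_plus DeltaL"
  shows "\<exists>T0. \<forall>p\<in>topspace DeltaL. g p \<noteq> 0 \<longrightarrow> fst p \<le> T0"
proof -
  obtain K where K: "compactin DeltaL K" "\<forall>x\<in>topspace DeltaL - K. g x = 0"
    using assms by (auto simp: CK_plus_def)
  then have "compact K" by (simp add: DeltaL_def compactin_subtopology)
  then have "compact (fst ` K)" by (intro compact_continuous_image continuous_intros)
  then have "bdd_above (fst ` K)" by (simp add: compact_imp_bounded bounded_imp_bdd_above)
  then obtain T0 where T0: "\<forall>b\<in>fst ` K. b \<le> T0" unfolding bdd_above_def by blast
  have "p \<in> K" if "p \<in> topspace DeltaL" "g p \<noteq> 0" for p using K(2) that by blast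
  then show ?thesis using T0 by (intro exI[of _ T0]) blast
qed

text \<open>Agreement for the test functions that see only births up to \<open>T0\<close>. Stated
  through integrals, it fits the vague topology, and for \<open>dirac_sum\<close> it can be checked
  atom by atom.\<close>

definition agree_up_to :: "real \<Rightarrow> (real \<times> ereal) measure \<Rightarrow> (real \<times> ereal) measure \<Rightarrow> bool" where
  "agree_up_to T0 N N' \<longleftrightarrow> (\<forall>g\<in>CK_plus DeltaL. (\<forall>p\<in>topspace DeltaL. g p \<noteq> 0 \<longrightarrow> fst p \<le> T0) \<longrightarrow>
     (\<integral>x. g x \<partial>N) = (\<integral>x. g x \<partial>N'))"

lemma agree_up_to_mono: "agree_up_to T1 N N' \<Longrightarrow> T0 \<le> T1 \<Longrightarrow> agree_up_to T0 N N'"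
  unfolding agree_up_to_def by (meson order_trans)

lemma agree_up_to_dirac_sum:
  assumes "\<And>p. p \<in> topspace DeltaL \<Longrightarrow> fst p \<le> T0 \<Longrightarrow> m p = m' p"
  shows "agree_up_to T0 (dirac_sum DeltaL m) (dirac_sum DeltaL m')"
  unfolding agree_up_to_def
proof (intro ballI impI)
  fix g assume g: "g \<in> CK_plus DeltaL" "\<forall>p\<in>topspace DeltaL. g p \<noteq> 0 \<longrightarrow> fst p \<le> T0"
  then have meas: "g \<in> borel_measurable (borel_of DeltaL)"
    by (auto simp: CK_plus_def intro: continuous_map_measurable)
  have "real (m p) * g p = real (m' p) * g p" if "p \<in> topspace DeltaL" for p
    using assms[OF that] g(2) that by (cases "g p = 0") auto
  then show "(\<integral>x. g x \<partial>dirac_sum DeltaL m) = (\<integral>x. g x \<partial>dirac_sum DeltaL m')"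
    unfolding integral_dirac_sum[OF meas] by (intro Bochner_Integration.integral_cong) auto
qed

text \<open>A basic neighbourhood involves finitely many test functions, each with bounded births,
  and \<open>T0\<close> is the maximum of the bounds. Exact agreement up to a cutoff thereby
  replaces estimates of integrals.\<close>

lemma vague_open_agree:
  assumes "openin (vague_topology DeltaL) U" "N0 \<in> U"
  shows "\<exists>T0. \<forall>N\<in>radon_point_measures DeltaL. agree_up_to T0 N N0 \<longrightarrow> N \<in> U"
proof -
  let ?S = "{{N \<in> radon_point_measures DeltaL. (\<integral>x. g x \<partial>N) \<in> U} | g U. g \<in> CK_plus DeltaL \<and> open (U :: real set)}"
  have "generate_topology_on ?S U"
    using assms(1) unfolding vague_topology_def by (simp add: openin_topology_generated_by)
  then show ?thesis using assms(2)
  proof induction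
    case (Int a b)
    then obtain T1 T2 where "\<forall>N\<in>radon_point_measures DeltaL. agree_up_to T1 N N0 \<longrightarrow> N \<in> a"
      "\<forall>N\<in>radon_point_measures DeltaL. agree_up_to T2 N N0 \<longrightarrow> N \<in> b" by blast
    then show ?case
      by (intro exI[of _ "max T1 T2"]) (meson IntI agree_up_to_mono max.cobounded1 max.cobounded2)
  next
    case (UN K)
    then obtain V where "V \<in> K" "N0 \<in> V" by blast
    then show ?case using UN.IH[OF \<open>V \<in> K\<close>] by blast
  next
    case (Basis s)
    then obtain g V where s: "s = {N \<in> radon_point_measures DeltaL. (\<integral>x. g x \<partial>N) \<in> V}" "g \<in> CK_plus DeltaL" by blast
    obtain T0 where T0: "\<forall>p\<in>topspace DeltaL. g p \<noteq> 0 \<longrightarrow> fst p \<le> T0"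
      using CK_plus_birth_bounded[OF s(2)] by blast
    have "N \<in> s" if N: "N \<in> radon_point_measures DeltaL" "agree_up_to T0 N N0" for N
    proof -
      have "(\<integral>x. g x \<partial>N) = (\<integral>x. g x \<partial>N0)" using N(2) T0 s(2) unfolding agree_up_to_def by blast
      then show ?thesis using N(1) Basis(2) unfolding s(1) by simp
    qed
    then show ?case by (intro exI[of _ T0]) simp
  qed simp
qed

lemma vague_continuous_agree:
  assumes \<phi>: "continuous_map (vague_topology DeltaL) euclideanreal \<phi>" and N0: "N0 \<in> radon_point_measures DeltaL" and e: "e > 0"
  shows "\<exists>T0. \<forall>N\<in>radon_point_measures DeltaL. agree_up_to T0 N N0 \<longrightarrow> \<bar>\<phi> N - \<phi> N0\<bar> < e"
proof -
  let ?U = "{N \<in> topspace (vague_topology DeltaL). \<phi> N \<in> ball (\<phi> N0) e}"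
  have U: "openin (vague_topology DeltaL) ?U"
    by (rule openin_continuous_map_preimage[OF \<phi>]) simp
  have N0U: "N0 \<in> ?U" using N0 e by simp
  obtain T0 where T0: "\<forall>N\<in>radon_point_measures DeltaL. agree_up_to T0 N N0 \<longrightarrow> N \<in> ?U"
    using vague_open_agree[OF U N0U] by blast
  show ?thesis
  proof (intro exI[of _ T0] ballI impI)
    fix N assume "N \<in> radon_point_measures DeltaL" "agree_up_to T0 N N0"
    then have "N \<in> ?U" using T0 by blast
    then show "\<bar>\<phi> N - \<phi> N0\<bar> < e" by (simp add: dist_real_def abs_minus_commute)
  qed
qed

section \<open>Diagrams as random point measures\<close>

text \<open>Birth and death are Cech times of two vertex sets; the empty second set stands for an
  infinite death.\<close>

lemma cech_diagram_support:
  assumes S: "finite S" and r: "r > 0"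
  shows "{p \<in> topspace DeltaL. persistence_mult F k (\<lambda>t. cech S (r * t)) p \<noteq> 0} \<subseteq>
    (\<lambda>(\<sigma>, \<tau>). (cech_time \<sigma> / r, if \<tau> = {} then \<infinity> else ereal (cech_time \<tau> / r))) ` ((Pow S - {{}}) \<times> Pow S)"
proof
  fix p assume p: "p \<in> {p \<in> topspace DeltaL. persistence_mult F k (\<lambda>t. cech S (r * t)) p \<noteq> 0}"
  obtain b d where bd: "p = (b, d)" by (cases p)
  have *: "0 \<le> b" "ereal b < d" "persistence_mult F k (\<lambda>t. cech S (r * t)) (b, d) \<noteq> 0"
    using p bd by auto
  obtain \<sigma> where \<sigma>: "\<sigma> \<subseteq> S" "\<sigma> \<noteq> {}" "b = cech_time \<sigma> / r"
    using persistence_mult_finite(1)[OF S r *] by blast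
  show "p \<in> (\<lambda>(\<sigma>, \<tau>). (cech_time \<sigma> / r, if \<tau> = {} then \<infinity> else ereal (cech_time \<tau> / r))) ` ((Pow S - {{}}) \<times> Pow S)"
  proof (cases "d = \<infinity>")
    case True
    then show ?thesis using \<sigma> bd by (intro image_eqI[where x="(\<sigma>, {})"]) auto
  next
    case False
    then obtain \<tau> where "\<tau> \<subseteq> S" "\<tau> \<noteq> {}" "d = ereal (cech_time \<tau> / r)"
      using persistence_mult_finite(2)[OF S r *] by blast
    then show ?thesis using \<sigma> bd by (intro image_eqI[where x="(\<sigma>, \<tau>)"]) auto
  qed
qed

lemma cech_diagram_radon:
  assumes "finite S" "r > 0"
  shows "cech_diagram F k r S \<in> radon_point_measures DeltaL"
  unfolding cech_diagram_def
  by (rule dirac_sum_radon, rule finite_subset[OF cech_diagram_support[OF assms]]) (simp add: assms(1))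

lemma tuple_diagram_dirac_sum:
  assumes "k \<ge> 1"
  shows "tuple_diagram F k y = dirac_sum DeltaL
    (\<lambda>q. of_bool (tuple_birth k y < tuple_death k y \<and> q = (tuple_birth k y, ereal (tuple_death k y))))"
proof (cases "tuple_birth k y < tuple_death k y")
  case True
  then have "(tuple_birth k y, ereal (tuple_death k y)) \<in> topspace DeltaL"
    using tuple_birth_nonneg[of k y] by simp
  from return_eq_dirac_sum[OF this] True show ?thesis by (simp add: tuple_diagram_eq[OF assms])
next
  case False
  then show ?thesis by (simp add: tuple_diagram_eq[OF assms] null_point_measure_eq)
qed

lemma tuple_diagram_radon:
  assumes "k \<ge> 1"
  shows "tuple_diagram F k y \<in> radon_point_measures DeltaL"
  unfolding tuple_diagram_dirac_sum[OF assms]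
  by (rule dirac_sum_radon, rule finite_subset[of _ "{(tuple_birth k y, ereal (tuple_death k y))}"]) auto

lemma null_point_measure_radon: "null_point_measure T \<in> radon_point_measures T"
  unfolding null_point_measure_eq by (rule dirac_sum_radon) simp

lemma tuple_death_affine:
  assumes "r > 0" "\<And>i. i < k + 2 \<Longrightarrow> x i = a + r *\<^sub>R y i"
  shows "tuple_death k x = r * tuple_death k y"
proof -
  have "x ` {..<k + 2} = (\<lambda>z. a + r *\<^sub>R z) ` y ` {..<k + 2}"
    unfolding image_image using assms(2) by (intro image_cong) auto
  moreover have "y ` {..<k + 2} \<noteq> {}" by (simp add: lessThan_empty_iff)
  ultimately show ?thesis unfolding tuple_death_def
    using cech_time_affine[OF assms(1), of "y ` {..<k + 2}" a] by simp
qed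

lemma tuple_birth_affine:
  assumes "r > 0" "\<And>i. i < k + 2 \<Longrightarrow> x i = a + r *\<^sub>R y i"
  shows "tuple_birth k x = r * tuple_birth k y"
proof -
  have "cech_time (x ` ({..<k + 2} - {i})) = r * cech_time (y ` ({..<k + 2} - {i}))" for i
  proof -
    have "x ` ({..<k + 2} - {i}) = (\<lambda>z. a + r *\<^sub>R z) ` y ` ({..<k + 2} - {i})"
      unfolding image_image using assms(2) by (intro image_cong) auto
    then show ?thesis using cech_time_affine[OF assms(1) _ face_nonempty, of y k i a] by simp
  qed
  then have "tuple_birth k x = Max ((*) r ` (\<lambda>i. cech_time (y ` ({..<k + 2} - {i}))) ` {..<k + 2})"
    by (simp add: tuple_birth_def image_image)
  also have "\<dots> = r * Max ((\<lambda>i. cech_time (y ` ({..<k + 2} - {i}))) ` {..<k + 2})"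
    using assms(1) by (intro mono_Max_commute[symmetric]) (auto simp: mono_def)
  finally show ?thesis by (simp add: tuple_birth_def)
qed

text \<open>Isolation at scale \<open>2 * (r * T0)\<close> controls all births up to
  \<open>T0\<close>, and the affine covariance of birth and death turns the rescaled pair of
  \<open>x\<close> into the pair of \<open>y\<close>.\<close>

lemma cech_diagram_agree_tuple:
  fixes F :: "'f::field itself" and x y :: "nat \<Rightarrow> 'a::euclidean_space"
  assumes k: "k \<ge> 1" and I: "finite I" "{..<k + 2} \<subseteq> I"
    and iso: "\<And>J. J \<subseteq> I \<Longrightarrow> card J = k + 2 \<Longrightarrow> close_points x J (2 * (r * T0)) \<Longrightarrow> J = {..<k + 2}"
    and r: "r > 0" and xy: "\<And>i. i < k + 2 \<Longrightarrow> x i = a + r *\<^sub>R y i"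
  shows "agree_up_to T0 (cech_diagram F k r (x ` I)) (tuple_diagram F k y)"
  unfolding cech_diagram_def tuple_diagram_dirac_sum[OF k]
proof (rule agree_up_to_dirac_sum)
  fix p :: "real \<times> ereal" assume p: "p \<in> topspace DeltaL" "fst p \<le> T0"
  obtain b d where bd: "p = (b, d)" by (cases p)
  have b: "0 \<le> b" "ereal b < d" "r * b \<le> r * T0" using p bd r by auto
  have "tuple_birth k x / r = tuple_birth k y" "tuple_death k x / r = tuple_death k y"
    using tuple_birth_affine[OF r xy] tuple_death_affine[OF r xy] r by auto
  moreover have "persistence_mult F k (\<lambda>t. cech (x ` I) (r * t)) (b, d) =
      of_bool (b = tuple_birth k x / r \<and> d = ereal (tuple_death k x / r))"
    by (rule persistence_mult_isolated[OF k I _ r b]) (rule iso)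
  ultimately have "persistence_mult F k (\<lambda>t. cech (x ` I) (r * t)) p =
      of_bool (b = tuple_birth k y \<and> d = ereal (tuple_death k y))"
    unfolding bd by simp
  then show "persistence_mult F k (\<lambda>t. cech (x ` I) (r * t)) p =
      of_bool (tuple_birth k y < tuple_death k y \<and> p = (tuple_birth k y, ereal (tuple_death k y)))"
    using b(2) bd by auto
qed

lemma cech_diagram_agree_null:
  fixes F :: "'f::field itself" and x :: "'i \<Rightarrow> 'a::euclidean_space"
  assumes k: "k \<ge> 1" and I: "finite I" and r: "r > 0"
    and far: "\<And>J. J \<subseteq> I \<Longrightarrow> card J = k + 2 \<Longrightarrow> \<not> close_points x J (2 * (r * T0))"
  shows "agree_up_to T0 (cech_diagram F k r (x ` I)) (null_point_measure DeltaL)"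
  unfolding cech_diagram_def null_point_measure_eq
proof (rule agree_up_to_dirac_sum)
  fix p :: "real \<times> ereal" assume p: "p \<in> topspace DeltaL" "fst p \<le> T0"
  obtain b d where bd: "p = (b, d)" by (cases p)
  have b: "0 \<le> b" "ereal b < d" "2 * (r * b) \<le> 2 * (r * T0)" using p bd r by auto
  show "persistence_mult F k (\<lambda>t. cech (x ` I) (r * t)) p = 0"
  proof (rule ccontr)
    assume "persistence_mult F k (\<lambda>t. cech (x ` I) (r * t)) p \<noteq> 0"
    then obtain J where J: "J \<subseteq> I" "card J = k + 2" "close_points x J (2 * (r * b))"
      using persistence_mult_close[OF k I r b(1,2), where F=F and x=x] unfolding bd by blast
    have "close_points x J (2 * (r * T0))"
      unfolding close_points_def
    proof (intro ballI)
      fix i j assume "i \<in> J" "j \<in> J"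
      then have "dist (x i) (x j) \<le> 2 * (r * b)" using J(3) by (simp add: close_points_def)
      then show "dist (x i) (x j) \<le> 2 * (r * T0)" using b(3) by linarith
    qed
    then show False using far[OF J(1,2)] by simp
  qed
qed

lemma tuple_diagram_agree_null:
  assumes "k \<ge> 1" "T0 < tuple_birth k y"
  shows "agree_up_to T0 (tuple_diagram F k y) (null_point_measure DeltaL)"
  unfolding tuple_diagram_dirac_sum[OF assms(1)] null_point_measure_eq
  by (rule agree_up_to_dirac_sum) (use assms(2) in auto)

lemma half_plane_borel: "{(x, y). 0 \<le> x \<and> ereal x < y} \<in> sets (borel :: (real \<times> ereal) measure)"
proof -
  have 1: "(\<lambda>p :: real \<times> ereal. fst p) \<in> borel_measurable borel"
    by (intro borel_measurable_continuous_onI continuous_intros)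
  have 2: "(\<lambda>p :: real \<times> ereal. snd p) \<in> borel_measurable borel"
    by (intro borel_measurable_continuous_onI continuous_intros)
  have "{p \<in> space (borel :: (real \<times> ereal) measure). 0 \<le> fst p} \<in> sets borel"
    using 1 by (intro borel_measurable_le) auto
  moreover have "{p \<in> space (borel :: (real \<times> ereal) measure). ereal (fst p) < snd p} \<in> sets borel"
    using 1 2 by (intro borel_measurable_less) auto
  ultimately have "{p \<in> space (borel :: (real \<times> ereal) measure). 0 \<le> fst p} \<inter>
      {p \<in> space borel. ereal (fst p) < snd p} \<in> sets borel" by (rule sets.Int)
  moreover have "{(x, y). 0 \<le> x \<and> ereal x < y} = {p \<in> space (borel :: (real \<times> ereal) measure). 0 \<le> fst p} \<inter>
      {p \<in> space borel. ereal (fst p) < snd p}" by auto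
  ultimately show ?thesis by simp
qed

text \<open>A test function is continuous only on the half plane. Its extension by zero is
  measurable because the half plane is a Borel set.\<close>

lemma CK_plus_extension_measurable:
  assumes "g \<in> CK_plus DeltaL"
  shows "(\<lambda>p. indicator (topspace DeltaL) p * g p) \<in> borel_measurable borel"
proof -
  have "continuous_on {(x, y). 0 \<le> x \<and> ereal x < y} g"
    using assms by (simp add: CK_plus_def DeltaL_def)
  from borel_measurable_continuous_on_indicator[OF half_plane_borel this]
  show ?thesis by simp
qed

section \<open>Measurability of the diagram map\<close>

text \<open>\<open>h\<close> factors through the discrete statistic \<open>D\<close>, and every
  function on a \<open>count_space\<close> is measurable.\<close>

lemma borel_measurable_determined:
  assumes D: "D \<in> measurable N (count_space A)"
    and h: "\<And>\<omega> \<omega>'. \<omega> \<in> space N \<Longrightarrow> \<omega>' \<in> space N \<Longrightarrow> D \<omega> = D \<omega>' \<Longrightarrow> h \<omega> = h \<omega>'"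
  shows "(h :: _ \<Rightarrow> real) \<in> borel_measurable N"
proof -
  define h' where "h' d = h (SOME \<omega>. \<omega> \<in> space N \<and> D \<omega> = d)" for d
  have "(\<lambda>\<omega>. h' (D \<omega>)) \<in> borel_measurable N"
    by (rule measurable_compose[OF D]) simp
  moreover have "h' (D \<omega>) = h \<omega>" if \<omega>: "\<omega> \<in> space N" for \<omega>
  proof -
    have *: "(SOME \<omega>'. \<omega>' \<in> space N \<and> D \<omega>' = D \<omega>) \<in> space N \<and> D (SOME \<omega>'. \<omega>' \<in> space N \<and> D \<omega>' = D \<omega>) = D \<omega>"
      by (rule someI[of _ \<omega>]) (use \<omega> in simp)
    show ?thesis unfolding h'_def by (rule h) (use * \<omega> in auto)
  qed
  ultimately show ?thesis by (subst measurable_cong[where g="\<lambda>\<omega>. h' (D \<omega>)"]) auto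
qed

text \<open>A sum over distinct atoms becomes a sum over a fixed index set; division by the size of
  the fibre undoes multiple counting.\<close>

lemma sum_over_image:
  fixes h :: "'b \<Rightarrow> real"
  assumes "finite A"
  shows "(\<Sum>p\<in>f ` A. h p) = (\<Sum>a\<in>A. h (f a) / real (card {a' \<in> A. f a' = f a}))"
proof -
  have "(\<Sum>a\<in>A. h (f a) / real (card {a' \<in> A. f a' = f a})) =
      (\<Sum>p\<in>f ` A. \<Sum>a | a \<in> A \<and> f a = p. h (f a) / real (card {a' \<in> A. f a' = f a}))"
    by (rule sum.image_gen[OF assms])
  also have "\<dots> = (\<Sum>p\<in>f ` A. h p)"
  proof (rule sum.cong[OF refl])
    fix p assume "p \<in> f ` A"
    then have "card {a \<in> A. f a = p} \<noteq> 0" using assms by auto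
    moreover have "(\<Sum>a | a \<in> A \<and> f a = p. h (f a) / real (card {a' \<in> A. f a' = f a})) =
        (\<Sum>a | a \<in> A \<and> f a = p. h p / real (card {a' \<in> A. f a' = p}))"
      by (intro sum.cong) auto
    ultimately show "(\<Sum>a | a \<in> A \<and> f a = p. h (f a) / real (card {a' \<in> A. f a' = f a})) = h p" by simp
  qed
  finally show ?thesis by simp
qed

definition pair_time :: "real \<Rightarrow> ('i \<Rightarrow> 'a::euclidean_space) \<Rightarrow> 'i set \<times> 'i set \<Rightarrow> real \<times> ereal" where
  "pair_time r x = (\<lambda>(a, b). (cech_time (x ` a) / r, if b = {} then \<infinity> else ereal (cech_time (x ` b) / r)))"

text \<open>The atoms move with the points, so the sum runs over the fixed index set
  \<open>A\<close>. In each summand the first factor depends only on the order of the Cech times,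
  the second is the extended test function at a measurable point; the indicator is put into
  both.\<close>

lemma integral_cech_diagram:
  assumes I: "finite I" and r: "r > 0" and g: "g \<in> CK_plus DeltaL"
  defines "A \<equiv> (Pow I - {{}}) \<times> Pow I"
  shows "(\<integral>p. g p \<partial>cech_diagram F k r (x ` I)) =
    (\<Sum>a\<in>A. (indicator (topspace DeltaL) (pair_time r x a) *
        real (persistence_mult F k (\<lambda>t. cech (x ` I) (r * t)) (pair_time r x a)) /
        real (card {a' \<in> A. pair_time r x a' = pair_time r x a})) *
      (indicator (topspace DeltaL) (pair_time r x a) * g (pair_time r x a)))"
proof -
  let ?m = "persistence_mult F k (\<lambda>t. cech (x ` I) (r * t))"
  let ?D = "topspace DeltaL"
  let ?h = "\<lambda>p. indicator ?D p * (real (?m p) * g p)"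
  have fin: "finite (x ` I)" and A: "finite A" using I by (simp_all add: A_def)
  have meas: "g \<in> borel_measurable (borel_of DeltaL)"
    using g by (auto simp: CK_plus_def intro: continuous_map_measurable)
  have sub: "{p \<in> ?D. ?m p \<noteq> 0} \<subseteq> pair_time r x ` A"
  proof
    fix p assume "p \<in> {p \<in> ?D. ?m p \<noteq> 0}"
    from subsetD[OF cech_diagram_support[OF fin r] this]
    obtain \<sigma> \<tau> where *: "\<sigma> \<subseteq> x ` I" "\<sigma> \<noteq> {}" "\<tau> \<subseteq> x ` I"
        "p = (cech_time \<sigma> / r, if \<tau> = {} then \<infinity> else ereal (cech_time \<tau> / r))" by auto
    obtain a b where "a \<subseteq> I" "\<sigma> = x ` a" "b \<subseteq> I" "\<tau> = x ` b"
      using *(1,3) by (auto simp: subset_image_iff)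
    then show "p \<in> pair_time r x ` A"
      using * by (intro image_eqI[where x="(a, b)"]) (auto simp: pair_time_def A_def)
  qed
  have supp: "{p \<in> ?D. real (?m p) * g p \<noteq> 0} \<subseteq> pair_time r x ` A" using sub by auto
  have "(\<integral>p. g p \<partial>cech_diagram F k r (x ` I)) = (\<integral>p. real (?m p) * g p \<partial>count_space ?D)"
    unfolding cech_diagram_def by (rule integral_dirac_sum[OF meas])
  also have "\<dots> = (\<Sum>p | p \<in> ?D \<and> real (?m p) * g p \<noteq> 0. real (?m p) * g p)"
    using finite_subset[OF supp] A by (intro lebesgue_integral_count_space_finite_support) simp
  also have "\<dots> = (\<Sum>p\<in>{p \<in> ?D. real (?m p) * g p \<noteq> 0}. ?h p)"
    by (intro sum.cong) (auto simp: indicator_def)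
  also have "\<dots> = (\<Sum>p\<in>pair_time r x ` A. ?h p)"
  proof (rule sum.mono_neutral_left)
    show "finite (pair_time r x ` A)" using A by simp
    show "\<forall>p\<in>pair_time r x ` A - {p \<in> ?D. real (?m p) * g p \<noteq> 0}. ?h p = 0"
      unfolding indicator_def by auto
  qed (rule supp)
  also have "\<dots> = (\<Sum>a\<in>A. ?h (pair_time r x a) / real (card {a' \<in> A. pair_time r x a' = pair_time r x a}))"
    by (rule sum_over_image[OF A])
  also have "\<dots> = (\<Sum>a\<in>A. (indicator (topspace DeltaL) (pair_time r x a) *
        real (?m (pair_time r x a)) / real (card {a' \<in> A. pair_time r x a' = pair_time r x a})) *
      (indicator (topspace DeltaL) (pair_time r x a) * g (pair_time r x a)))"
    by (intro sum.cong refl) (simp add: indicator_def)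
  finally show ?thesis .
qed

text \<open>The weights \<open>coef\<close> are constant on each of finitely many order types, the
  positions \<open>P\<close> are measurable, and \<open>integral_cech_diagram\<close> expresses
  every test integral through them.\<close>

lemma measurable_cech_diagram:
  fixes F :: "'f::field itself" and X :: "nat \<Rightarrow> 'w \<Rightarrow> 'a::euclidean_space"
  assumes \<rho>: "vague_metric DeltaL \<rho>" and I: "finite I" and r: "r > 0"
    and X: "\<And>i. i \<in> I \<Longrightarrow> X i \<in> borel_measurable N"
  shows "(\<lambda>\<omega>. cech_diagram F k r ((\<lambda>i. X i \<omega>) ` I)) \<in> measurable N (borel_of (vague_topology DeltaL))"
proof (rule measurable_vagueI[OF \<rho>])
  show "cech_diagram F k r ((\<lambda>i. X i \<omega>) ` I) \<in> radon_point_measures DeltaL" for \<omega>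
    using I r by (intro cech_diagram_radon) auto
  fix g assume g: "g \<in> CK_plus DeltaL"
  define A where "A = (Pow I - {{}}) \<times> Pow I"
  define P where "P \<omega> = pair_time r (\<lambda>i. X i \<omega>)" for \<omega>
  define coef where "coef a \<omega> = indicator (topspace DeltaL) (P \<omega> a) *
        real (persistence_mult F k (\<lambda>t. cech ((\<lambda>i. X i \<omega>) ` I) (r * t)) (P \<omega> a)) /
        real (card {a' \<in> A. P \<omega> a' = P \<omega> a})" for a \<omega>
  define \<tau> where "\<tau> a \<omega> = cech_time ((\<lambda>i. X i \<omega>) ` a)" for a \<omega>
  define Q where "Q = (Pow I - {{}}) \<times> (Pow I - {{}})"
  \<comment> \<open>\<open>D\<close> records the order of the Cech times of all nonempty index sets;
    its values are subsets of the finite set \<open>Q\<close>.\<close>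
  define D where "D \<omega> = {ab \<in> Q. \<tau> (fst ab) \<omega> \<le> \<tau> (snd ab) \<omega>}" for \<omega>
  have Q: "finite Q" using I by (simp add: Q_def)
  have \<tau>: "\<tau> a \<in> borel_measurable N" if "a \<subseteq> I" for a
    unfolding \<tau>_def using finite_subset[OF that I] X that by (intro borel_measurable_cech_time) auto
  have D: "D \<in> measurable N (count_space (Pow Q))"
  proof (subst measurable_count_space_eq2)
    show "finite (Pow Q)" using Q by simp
    have "D -` {d} \<inter> space N \<in> sets N" if d: "d \<in> Pow Q" for d
    proof -
      have "D -` {d} \<inter> space N = {\<omega> \<in> space N. \<forall>ab\<in>Q. (\<tau> (fst ab) \<omega> \<le> \<tau> (snd ab) \<omega>) = (ab \<in> d)}"
        using d unfolding D_def by auto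
      moreover have "{\<omega> \<in> space N. (\<tau> (fst ab) \<omega> \<le> \<tau> (snd ab) \<omega>) = (ab \<in> d)} \<in> sets N" if ab: "ab \<in> Q" for ab
      proof -
        have le: "{\<omega> \<in> space N. \<tau> (fst ab) \<omega> \<le> \<tau> (snd ab) \<omega>} \<in> sets N"
          using ab by (intro borel_measurable_le \<tau>) (auto simp: Q_def)
        show ?thesis
        proof (cases "ab \<in> d")
          case False
          have "{\<omega> \<in> space N. (\<tau> (fst ab) \<omega> \<le> \<tau> (snd ab) \<omega>) = (ab \<in> d)} =
              space N - {\<omega> \<in> space N. \<tau> (fst ab) \<omega> \<le> \<tau> (snd ab) \<omega>}" using False by auto
          then show ?thesis using le by simp
        qed (use le in simp)
      qed
      ultimately show ?thesis using Q by (simp only: sets.sets_Collect_finite_All)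
    qed
    then show "D \<in> space N \<rightarrow> Pow Q \<and> (\<forall>a\<in>Pow Q. D -` {a} \<inter> space N \<in> sets N)"
      by (auto simp: D_def)
  qed
  have coef: "coef ab \<in> borel_measurable N" if ab: "ab \<in> A" for ab
  proof (rule borel_measurable_determined[OF D])
    fix \<omega> \<omega>' assume eq: "D \<omega> = D \<omega>'"
    have order: "\<tau> a \<omega> \<le> \<tau> b \<omega> \<longleftrightarrow> \<tau> a \<omega>' \<le> \<tau> b \<omega>'" if "a \<subseteq> I" "b \<subseteq> I" "a \<noteq> {}" "b \<noteq> {}" for a b
    proof -
      have "(a, b) \<in> Q" using that by (simp add: Q_def)
      moreover have "(a, b) \<in> D \<omega> \<longleftrightarrow> (a, b) \<in> D \<omega>'" using eq by simp
      ultimately show ?thesis by (simp add: D_def)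
    qed
    have eq\<tau>: "\<tau> a \<omega> = \<tau> b \<omega> \<longleftrightarrow> \<tau> a \<omega>' = \<tau> b \<omega>'" if "a \<subseteq> I" "b \<subseteq> I" "a \<noteq> {}" "b \<noteq> {}" for a b
      using order[OF that] order[OF that(2,1,4,3)] by linarith
    have less\<tau>: "\<tau> a \<omega> < \<tau> b \<omega> \<longleftrightarrow> \<tau> a \<omega>' < \<tau> b \<omega>'" if "a \<subseteq> I" "b \<subseteq> I" "a \<noteq> {}" "b \<noteq> {}" for a b
      using order[OF that(2,1,4,3)] by linarith
    have P: "P \<omega> (a, b) = (\<tau> a \<omega> / r, if b = {} then \<infinity> else ereal (\<tau> b \<omega> / r))" for \<omega> a b
      by (simp add: P_def pair_time_def \<tau>_def)
    obtain a b where a: "ab = (a, b)" "a \<subseteq> I" "a \<noteq> {}" "b \<subseteq> I" using ab by (auto simp: A_def)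
    have Peq: "P \<omega> a' = P \<omega> ab \<longleftrightarrow> P \<omega>' a' = P \<omega>' ab" if a': "a' \<in> A" for a'
    proof -
      obtain u v where uv: "a' = (u, v)" "u \<subseteq> I" "u \<noteq> {}" "v \<subseteq> I" using a' by (auto simp: A_def)
      show ?thesis
        unfolding uv(1) a(1) P using r eq\<tau>[OF uv(2) a(2) uv(3) a(3)] eq\<tau>[OF uv(4) a(4)]
        by (cases "v = {}"; cases "b = {}") simp_all
    qed
    have card: "{a' \<in> A. P \<omega> a' = P \<omega> ab} = {a' \<in> A. P \<omega>' a' = P \<omega>' ab}" using Peq by blast
    have nonneg: "0 \<le> \<tau> a \<omega>" for \<omega>
      unfolding \<tau>_def using finite_subset[OF a(2) I] by (intro cech_time_nonneg) simp
    have top: "P \<omega> ab \<in> topspace DeltaL \<longleftrightarrow> (b = {} \<or> \<tau> a \<omega> < \<tau> b \<omega>)" for \<omega>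
      unfolding a(1) P using r nonneg[of \<omega>] by (simp add: divide_less_cancel)
    have top': "P \<omega> ab \<in> topspace DeltaL \<longleftrightarrow> P \<omega>' ab \<in> topspace DeltaL"
      unfolding top using less\<tau>[OF a(2,4,3)] by auto
    show "coef ab \<omega> = coef ab \<omega>'"
    proof (cases "P \<omega> ab \<in> topspace DeltaL")
      case True
      have "persistence_mult F k (\<lambda>t. cech ((\<lambda>i. X i \<omega>) ` I) (r * t)) (P \<omega> ab) =
          persistence_mult F k (\<lambda>t. cech ((\<lambda>i. X i \<omega>') ` I) (r * t)) (P \<omega>' ab)"
        unfolding a(1) P \<tau>_def
      proof (rule persistence_mult_order_type[OF r I _ a(2,3,4),
            where d="\<lambda>y. if b = {} then \<infinity> else ereal (cech_time (y ` b) / r)"])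
        show "ereal (cech_time ((\<lambda>i. X i \<omega>) ` a) / r) < (if b = {} then \<infinity> else ereal (cech_time ((\<lambda>i. X i \<omega>) ` b) / r))"
          using True unfolding a(1) P \<tau>_def by simp
      qed (use order in \<open>simp_all add: \<tau>_def\<close>)
      then show ?thesis unfolding coef_def card using top' by (simp add: indicator_def)
    next
      case False
      then show ?thesis unfolding coef_def using top' by (simp add: indicator_def)
    qed
  qed
  have P: "(\<lambda>\<omega>. P \<omega> ab) \<in> borel_measurable N" if ab: "ab \<in> A" for ab
  proof -
    obtain a b where a: "ab = (a, b)" "a \<subseteq> I" "a \<noteq> {}" "b \<subseteq> I" using ab by (auto simp: A_def)
    have P: "(\<lambda>\<omega>. P \<omega> ab) = (\<lambda>\<omega>. (\<tau> a \<omega> / r, if b = {} then \<infinity> else ereal (\<tau> b \<omega> / r)))"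
      unfolding a(1) P_def pair_time_def \<tau>_def by simp
    show ?thesis
      unfolding P using \<tau>[OF a(2)] \<tau>[OF a(4)]
      by (intro borel_measurable_Pair) (auto intro!: borel_measurable_ereal borel_measurable_divide)
  qed
  have "(\<lambda>\<omega>. \<Sum>ab\<in>A. coef ab \<omega> * (indicator (topspace DeltaL) (P \<omega> ab) * g (P \<omega> ab))) \<in> borel_measurable N"
    by (intro borel_measurable_sum borel_measurable_times[OF coef measurable_compose[OF P CK_plus_extension_measurable[OF g]]])
  then show "(\<lambda>\<omega>. \<integral>p. g p \<partial>cech_diagram F k r ((\<lambda>i. X i \<omega>) ` I)) \<in> borel_measurable N"
    unfolding integral_cech_diagram[OF I r g] A_def coef_def P_def .
qed

lemma borel_measurable_tuple_birth:
  assumes "\<And>i. i < k + 2 \<Longrightarrow> X i \<in> borel_measurable N"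
  shows "(\<lambda>\<omega>. tuple_birth k (\<lambda>i. X i \<omega>)) \<in> borel_measurable N"
  unfolding tuple_birth_def using assms
  by (intro borel_measurable_Max borel_measurable_cech_time) auto

lemma borel_measurable_tuple_death:
  assumes "\<And>i. i < k + 2 \<Longrightarrow> X i \<in> borel_measurable N"
  shows "(\<lambda>\<omega>. tuple_death k (\<lambda>i. X i \<omega>)) \<in> borel_measurable N"
  unfolding tuple_death_def using assms by (intro borel_measurable_cech_time) auto

lemma measurable_tuple_diagram:
  assumes \<rho>: "vague_metric DeltaL \<rho>" and k: "k \<ge> 1"
    and X: "\<And>i. i < k + 2 \<Longrightarrow> X i \<in> borel_measurable N"
  shows "(\<lambda>\<omega>. tuple_diagram F k (\<lambda>i. X i \<omega>)) \<in> measurable N (borel_of (vague_topology DeltaL))"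
proof (rule measurable_vagueI[OF \<rho>])
  fix g assume g: "g \<in> CK_plus DeltaL"
  then have meas: "g \<in> borel_measurable (borel_of DeltaL)"
    by (auto simp: CK_plus_def intro: continuous_map_measurable)
  let ?p = "\<lambda>x. (tuple_birth k x, ereal (tuple_death k x))"
  \<comment> \<open>For a tuple that is never born the pair lies outside the half plane, and the
    indicator reproduces the integral 0 of the null measure.\<close>
  have "(\<integral>p. g p \<partial>tuple_diagram F k x) = indicator (topspace DeltaL) (?p x) * g (?p x)" for x :: "nat \<Rightarrow> 'b"
  proof (cases "tuple_birth k x < tuple_death k x")
    case True
    then have "?p x \<in> topspace DeltaL" using tuple_birth_nonneg[of k x] by simp
    then show ?thesis using True meas by (simp add: tuple_diagram_eq[OF k] integral_return)
  next
    case False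
    then show ?thesis by (simp add: tuple_diagram_eq[OF k] null_point_measure_def)
  qed
  moreover have "(\<lambda>\<omega>. ?p (\<lambda>i. X i \<omega>)) \<in> borel_measurable N"
    using borel_measurable_tuple_birth[OF X] borel_measurable_tuple_death[OF X]
    by (intro borel_measurable_Pair) auto
  ultimately show "(\<lambda>\<omega>. \<integral>p. g p \<partial>tuple_diagram F k (\<lambda>i. X i \<omega>)) \<in> borel_measurable N"
    using measurable_compose[OF _ CK_plus_extension_measurable[OF g]] by simp
qed (use tuple_diagram_radon[OF k] in blast)

section \<open>Independent points with a bounded density\<close>

lemma nn_integral_lborel_affine:
  fixes g :: "'a::euclidean_space \<Rightarrow> ennreal"
  assumes [measurable]: "g \<in> borel_measurable borel" and r: "r > 0"
  shows "(\<integral>\<^sup>+z. g z \<partial>lborel) = ennreal (r ^ DIM('a)) * (\<integral>\<^sup>+y. g (x + r *\<^sub>R y) \<partial>lborel)"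
  using r by (subst lborel_affine[of r x]) (simp_all add: nn_integral_density nn_integral_distr nn_integral_cmult)

lemma prod_ennreal_le_power:
  assumes "finite D" "\<And>j. g j \<le> (c :: ennreal)"
  shows "(\<Prod>j\<in>D. g j) \<le> c ^ card D"
  using assms(1) by induction (auto intro!: mult_mono assms(2))

lemma prod_lessThan_split:
  fixes g :: "nat \<Rightarrow> 'b::comm_monoid_mult"
  assumes "m < n"
  shows "(\<Prod>i<n. g i) = g 0 * (\<Prod>j<m. g (Suc j)) * (\<Prod>i\<in>{Suc m..<n}. g i)"
proof -
  have "prod g ({..<Suc m} \<union> {Suc m..<n}) = (\<Prod>i<Suc m. g i) * (\<Prod>i\<in>{Suc m..<n}. g i)"
    by (rule prod.union_disjoint) auto
  moreover have "{..<Suc m} \<union> {Suc m..<n} = {..<n}" using assms by auto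
  ultimately show ?thesis by (simp only: prod.lessThan_Suc_shift)
qed

locale iid_points = prob_space M for M :: "'w measure" +
  fixes X :: "nat \<Rightarrow> 'w \<Rightarrow> 'a::euclidean_space" and f :: "'a \<Rightarrow> real" and B :: real
  assumes indep: "indep_vars (\<lambda>_. borel) X UNIV"
    and dens: "\<And>i. distributed M lborel (X i) (\<lambda>x. ennreal (f x))"
    and nonneg: "\<And>x. 0 \<le> f x"
    and bound: "\<And>x. f x \<le> B"
begin

definition "\<mu> = density lborel (\<lambda>x. ennreal (f x))"

lemma X_measurable [measurable]: "X i \<in> borel_measurable M"
  using distributed_measurable[OF dens[of i]] by simp

text \<open>\<open>distributed\<close> only gives measurability of \<open>ennreal\<close> composed
  with \<open>f\<close>; nonnegativity recovers \<open>f\<close> itself.\<close>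

lemma f_measurable [measurable]: "f \<in> borel_measurable borel"
proof -
  have "(\<lambda>x. enn2real (ennreal (f x))) \<in> borel_measurable borel"
    using distributed_borel_measurable[OF dens[of 0]] by simp
  then show ?thesis using nonneg by simp
qed

lemma sets_\<mu> [simp, measurable_cong]: "sets \<mu> = sets borel"
  by (simp add: \<mu>_def)

lemma space_\<mu> [simp]: "space \<mu> = UNIV"
  by (simp add: \<mu>_def)

lemma distr_X: "distr M borel (X i) = \<mu>"
  using distributed_distr_eq_density[OF dens[of i]] unfolding \<mu>_def
  by (metis (no_types, lifting) distr_cong sets_lborel)

lemma prob_space_\<mu>: "prob_space \<mu>"
  using prob_space_distr[OF X_measurable[of 0]] by (simp add: distr_X)

sublocale \<mu>: prob_space \<mu>
  by (rule prob_space_\<mu>)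

sublocale \<mu>P: product_prob_space "\<lambda>_ :: nat. \<mu>"
  by unfold_locales

lemma emeasure_X: "A \<in> sets borel \<Longrightarrow> emeasure M (X i -` A \<inter> space M) = emeasure \<mu> A"
  unfolding distr_X[of i, symmetric] by (simp add: emeasure_distr)

lemma integral_f: "(\<integral>\<^sup>+x. ennreal (f x) \<partial>lborel) = 1"
  using \<mu>.emeasure_space_1 by (simp add: \<mu>_def emeasure_density)

lemma B_nonneg: "0 \<le> B"
  using nonneg bound order_trans by blast

section \<open>Joint laws of the sample points\<close>

text \<open>\<sigma> selects distinct sample indices in any order, so the same computation yields
  the product law and exchangeability. Independence applies to the image of \<open>I\<close>, whence
  the boxes are reindexed by \<open>C\<close>.\<close>

lemma emeasure_box:
  assumes I: "finite I" and \<sigma>: "inj_on \<sigma> I" and A: "\<And>i. i \<in> I \<Longrightarrow> A i \<in> sets borel"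
  shows "emeasure M {\<omega>\<in>space M. \<forall>i\<in>I. X (\<sigma> i) \<omega> \<in> A i} = (\<Prod>i\<in>I. emeasure \<mu> (A i))"
proof (cases "I = {}")
  case True
  then show ?thesis by (simp add: emeasure_space_1)
next
  case False
  define C where "C j = A (the_inv_into I \<sigma> j)" for j
  have C: "C (\<sigma> i) = A i" if "i \<in> I" for i
    using that \<sigma> by (simp add: C_def the_inv_into_f_f)
  have "{\<omega>\<in>space M. \<forall>i\<in>I. X (\<sigma> i) \<omega> \<in> A i} = (\<Inter>j\<in>\<sigma> ` I. X j -` C j \<inter> space M)"
    using False C by auto
  moreover have "prob (\<Inter>j\<in>\<sigma> ` I. X j -` C j \<inter> space M) = (\<Prod>j\<in>\<sigma> ` I. prob (X j -` C j \<inter> space M))"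
    using False I A C by (intro indep_varsD[OF indep]) auto
  moreover have "(\<Prod>j\<in>\<sigma> ` I. prob (X j -` C j \<inter> space M)) = (\<Prod>i\<in>I. prob (X (\<sigma> i) -` A i \<inter> space M))"
    unfolding prod.reindex[OF \<sigma>] by (intro prod.cong) (simp_all add: C)
  ultimately have "emeasure M {\<omega>\<in>space M. \<forall>i\<in>I. X (\<sigma> i) \<omega> \<in> A i} = ennreal (\<Prod>i\<in>I. prob (X (\<sigma> i) -` A i \<inter> space M))"
    by (simp add: emeasure_eq_measure)
  also have "\<dots> = (\<Prod>i\<in>I. emeasure M (X (\<sigma> i) -` A i \<inter> space M))"
    by (simp add: prod_ennreal emeasure_eq_measure)
  also have "\<dots> = (\<Prod>i\<in>I. emeasure \<mu> (A i))"
    by (intro prod.cong refl emeasure_X A)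
  finally show ?thesis .
qed

lemma law:
  assumes I: "finite I" and \<sigma>: "inj_on \<sigma> I"
  shows "distr M (PiM I (\<lambda>_. borel)) (\<lambda>\<omega>. \<lambda>i\<in>I. X (\<sigma> i) \<omega>) = PiM I (\<lambda>_. \<mu>)"
proof (rule \<mu>P.PiM_eqI[OF I])
  show "sets (distr M (PiM I (\<lambda>_. borel)) (\<lambda>\<omega>. \<lambda>i\<in>I. X (\<sigma> i) \<omega>)) = sets (PiM I (\<lambda>_. \<mu>))"
    by (simp cong: sets_PiM_cong)
  fix A assume "\<And>i. i \<in> I \<Longrightarrow> A i \<in> sets \<mu>"
  then have A: "\<And>i. i \<in> I \<Longrightarrow> A i \<in> sets borel" by simp
  have [measurable]: "(\<lambda>\<omega>. \<lambda>i\<in>I. X (\<sigma> i) \<omega>) \<in> measurable M (PiM I (\<lambda>_. borel))"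
    by (intro measurable_restrict X_measurable)
  have "emeasure (distr M (PiM I (\<lambda>_. borel)) (\<lambda>\<omega>. \<lambda>i\<in>I. X (\<sigma> i) \<omega>)) (Pi\<^sub>E I A) =
      emeasure M ((\<lambda>\<omega>. \<lambda>i\<in>I. X (\<sigma> i) \<omega>) -` (Pi\<^sub>E I A) \<inter> space M)"
    using I A by (intro emeasure_distr sets_PiM_I_finite) auto
  also have "(\<lambda>\<omega>. \<lambda>i\<in>I. X (\<sigma> i) \<omega>) -` (Pi\<^sub>E I A) \<inter> space M = {\<omega>\<in>space M. \<forall>i\<in>I. X (\<sigma> i) \<omega> \<in> A i}"
    by (auto simp: PiE_iff)
  also have "emeasure M {\<omega>\<in>space M. \<forall>i\<in>I. X (\<sigma> i) \<omega> \<in> A i} = (\<Prod>i\<in>I. emeasure \<mu> (A i))"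
    by (rule emeasure_box[OF I \<sigma>]) (rule A)
  finally show "emeasure (distr M (PiM I (\<lambda>_. borel)) (\<lambda>\<omega>. \<lambda>i\<in>I. X (\<sigma> i) \<omega>)) (Pi\<^sub>E I A) =
      (\<Prod>i\<in>I. emeasure \<mu> (A i))" .
qed

text \<open>The first \<open>m + 1\<close> points are written as \<open>x\<close> and \<open>x + r y\<^sub>j\<close>; the others stay random.\<close>

definition rescaled :: "real \<Rightarrow> nat \<Rightarrow> 'a \<times> (nat \<Rightarrow> 'a) \<times> 'w \<Rightarrow> nat \<Rightarrow> 'a" where
  "rescaled r m q i = (if i = 0 then fst q else if i \<le> m then fst q + r *\<^sub>R fst (snd q) (i - 1) else X i (snd (snd q)))"

definition rescaled_space :: "nat \<Rightarrow> ('a \<times> (nat \<Rightarrow> 'a) \<times> 'w) measure" where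
  "rescaled_space m = lborel \<Otimes>\<^sub>M (PiM {..<m} (\<lambda>_. lborel) \<Otimes>\<^sub>M M)"

definition rescaled_density :: "real \<Rightarrow> nat \<Rightarrow> 'a \<times> (nat \<Rightarrow> 'a) \<times> 'w \<Rightarrow> real" where
  "rescaled_density r m q = f (fst q) * (\<Prod>j<m. f (fst q + r *\<^sub>R fst (snd q) j))"

section \<open>Change of variables around the first point\<close>

lemma sets_rescaled_space [measurable_cong]:
  "sets (rescaled_space m) = sets (borel \<Otimes>\<^sub>M (PiM {..<m} (\<lambda>_. borel) \<Otimes>\<^sub>M M))"
  unfolding rescaled_space_def by (intro sets_pair_measure_cong sets_PiM_cong) auto

lemma rescaled_coordinate_measurable [measurable]:
  assumes "j < m"
  shows "(\<lambda>q. fst (snd q) j) \<in> borel_measurable (rescaled_space m)"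
proof -
  have "(\<lambda>q. fst (snd q)) \<in> measurable (rescaled_space m) (PiM {..<m} (\<lambda>_. borel))"
    by measurable
  then show ?thesis
    by (rule measurable_compose[OF _ measurable_component_singleton]) (use assms in simp)
qed

lemma rescaled_measurable [measurable]: "(\<lambda>q. rescaled r m q i) \<in> borel_measurable (rescaled_space m)"
proof (cases "i = 0 \<or> m < i")
  case True
  then show ?thesis by (auto simp: rescaled_def)
next
  case False
  then have "i - 1 < m" by auto
  then have "(\<lambda>q. fst q + r *\<^sub>R fst (snd q) (i - 1)) \<in> borel_measurable (rescaled_space m)"
    by (intro borel_measurable_add borel_measurable_scaleR borel_measurable_const rescaled_coordinate_measurable) measurable
  moreover have "(\<lambda>q. rescaled r m q i) = (\<lambda>q. fst q + r *\<^sub>R fst (snd q) (i - 1))"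
    using False unfolding rescaled_def by auto
  ultimately show ?thesis by (simp only:)
qed

lemma rescaled_density_measurable [measurable]: "rescaled_density r m \<in> borel_measurable (rescaled_space m)"
  unfolding rescaled_density_def
  by (intro borel_measurable_times borel_measurable_prod measurable_compose[OF _ f_measurable]
      borel_measurable_add borel_measurable_scaleR borel_measurable_const rescaled_coordinate_measurable) auto

lemma rescaled_density_nonneg: "0 \<le> rescaled_density r m q"
  unfolding rescaled_density_def by (intro mult_nonneg_nonneg prod_nonneg nonneg)

lemma sigma_finite_rescaled_factor:
  fixes m :: nat
  shows "sigma_finite_measure (PiM {..<m} (\<lambda>_. lborel :: 'a measure) \<Otimes>\<^sub>M M)"
proof -
  interpret L: product_sigma_finite "\<lambda>_ :: nat. lborel :: 'a measure"
    by (intro product_sigma_finite.intro sigma_finite_lborel)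
  show ?thesis
    by (rule sigma_finite_pair_measure[OF product_sigma_finite.sigma_finite[OF L.product_sigma_finite_axioms finite_lessThan]
      sigma_finite_measure_axioms])
qed

lemma nn_integral_rescaled_space:
  assumes "h \<in> borel_measurable (rescaled_space m)"
  shows "(\<integral>\<^sup>+q. h q \<partial>rescaled_space m) = (\<integral>\<^sup>+x. \<integral>\<^sup>+y. \<integral>\<^sup>+\<omega>. h (x, y, \<omega>) \<partial>M \<partial>PiM {..<m} (\<lambda>_. lborel) \<partial>lborel)"
proof -
  have h: "h \<in> borel_measurable (lborel \<Otimes>\<^sub>M (PiM {..<m} (\<lambda>_. lborel) \<Otimes>\<^sub>M M))"
    using assms by (simp add: rescaled_space_def)
  have "(\<integral>\<^sup>+q. h q \<partial>rescaled_space m) = (\<integral>\<^sup>+x. \<integral>\<^sup>+z. h (x, z) \<partial>(PiM {..<m} (\<lambda>_. lborel) \<Otimes>\<^sub>M M) \<partial>lborel)"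
    unfolding rescaled_space_def
    by (rule sigma_finite_measure.nn_integral_fst[OF sigma_finite_rescaled_factor h, symmetric])
  also have "\<dots> = (\<integral>\<^sup>+x. \<integral>\<^sup>+y. \<integral>\<^sup>+\<omega>. h (x, y, \<omega>) \<partial>M \<partial>PiM {..<m} (\<lambda>_. lborel) \<partial>lborel)"
  proof (rule nn_integral_cong)
    fix x :: 'a
    have "(\<lambda>z. h (x, z)) \<in> borel_measurable (PiM {..<m} (\<lambda>_. lborel) \<Otimes>\<^sub>M M)"
      by (rule measurable_compose[OF measurable_Pair1' h]) simp
    then show "(\<integral>\<^sup>+z. h (x, z) \<partial>(PiM {..<m} (\<lambda>_. lborel) \<Otimes>\<^sub>M M)) = (\<integral>\<^sup>+y. \<integral>\<^sup>+\<omega>. h (x, y, \<omega>) \<partial>M \<partial>PiM {..<m} (\<lambda>_. lborel))"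
      by (rule nn_integral_fst[symmetric])
  qed
  finally show ?thesis .
qed

text \<open>It suffices to compare boxes, whose variables separate: independence handles the points
  that stay random, the substitution \<open>z = x + r y\<close> turns each integral over some
  \<open>y j\<close> into a marginal and absorbs one factor \<open>r ^ DIM('a)\<close>, and the
  integral over \<open>x\<close> comes last.\<close>

lemma rescaled_law:
  assumes r: "r > 0" and mn: "m < n"
  shows "distr (density (rescaled_space m) (\<lambda>q. ennreal (r ^ (DIM('a) * m) * rescaled_density r m q)))
      (PiM {..<n} (\<lambda>_. borel)) (\<lambda>q. \<lambda>i\<in>{..<n}. rescaled r m q i) = PiM {..<n} (\<lambda>_. \<mu>)"
proof (rule \<mu>P.PiM_eqI)
  let ?W = "\<lambda>q. ennreal (r ^ (DIM('a) * m) * rescaled_density r m q)"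
  let ?P = "distr (density (rescaled_space m) ?W) (PiM {..<n} (\<lambda>_. borel)) (\<lambda>q. \<lambda>i\<in>{..<n}. rescaled r m q i)"
  show "sets ?P = sets (PiM {..<n} (\<lambda>_. \<mu>))" by (simp cong: sets_PiM_cong)
  interpret L: product_sigma_finite "\<lambda>_ :: nat. lborel :: 'a measure"
    by (intro product_sigma_finite.intro sigma_finite_lborel)
  fix A assume "\<And>i. i \<in> {..<n} \<Longrightarrow> A i \<in> sets \<mu>"
  then have A: "\<And>i. i < n \<Longrightarrow> A i \<in> sets borel" by simp
  have map: "(\<lambda>q. \<lambda>i\<in>{..<n}. rescaled r m q i) \<in> measurable (rescaled_space m) (PiM {..<n} (\<lambda>_. borel))"
    by (intro measurable_restrict rescaled_measurable)
  let ?S = "(\<lambda>q. \<lambda>i\<in>{..<n}. rescaled r m q i) -` (Pi\<^sub>E {..<n} A) \<inter> space (rescaled_space m)"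
  have box: "Pi\<^sub>E {..<n} A \<in> sets (PiM {..<n} (\<lambda>_. borel))" using A by (intro sets_PiM_I_finite) auto
  then have S: "?S \<in> sets (rescaled_space m)" using map by (rule measurable_sets[rotated])
  have "emeasure ?P (Pi\<^sub>E {..<n} A) = emeasure (density (rescaled_space m) ?W) ?S"
    using map box by (subst emeasure_distr) (auto simp: measurable_density_eq2)
  also have "\<dots> = (\<integral>\<^sup>+q. ?W q * indicator ?S q \<partial>rescaled_space m)"
    by (rule emeasure_density[OF _ S]) measurable
  also have "\<dots> = (\<integral>\<^sup>+q. ?W q * (\<Prod>i<n. indicator (A i) (rescaled r m q i)) \<partial>rescaled_space m)"
  proof (rule nn_integral_cong)
    fix q assume q: "q \<in> space (rescaled_space m)"
    have "indicator ?S q = (\<Prod>i<n. indicator (A i) (rescaled r m q i) :: ennreal)"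
    proof (cases "q \<in> ?S")
      case True
      then show ?thesis by (auto simp: PiE_iff)
    next
      case False
      then obtain i where "i < n" "rescaled r m q i \<notin> A i" using q by (auto simp: PiE_iff)
      then have "(\<Prod>i<n. indicator (A i) (rescaled r m q i) :: ennreal) = 0"
        by (intro prod_zero bexI[of _ i]) auto
      then show ?thesis using False by simp
    qed
    then show "?W q * indicator ?S q = ?W q * (\<Prod>i<n. indicator (A i) (rescaled r m q i))" by simp
  qed
  also have "\<dots> = (\<integral>\<^sup>+x. \<integral>\<^sup>+y. \<integral>\<^sup>+\<omega>. ?W (x, y, \<omega>) * (\<Prod>i<n. indicator (A i) (rescaled r m (x, y, \<omega>) i))
      \<partial>M \<partial>PiM {..<m} (\<lambda>_. lborel) \<partial>lborel)"
  proof (rule nn_integral_rescaled_space)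
    have ind: "(\<lambda>q. indicator (A i) (rescaled r m q i) :: ennreal) \<in> borel_measurable (rescaled_space m)" if "i \<in> {..<n}" for i
      by (rule measurable_compose[OF rescaled_measurable borel_measurable_indicator]) (use A that in simp)
    show "(\<lambda>q. ?W q * (\<Prod>i<n. indicator (A i) (rescaled r m q i))) \<in> borel_measurable (rescaled_space m)"
      by (intro borel_measurable_times_ennreal borel_measurable_prod_ennreal ind) measurable
  qed
  \<comment> \<open>Given \<open>x\<close> and \<open>y\<close>, only the points with index above
    \<open>m\<close> depend on the sample, so their box probability factors out. The entry
    \<open>y j\<close> belongs to the point with index \<open>Suc j\<close>.\<close>
  also have "\<dots> = (\<integral>\<^sup>+x. \<integral>\<^sup>+y. (ennreal (f x) * indicator (A 0) x) *
      (\<Prod>j<m. ennreal (r ^ DIM('a) * f (x + r *\<^sub>R y j)) * indicator (A (Suc j)) (x + r *\<^sub>R y j)) *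
      (\<Prod>i\<in>{Suc m..<n}. emeasure \<mu> (A i)) \<partial>PiM {..<m} (\<lambda>_. lborel) \<partial>lborel)"
  proof (intro nn_integral_cong)
    fix x :: 'a and y :: "nat \<Rightarrow> 'a"
    let ?c = "(ennreal (f x) * indicator (A 0) x) *
      (\<Prod>j<m. ennreal (r ^ DIM('a) * f (x + r *\<^sub>R y j)) * indicator (A (Suc j)) (x + r *\<^sub>R y j))"
    have W: "?W (x, y, \<omega>) = ennreal (f x) * (\<Prod>j<m. ennreal (r ^ DIM('a) * f (x + r *\<^sub>R y j)))" for \<omega>
    proof -
      have "r ^ (DIM('a) * m) * rescaled_density r m (x, y, \<omega>) = f x * (\<Prod>j<m. r ^ DIM('a) * f (x + r *\<^sub>R y j))"
        unfolding rescaled_density_def prod.distrib power_mult by simp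
      also have "ennreal \<dots> = ennreal (f x) * ennreal (\<Prod>j<m. r ^ DIM('a) * f (x + r *\<^sub>R y j))"
        using nonneg r by (intro ennreal_mult prod_nonneg) auto
      also have "ennreal (\<Prod>j<m. r ^ DIM('a) * f (x + r *\<^sub>R y j)) = (\<Prod>j<m. ennreal (r ^ DIM('a) * f (x + r *\<^sub>R y j)))"
        using nonneg r by (intro prod_ennreal[symmetric]) auto
      finally show ?thesis .
    qed
    have "?W (x, y, \<omega>) * (\<Prod>i<n. indicator (A i) (rescaled r m (x, y, \<omega>) i)) =
        ?c * (\<Prod>i\<in>{Suc m..<n}. indicator (A i) (X i \<omega>))" for \<omega>
    proof -
      have "(\<Prod>i<n. indicator (A i) (rescaled r m (x, y, \<omega>) i) :: ennreal) =
          indicator (A 0) x * (\<Prod>j<m. indicator (A (Suc j)) (x + r *\<^sub>R y j)) * (\<Prod>i\<in>{Suc m..<n}. indicator (A i) (X i \<omega>))"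
        unfolding prod_lessThan_split[OF mn] by (intro arg_cong2[where f="(*)"] prod.cong) (auto simp: rescaled_def)
      then show ?thesis unfolding W by (simp add: prod.distrib mult_ac)
    qed
    then have "(\<integral>\<^sup>+\<omega>. ?W (x, y, \<omega>) * (\<Prod>i<n. indicator (A i) (rescaled r m (x, y, \<omega>) i)) \<partial>M) =
        (\<integral>\<^sup>+\<omega>. ?c * (\<Prod>i\<in>{Suc m..<n}. indicator (A i) (X i \<omega>)) \<partial>M)" by (intro nn_integral_cong) simp
    also have "\<dots> = ?c * (\<integral>\<^sup>+\<omega>. (\<Prod>i\<in>{Suc m..<n}. indicator (A i) (X i \<omega>)) \<partial>M)"
    proof (rule nn_integral_cmult)
      have "(\<lambda>\<omega>. indicator (A i) (X i \<omega>) :: ennreal) \<in> borel_measurable M" if "i < n" for i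
        by (rule measurable_compose[OF X_measurable]) (use A[OF that] in simp)
      then show "(\<lambda>\<omega>. \<Prod>i\<in>{Suc m..<n}. indicator (A i) (X i \<omega>) :: ennreal) \<in> borel_measurable M"
        by (intro borel_measurable_prod_ennreal) auto
    qed
    also have "(\<integral>\<^sup>+\<omega>. (\<Prod>i\<in>{Suc m..<n}. indicator (A i) (X i \<omega>)) \<partial>M) =
        (\<integral>\<^sup>+\<omega>. indicator {\<omega>\<in>space M. \<forall>i\<in>{Suc m..<n}. X i \<omega> \<in> A i} \<omega> \<partial>M)"
    proof (rule nn_integral_cong)
      fix \<omega> assume \<omega>: "\<omega> \<in> space M"
      show "(\<Prod>i\<in>{Suc m..<n}. indicator (A i) (X i \<omega>)) = (indicator {\<omega>\<in>space M. \<forall>i\<in>{Suc m..<n}. X i \<omega> \<in> A i} \<omega> :: ennreal)"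
      proof (cases "\<forall>i\<in>{Suc m..<n}. X i \<omega> \<in> A i")
        case False
        then obtain i where "i \<in> {Suc m..<n}" "X i \<omega> \<notin> A i" by blast
        then have "(\<Prod>i\<in>{Suc m..<n}. indicator (A i) (X i \<omega>) :: ennreal) = 0"
          by (intro prod_zero bexI[of _ i]) auto
        then show ?thesis using False by (auto simp: indicator_def)
      qed (use \<omega> in simp)
    qed
    also have "\<dots> = emeasure M {\<omega>\<in>space M. \<forall>i\<in>{Suc m..<n}. X i \<omega> \<in> A i}"
    proof (rule nn_integral_indicator)
      have "{\<omega>\<in>space M. X i \<omega> \<in> A i} \<in> sets M" if "i < n" for i
        using measurable_sets[OF X_measurable A[OF that], of i] by (simp add: vimage_def Int_def conj_commute)
      then show "{\<omega>\<in>space M. \<forall>i\<in>{Suc m..<n}. X i \<omega> \<in> A i} \<in> sets M"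
        by (intro sets.sets_Collect_finite_All) auto
    qed
    also have "\<dots> = (\<Prod>i\<in>{Suc m..<n}. emeasure \<mu> (A i))"
      using emeasure_box[of "{Suc m..<n}" "\<lambda>i. i" A] A by simp
    finally show "(\<integral>\<^sup>+\<omega>. ?W (x, y, \<omega>) * (\<Prod>i<n. indicator (A i) (rescaled r m (x, y, \<omega>) i)) \<partial>M) =
        ?c * (\<Prod>i\<in>{Suc m..<n}. emeasure \<mu> (A i))" .
  qed
  \<comment> \<open>For fixed \<open>x\<close> the integral over \<open>y\<close> is a product of
    integrals over the single entries.\<close>
  also have "\<dots> = (\<integral>\<^sup>+x. (ennreal (f x) * indicator (A 0) x) *
      ((\<Prod>j<m. emeasure \<mu> (A (Suc j))) * (\<Prod>i\<in>{Suc m..<n}. emeasure \<mu> (A i))) \<partial>lborel)"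
  proof (rule nn_integral_cong)
    fix x :: 'a
    let ?a = "ennreal (f x) * indicator (A 0) x" and ?b = "\<Prod>i\<in>{Suc m..<n}. emeasure \<mu> (A i)"
    let ?h = "\<lambda>j z. ennreal (r ^ DIM('a) * f (x + r *\<^sub>R z)) * indicator (A (Suc j)) (x + r *\<^sub>R z)"
    have h: "?h j \<in> borel_measurable borel" if "j < m" for j
    proof -
      have [measurable]: "A (Suc j) \<in> sets borel" using A that mn by simp
      show ?thesis by measurable
    qed
    have "(\<integral>\<^sup>+z. ?h j z \<partial>lborel) = emeasure \<mu> (A (Suc j))" if "j < m" for j
    proof -
      have [measurable]: "A (Suc j) \<in> sets borel" using A that mn by simp
      have "emeasure \<mu> (A (Suc j)) = (\<integral>\<^sup>+z. ennreal (f z) * indicator (A (Suc j)) z \<partial>lborel)"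
        unfolding \<mu>_def by (rule emeasure_density) auto
      also have "\<dots> = ennreal (r ^ DIM('a)) * (\<integral>\<^sup>+z. ennreal (f (x + r *\<^sub>R z)) * indicator (A (Suc j)) (x + r *\<^sub>R z) \<partial>lborel)"
        using r by (intro nn_integral_lborel_affine) measurable
      also have "\<dots> = (\<integral>\<^sup>+z. ennreal (r ^ DIM('a)) * (ennreal (f (x + r *\<^sub>R z)) * indicator (A (Suc j)) (x + r *\<^sub>R z)) \<partial>lborel)"
        by (rule nn_integral_cmult[symmetric]) measurable
      also have "\<dots> = (\<integral>\<^sup>+z. ?h j z \<partial>lborel)"
        using r nonneg by (intro nn_integral_cong) (simp add: ennreal_mult mult.assoc)
      finally show ?thesis ..
    qed
    note int = this
    have meas: "(\<lambda>y. \<Prod>j<m. ?h j (y j)) \<in> borel_measurable (PiM {..<m} (\<lambda>_. lborel))"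
      by (intro borel_measurable_prod_ennreal measurable_compose[OF measurable_component_singleton]) (use h in auto)
    have "(\<integral>\<^sup>+y. ?a * (\<Prod>j<m. ?h j (y j)) * ?b \<partial>PiM {..<m} (\<lambda>_. lborel)) =
        ?a * (\<integral>\<^sup>+y. (\<Prod>j<m. ?h j (y j)) \<partial>PiM {..<m} (\<lambda>_. lborel)) * ?b"
      using meas by (simp add: nn_integral_cmult nn_integral_multc)
    also have "(\<integral>\<^sup>+y. (\<Prod>j<m. ?h j (y j)) \<partial>PiM {..<m} (\<lambda>_. lborel)) = (\<Prod>j<m. \<integral>\<^sup>+z. ?h j z \<partial>lborel)"
      using h by (intro L.product_nn_integral_prod) auto
    also have "\<dots> = (\<Prod>j<m. emeasure \<mu> (A (Suc j)))" using int by (intro prod.cong) auto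
    finally show "(\<integral>\<^sup>+y. ?a * (\<Prod>j<m. ?h j (y j)) * ?b \<partial>PiM {..<m} (\<lambda>_. lborel)) =
        ?a * ((\<Prod>j<m. emeasure \<mu> (A (Suc j))) * ?b)" by (simp add: mult.assoc)
  qed
  also have "\<dots> = emeasure \<mu> (A 0) * ((\<Prod>j<m. emeasure \<mu> (A (Suc j))) * (\<Prod>i\<in>{Suc m..<n}. emeasure \<mu> (A i)))"
  proof -
    have [measurable]: "A 0 \<in> sets borel" using A mn by simp
    show ?thesis unfolding \<mu>_def by (subst nn_integral_multc) (simp_all add: emeasure_density)
  qed
  also have "\<dots> = (\<Prod>i<n. emeasure \<mu> (A i))" unfolding prod_lessThan_split[OF mn] by (simp add: mult.assoc)
  finally show "emeasure ?P (Pi\<^sub>E {..<n} A) = (\<Prod>i<n. emeasure \<mu> (A i))" .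
qed simp

text \<open>The laws live on functions restricted to \<open>{..<n}\<close>; the assumption
  \<open>dep\<close> allows \<open>G\<close> to be evaluated at unrestricted ones.\<close>

lemma expectation_rescaled:
  fixes G :: "(nat \<Rightarrow> 'a) \<Rightarrow> real"
  assumes r: "r > 0" and mn: "m < n"
    and G: "G \<in> borel_measurable (PiM {..<n} (\<lambda>_. borel))"
    and dep: "\<And>x y. (\<And>i. i < n \<Longrightarrow> x i = y i) \<Longrightarrow> G x = G y"
  shows "(\<integral>\<omega>. G (\<lambda>i. X i \<omega>) \<partial>M) =
    r ^ (DIM('a) * m) * (\<integral>q. rescaled_density r m q * G (rescaled r m q) \<partial>rescaled_space m)"
proof -
  have restr: "G (\<lambda>i\<in>{..<n}. x i) = G x" for x by (rule dep) simp
  have mX: "(\<lambda>\<omega>. \<lambda>i\<in>{..<n}. X i \<omega>) \<in> measurable M (PiM {..<n} (\<lambda>_. borel))"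
    by (intro measurable_restrict X_measurable)
  have mR: "(\<lambda>q. \<lambda>i\<in>{..<n}. rescaled r m q i) \<in> measurable (rescaled_space m) (PiM {..<n} (\<lambda>_. borel))"
    by (intro measurable_restrict rescaled_measurable)
  let ?W = "\<lambda>q. r ^ (DIM('a) * m) * rescaled_density r m q"
  have GR: "(\<lambda>q. G (rescaled r m q)) \<in> borel_measurable (rescaled_space m)"
    using measurable_compose[OF mR G] unfolding restr by simp
  have "(\<integral>\<omega>. G (\<lambda>i. X i \<omega>) \<partial>M) = (\<integral>x. G x \<partial>distr M (PiM {..<n} (\<lambda>_. borel)) (\<lambda>\<omega>. \<lambda>i\<in>{..<n}. X i \<omega>))"
    using integral_distr[OF mX G] by (simp add: restr)
  also have "\<dots> = (\<integral>x. G x \<partial>distr (density (rescaled_space m) (\<lambda>q. ennreal (?W q)))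
      (PiM {..<n} (\<lambda>_. borel)) (\<lambda>q. \<lambda>i\<in>{..<n}. rescaled r m q i))"
    using law[of "{..<n}" "\<lambda>i. i"] rescaled_law[OF r mn] by simp
  also have "\<dots> = (\<integral>q. G (rescaled r m q) \<partial>density (rescaled_space m) (\<lambda>q. ennreal (?W q)))"
    using mR G by (subst integral_distr) (simp_all add: restr)
  also have "\<dots> = (\<integral>q. ?W q *\<^sub>R G (rescaled r m q) \<partial>rescaled_space m)"
    using GR r rescaled_density_nonneg by (intro integral_density) auto
  also have "\<dots> = r ^ (DIM('a) * m) * (\<integral>q. rescaled_density r m q * G (rescaled r m q) \<partial>rescaled_space m)"
    by (simp add: mult.assoc)
  finally show ?thesis .
qed

text \<open>By \<open>law\<close> both index families have the same product law.\<close>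

lemma expectation_permute:
  fixes G :: "(nat \<Rightarrow> 'a) \<Rightarrow> real"
  assumes \<sigma>: "inj_on \<sigma> {..<n}"
    and G: "G \<in> borel_measurable (PiM {..<n} (\<lambda>_. borel))"
    and dep: "\<And>x y. (\<And>i. i < n \<Longrightarrow> x i = y i) \<Longrightarrow> G x = G y"
  shows "(\<integral>\<omega>. G (\<lambda>i. X (\<sigma> i) \<omega>) \<partial>M) = (\<integral>\<omega>. G (\<lambda>i. X i \<omega>) \<partial>M)"
proof -
  have restr: "G (\<lambda>i\<in>{..<n}. x i) = G x" for x by (rule dep) simp
  have m: "(\<lambda>\<omega>. \<lambda>i\<in>{..<n}. X (\<tau> i) \<omega>) \<in> measurable M (PiM {..<n} (\<lambda>_. borel))" for \<tau> :: "nat \<Rightarrow> nat"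
    by (intro measurable_restrict X_measurable)
  have "(\<integral>\<omega>. G (\<lambda>i. X (\<tau> i) \<omega>) \<partial>M) = (\<integral>x. G x \<partial>PiM {..<n} (\<lambda>_. \<mu>))" if "inj_on \<tau> {..<n}" for \<tau>
    unfolding law[OF _ that, of, symmetric, OF finite_lessThan] using integral_distr[OF m G, of \<tau>] by (simp add: restr)
  from this[OF \<sigma>] this[of "\<lambda>i. i"] show ?thesis by simp
qed

section \<open>Probability bounds for crowded configurations\<close>

lemma emeasure_cball_le:
  assumes "0 \<le> \<rho>"
  shows "emeasure \<mu> (cball z \<rho>) \<le> ennreal (B * unit_ball_vol (real DIM('a)) * \<rho> ^ DIM('a))"
proof -
  have "emeasure \<mu> (cball z \<rho>) = (\<integral>\<^sup>+x. ennreal (f x) * indicator (cball z \<rho>) x \<partial>lborel)"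
    unfolding \<mu>_def by (rule emeasure_density) auto
  also have "\<dots> \<le> (\<integral>\<^sup>+x. ennreal B * indicator (cball z \<rho>) x \<partial>lborel)"
    using bound by (intro nn_integral_mono mult_right_mono) (auto intro: ennreal_leI)
  also have "\<dots> = ennreal B * emeasure lborel (cball z \<rho>)" by (rule nn_integral_cmult_indicator) simp
  also have "\<dots> = ennreal (B * unit_ball_vol (real DIM('a)) * \<rho> ^ DIM('a))"
    using assms B_nonneg by (simp add: emeasure_cball ennreal_mult mult.assoc)
  finally show ?thesis .
qed

text \<open>Given the roots in \<open>R\<close>, the points of \<open>D\<close> are independent, and
  each has to fall into a ball around its root \<open>p j\<close>, at a cost of at most
  \<open>c\<close>.\<close>

lemma prob_star_le:
  assumes D: "finite D" and R: "finite R" "D \<inter> R = {}" and p: "\<And>j. j \<in> D \<Longrightarrow> p j \<in> R"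
    and c: "0 \<le> c" "\<And>z. emeasure \<mu> (cball z \<rho>) \<le> ennreal c"
  shows "prob {\<omega>\<in>space M. \<forall>j\<in>D. dist (X (p j) \<omega>) (X j \<omega>) \<le> \<rho>} \<le> c ^ card D"
proof -
  let ?S = "{x\<in>space (PiM (R \<union> D) (\<lambda>_. \<mu>)). \<forall>j\<in>D. dist (x (p j)) (x j) \<le> \<rho>}"
  have fin: "finite (R \<union> D)" using D R by simp
  have "{x\<in>space (PiM (R \<union> D) (\<lambda>_. \<mu>)). dist (x (p j)) (x j) \<le> \<rho>} \<in> sets (PiM (R \<union> D) (\<lambda>_. \<mu>))" if "j \<in> D" for j
  proof -
    have [measurable]: "(\<lambda>x. x j) \<in> borel_measurable (PiM (R \<union> D) (\<lambda>_. \<mu>))" "(\<lambda>x. x (p j)) \<in> borel_measurable (PiM (R \<union> D) (\<lambda>_. \<mu>))"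
      using measurable_component_singleton[of j "R \<union> D" "\<lambda>_. \<mu>"] measurable_component_singleton[of "p j" "R \<union> D" "\<lambda>_. \<mu>"] p[OF that] that
      by (simp_all cong: measurable_cong_sets)
    show ?thesis by measurable
  qed
  then have S: "?S \<in> sets (PiM (R \<union> D) (\<lambda>_. \<mu>))" using D by (intro sets.sets_Collect_finite_All) auto
  have mX: "(\<lambda>\<omega>. \<lambda>i\<in>R \<union> D. X i \<omega>) \<in> measurable M (PiM (R \<union> D) (\<lambda>_. borel))"
    by (intro measurable_restrict X_measurable)
  have sets: "sets (PiM (R \<union> D) (\<lambda>_. \<mu>)) = sets (PiM (R \<union> D) (\<lambda>_. borel))" by (intro sets_PiM_cong) auto
  have "emeasure M {\<omega>\<in>space M. \<forall>j\<in>D. dist (X (p j) \<omega>) (X j \<omega>) \<le> \<rho>} =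
      emeasure M ((\<lambda>\<omega>. \<lambda>i\<in>R \<union> D. X i \<omega>) -` ?S \<inter> space M)"
    using p by (intro arg_cong[where f="emeasure M"]) (auto simp: space_PiM)
  also have "\<dots> = emeasure (distr M (PiM (R \<union> D) (\<lambda>_. borel)) (\<lambda>\<omega>. \<lambda>i\<in>R \<union> D. X i \<omega>)) ?S"
    using S unfolding sets by (rule emeasure_distr[OF mX, symmetric])
  also have "\<dots> = emeasure (PiM (R \<union> D) (\<lambda>_. \<mu>)) ?S"
    using law[OF fin, of "\<lambda>i. i"] by simp
  also have "\<dots> = (\<integral>\<^sup>+x. indicator ?S x \<partial>PiM (R \<union> D) (\<lambda>_. \<mu>))" using S by simp
  also have "\<dots> = (\<integral>\<^sup>+x. \<integral>\<^sup>+y. indicator ?S (merge R D (x, y)) \<partial>PiM D (\<lambda>_. \<mu>) \<partial>PiM R (\<lambda>_. \<mu>))"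
    using R D S by (intro \<mu>P.product_nn_integral_fold) auto
  also have "\<dots> \<le> (\<integral>\<^sup>+x. ennreal c ^ card D \<partial>PiM R (\<lambda>_. \<mu>))"
  proof (rule nn_integral_mono)
    fix x
    have "(\<integral>\<^sup>+y. indicator ?S (merge R D (x, y)) \<partial>PiM D (\<lambda>_. \<mu>)) \<le>
        (\<integral>\<^sup>+y. (\<Prod>j\<in>D. indicator (cball (x (p j)) \<rho>) (y j)) \<partial>PiM D (\<lambda>_. \<mu>))"
    proof (rule nn_integral_mono)
      fix y
      show "indicator ?S (merge R D (x, y)) \<le> (\<Prod>j\<in>D. indicator (cball (x (p j)) \<rho>) (y j) :: ennreal)"
      proof (cases "merge R D (x, y) \<in> ?S")
        case True
        have "dist (x (p j)) (y j) \<le> \<rho>" if j: "j \<in> D" for j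
        proof -
          have "dist (merge R D (x, y) (p j)) (merge R D (x, y) j) \<le> \<rho>" using True j by blast
          moreover have "j \<notin> R" "p j \<in> R" using j p R by auto
          ultimately show ?thesis using j by (simp add: merge_def)
        qed
        then have "(\<Prod>j\<in>D. indicator (cball (x (p j)) \<rho>) (y j) :: ennreal) = 1" by simp
        then show ?thesis by (simp add: indicator_def)
      qed simp
    qed
    also have "\<dots> = (\<Prod>j\<in>D. \<integral>\<^sup>+z. indicator (cball (x (p j)) \<rho>) z \<partial>\<mu>)"
      using D by (intro \<mu>P.product_nn_integral_prod borel_measurable_indicator) auto
    also have "\<dots> = (\<Prod>j\<in>D. emeasure \<mu> (cball (x (p j)) \<rho>))" by simp
    also have "\<dots> \<le> ennreal c ^ card D" by (rule prod_ennreal_le_power[OF D c(2)])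
    finally show "(\<integral>\<^sup>+y. indicator ?S (merge R D (x, y)) \<partial>PiM D (\<lambda>_. \<mu>)) \<le> ennreal c ^ card D" .
  qed
  also have "\<dots> = ennreal (c ^ card D)"
    using prob_space.emeasure_space_1[OF prob_space_PiM[of R "\<lambda>_. \<mu>"]] prob_space_\<mu> c(1) by (simp add: ennreal_power)
  finally show ?thesis using c(1) by (simp add: emeasure_eq_measure)
qed

text \<open>If the second cluster meets the first, some index \<open>j\<close> outside is within
  \<open>2 * \<rho>\<close> of the point 0: one star with \<open>k + 2\<close> leaves and at most
  \<open>n\<close> choices. If it is disjoint, two stars rooted at 0 and \<open>Min J\<close> have
  \<open>2 * k + 2\<close> leaves together, with at most \<open>n ^ (k + 2)\<close> choices.\<close>

lemma prob_two_clusters_le: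
  assumes c: "0 \<le> c" "\<And>z. emeasure \<mu> (cball z (2 * \<rho>)) \<le> ennreal c" and \<rho>: "0 \<le> \<rho>"
  shows "prob {\<omega>\<in>space M. close_points (\<lambda>i. X i \<omega>) {..<k + 2} \<rho> \<and>
      (\<exists>J\<subseteq>{..<n}. card J = k + 2 \<and> J \<noteq> {..<k + 2} \<and> close_points (\<lambda>i. X i \<omega>) J \<rho>)}
    \<le> real n * c ^ (k + 2) + real n ^ (k + 2) * c ^ (2 * k + 2)"
proof -
  let ?E = "{\<omega>\<in>space M. close_points (\<lambda>i. X i \<omega>) {..<k + 2} \<rho> \<and>
      (\<exists>J\<subseteq>{..<n}. card J = k + 2 \<and> J \<noteq> {..<k + 2} \<and> close_points (\<lambda>i. X i \<omega>) J \<rho>)}"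
  define S where "S D p = {\<omega>\<in>space M. \<forall>j\<in>D. dist (X (p j) \<omega>) (X j \<omega>) \<le> 2 * \<rho>}" for D :: "nat set" and p :: "nat \<Rightarrow> nat"
  have S: "S D p \<in> sets M" if "finite D" for D p
    unfolding S_def using that by (intro sets.sets_Collect_finite_All) measurable
  define D1 where "D1 j = insert j {1..<k + 2}" for j
  define \<J> where "\<J> = {J. J \<subseteq> {k + 2..<n} \<and> card J = k + 2}"
  define D2 where "D2 J = {1..<k + 2} \<union> (J - {Min J})" for J
  define p2 where "p2 J j = (if j \<in> J then Min J else 0)" for J and j :: nat
  have fin\<J>: "finite \<J>" unfolding \<J>_def by (rule finite_subset[of _ "Pow {k + 2..<n}"]) auto
  have J: "finite J" "J \<noteq> {}" "Min J \<in> J" "J \<inter> {..<k + 2} = {}" if "J \<in> \<J>" for J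
  proof -
    show *: "finite J" "J \<noteq> {}" using that finite_subset[of J "{k + 2..<n}"] by (auto simp: \<J>_def)
    then show "Min J \<in> J" by (rule Min_in)
    show "J \<inter> {..<k + 2} = {}" using that by (auto simp: \<J>_def)
  qed
  have sub: "?E \<subseteq> (\<Union>j\<in>{k + 2..<n}. S (D1 j) (\<lambda>_. 0)) \<union> (\<Union>J\<in>\<J>. S (D2 J) (p2 J))"
  proof
    fix \<omega> assume "\<omega> \<in> ?E"
    then obtain J where \<omega>: "\<omega> \<in> space M" "close_points (\<lambda>i. X i \<omega>) {..<k + 2} \<rho>"
      and JJ: "J \<subseteq> {..<n}" "card J = k + 2" "J \<noteq> {..<k + 2}" "close_points (\<lambda>i. X i \<omega>) J \<rho>" by blast
    have d0: "dist (X i \<omega>) (X j \<omega>) \<le> \<rho>" if "i < k + 2" "j < k + 2" for i j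
      using \<omega>(2) that by (simp add: close_points_def)
    have dJ: "dist (X i \<omega>) (X j \<omega>) \<le> \<rho>" if "i \<in> J" "j \<in> J" for i j
      using JJ(4) that by (simp add: close_points_def)
    have le2: "a \<le> 2 * \<rho>" if "a \<le> \<rho>" for a using that \<rho> by linarith
    show "\<omega> \<in> (\<Union>j\<in>{k + 2..<n}. S (D1 j) (\<lambda>_. 0)) \<union> (\<Union>J\<in>\<J>. S (D2 J) (p2 J))"
    proof (cases "J \<inter> {..<k + 2} = {}")
      case True
      then have "J \<in> \<J>" using JJ by (force simp: \<J>_def)
      moreover have "\<omega> \<in> S (D2 J) (p2 J)"
        unfolding S_def
      proof (intro CollectI conjI ballI)
        fix j assume j: "j \<in> D2 J"
        show "dist (X (p2 J j) \<omega>) (X j \<omega>) \<le> 2 * \<rho>"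
        proof (cases "j \<in> J")
          case True
          then show ?thesis using dJ[of "Min J" j] J(3)[OF \<open>J \<in> \<J>\<close>] le2 by (simp add: p2_def)
        next
          case False
          then show ?thesis using d0[of 0 j] j le2 by (simp add: p2_def D2_def)
        qed
      qed (rule \<omega>(1))
      ultimately show ?thesis by blast
    next
      case False
      then obtain i where i: "i \<in> J" "i < k + 2" by auto
      have "\<not> J \<subseteq> {..<k + 2}" using JJ(2,3) card_subset_eq[of "{..<k + 2}" J] by auto
      then obtain j where j: "j \<in> J" "\<not> j < k + 2" by auto
      have "dist (X 0 \<omega>) (X j \<omega>) \<le> dist (X 0 \<omega>) (X i \<omega>) + dist (X i \<omega>) (X j \<omega>)" by (rule dist_triangle)
      also have "\<dots> \<le> \<rho> + \<rho>" using i j by (intro add_mono d0 dJ) auto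
      finally have "\<omega> \<in> S (D1 j) (\<lambda>_. 0)"
        using \<omega>(1) d0[of 0] le2 by (auto simp: S_def D1_def)
      moreover have "j \<in> {k + 2..<n}" using j JJ(1) by auto
      ultimately show ?thesis by blast
    qed
  qed
  have 1: "prob (S (D1 j) (\<lambda>_. 0)) \<le> c ^ (k + 2)" if "j \<in> {k + 2..<n}" for j
  proof -
    have "prob (S (D1 j) (\<lambda>_. 0)) \<le> c ^ card (D1 j)"
      unfolding S_def by (rule prob_star_le[where R="{0}"]) (use c that in \<open>auto simp: D1_def\<close>)
    moreover have "card (D1 j) = k + 2" using that by (simp add: D1_def)
    ultimately show ?thesis by simp
  qed
  have 2: "prob (S (D2 J) (p2 J)) \<le> c ^ (2 * k + 2)" if "J \<in> \<J>" for J
  proof -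
    note J = J[OF that]
    have Min: "\<not> Min J < k + 2" using J(3,4) by auto
    have "prob (S (D2 J) (p2 J)) \<le> c ^ card (D2 J)"
      unfolding S_def by (rule prob_star_le[where R="{0, Min J}"]) (use c J Min in \<open>auto simp: D2_def p2_def\<close>)
    moreover have "card (D2 J) = card {1..<k + 2} + card (J - {Min J})"
      unfolding D2_def using J by (intro card_Un_disjoint) auto
    moreover have "card (J - {Min J}) = k + 1" using J that by (simp add: \<J>_def)
    ultimately have "prob (S (D2 J) (p2 J)) \<le> c ^ card (D2 J)" "card (D2 J) = 2 * k + 2" by simp_all
    then show ?thesis by (simp only:)
  qed
  have "prob ?E \<le> prob ((\<Union>j\<in>{k + 2..<n}. S (D1 j) (\<lambda>_. 0)) \<union> (\<Union>J\<in>\<J>. S (D2 J) (p2 J)))"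
    using sub by (rule finite_measure_mono) (use S J(1) fin\<J> in \<open>auto simp: D1_def D2_def intro!: sets.Un sets.finite_UN\<close>)
  also have "\<dots> \<le> prob (\<Union>j\<in>{k + 2..<n}. S (D1 j) (\<lambda>_. 0)) + prob (\<Union>J\<in>\<J>. S (D2 J) (p2 J))"
    by (rule measure_Un_le) (use S J(1) fin\<J> in \<open>auto simp: D1_def D2_def intro!: sets.finite_UN\<close>)
  also have "\<dots> \<le> (\<Sum>j\<in>{k + 2..<n}. prob (S (D1 j) (\<lambda>_. 0))) + (\<Sum>J\<in>\<J>. prob (S (D2 J) (p2 J)))"
    by (intro add_mono finite_measure_subadditive_finite) (use S J(1) fin\<J> in \<open>auto simp: D1_def D2_def\<close>)
  also have "\<dots> \<le> (\<Sum>j\<in>{k + 2..<n}. c ^ (k + 2)) + (\<Sum>J\<in>\<J>. c ^ (2 * k + 2))"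
    using 1 2 by (intro add_mono sum_mono) auto
  also have "\<dots> = real (card {k + 2..<n}) * c ^ (k + 2) + real (card \<J>) * c ^ (2 * k + 2)" by simp
  also have "\<dots> \<le> real n * c ^ (k + 2) + real n ^ (k + 2) * c ^ (2 * k + 2)"
  proof (intro add_mono mult_right_mono zero_le_power c(1))
    have "card \<J> = card {k + 2..<n} choose (k + 2)" unfolding \<J>_def by (rule n_subsets) simp
    also have "\<dots> \<le> (n - (k + 2)) ^ (k + 2)" using binomial_fact_pow[of "n - (k + 2)" "k + 2"]
      by (metis card_atLeastLessThan fact_ge_1 le_trans mult_le_mono2 nat_mult_1_right)
    also have "\<dots> \<le> n ^ (k + 2)" by (intro power_mono) auto
    finally show "real (card \<J>) \<le> real n ^ (k + 2)" by (metis of_nat_le_iff of_nat_power)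
  qed auto
  finally show ?thesis .
qed

end

section \<open>Isolated clusters\<close>

text \<open>Nothing is asked of \<open>J\<close> itself; every other set of \<open>k + 2\<close>
  indices must fail to be close. The quantifier ranges over an explicit finite set for the sake of
  measurability.\<close>

definition isolated_cluster :: "nat \<Rightarrow> nat \<Rightarrow> (nat \<Rightarrow> 'a::metric_space) \<Rightarrow> nat set \<Rightarrow> real \<Rightarrow> bool" where
  "isolated_cluster k n x J \<rho> \<longleftrightarrow>
    (\<forall>J'\<in>{J'. J' \<subseteq> {..<n} \<and> card J' = k + 2 \<and> J' \<noteq> J}. \<not> close_points x J' \<rho>)"

lemma close_points_mono: "close_points x J \<rho> \<Longrightarrow> \<rho> \<le> \<rho>' \<Longrightarrow> close_points x J \<rho>'"
  unfolding close_points_def using order_trans by blast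

lemma close_pointsD: "close_points x J \<rho> \<Longrightarrow> i \<in> J \<Longrightarrow> j \<in> J \<Longrightarrow> dist (x i) (x j) \<le> \<rho>"
  by (simp add: close_points_def)

text \<open>If some close set is isolated, it is the only close one and its term restores
  \<open>v\<close>. Otherwise the first sum is zero, and for \<open>v \<noteq> 0\<close> a close but
  crowded set alone contributes \<open>b\<close>. Closeness is measured at \<open>\<rho>0\<close>,
  isolation at the larger \<open>\<rho>\<close>.\<close>

lemma cluster_decomposition:
  fixes v b :: real and n k :: nat and x :: "nat \<Rightarrow> 'a::metric_space"
  defines "\<J> \<equiv> {J. J \<subseteq> {..<n} \<and> card J = k + 2}"
  assumes supp: "v \<noteq> 0 \<Longrightarrow> \<exists>J\<subseteq>{..<n}. card J = k + 2 \<and> close_points x J \<rho>0"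
    and b: "\<bar>v\<bar> \<le> b" and \<rho>: "\<rho>0 \<le> \<rho>"
  shows "\<bar>v - (\<Sum>J\<in>\<J>. if close_points x J \<rho>0 \<and> isolated_cluster k n x J \<rho> then v else 0)\<bar> \<le>
    (\<Sum>J\<in>\<J>. if close_points x J \<rho>0 \<and> \<not> isolated_cluster k n x J \<rho> then b else 0)"
proof -
  have fin: "finite \<J>" unfolding \<J>_def by (rule finite_subset[of _ "Pow {..<n}"]) auto
  have b0: "0 \<le> b" using b by linarith
  have nonneg: "0 \<le> (\<Sum>J\<in>\<J>. if close_points x J \<rho>0 \<and> \<not> isolated_cluster k n x J \<rho> then b else 0)"
    using b0 by (intro sum_nonneg) auto
  show ?thesis
  proof (cases "\<exists>J0\<in>\<J>. close_points x J0 \<rho>0 \<and> isolated_cluster k n x J0 \<rho>")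
    case True
    then obtain J0 where J0: "J0 \<in> \<J>" "close_points x J0 \<rho>0" "isolated_cluster k n x J0 \<rho>" by blast
    have far: "\<not> close_points x J \<rho>0" if "J \<in> \<J>" "J \<noteq> J0" for J
      using J0(3) that close_points_mono[OF _ \<rho>, of x J] unfolding isolated_cluster_def \<J>_def by blast
    have "(\<Sum>J\<in>\<J>. if close_points x J \<rho>0 \<and> isolated_cluster k n x J \<rho> then v else 0) =
        (\<Sum>J\<in>{J0}. if close_points x J \<rho>0 \<and> isolated_cluster k n x J \<rho> then v else 0)"
      using fin J0 far by (intro sum.mono_neutral_right) auto
    then show ?thesis using J0 nonneg by simp
  next
    case False
    then have zero: "(\<Sum>J\<in>\<J>. if close_points x J \<rho>0 \<and> isolated_cluster k n x J \<rho> then v else 0) = 0"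
      by (intro sum.neutral) auto
    show ?thesis
    proof (cases "v = 0")
      case True
      then show ?thesis using zero nonneg by simp
    next
      case nz: False
      then obtain J where J: "J \<in> \<J>" "close_points x J \<rho>0" using supp unfolding \<J>_def by blast
      then have "b = (if close_points x J \<rho>0 \<and> \<not> isolated_cluster k n x J \<rho> then b else 0)" using False by auto
      also have "\<dots> \<le> (\<Sum>J\<in>\<J>. if close_points x J \<rho>0 \<and> \<not> isolated_cluster k n x J \<rho> then b else 0)"
        using b0 by (intro member_le_sum[OF J(1)] fin) auto
      finally show ?thesis using b zero by linarith
    qed
  qed
qed

section \<open>Permutations of the sample indices and measurable events\<close>

lemma isolated_cluster_permute:
  assumes \<sigma>: "bij_betw \<sigma> {..<n} {..<n}" and J: "J \<subseteq> {..<n}"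
  shows "isolated_cluster k n (\<lambda>i. x (\<sigma> i)) J \<rho> \<longleftrightarrow> isolated_cluster k n x (\<sigma> ` J) \<rho>"
proof -
  have inj: "inj_on \<sigma> {..<n}" and im: "\<sigma> ` {..<n} = {..<n}" using \<sigma> by (auto simp: bij_betw_def)
  have close: "close_points (\<lambda>i. x (\<sigma> i)) K \<rho> \<longleftrightarrow> close_points x (\<sigma> ` K) \<rho>" for K
    by (simp add: close_points_def)
  have card: "card (\<sigma> ` K) = card K" if "K \<subseteq> {..<n}" for K
    using inj_on_subset[OF inj that] by (rule card_image)
  have neq: "\<sigma> ` K = \<sigma> ` J \<longleftrightarrow> K = J" if "K \<subseteq> {..<n}" for K
    by (rule inj_on_image_eq_iff[OF inj that J])
  show ?thesis
  proof
    assume *: "isolated_cluster k n (\<lambda>i. x (\<sigma> i)) J \<rho>"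
    show "isolated_cluster k n x (\<sigma> ` J) \<rho>"
      unfolding isolated_cluster_def
    proof
      fix L assume L: "L \<in> {J'. J' \<subseteq> {..<n} \<and> card J' = k + 2 \<and> J' \<noteq> \<sigma> ` J}"
      then obtain K where K: "K \<subseteq> {..<n}" "L = \<sigma> ` K" using im by (metis (no_types, lifting) mem_Collect_eq subset_image_iff)
      then have "K \<in> {J'. J' \<subseteq> {..<n} \<and> card J' = k + 2 \<and> J' \<noteq> J}" using L card[OF K(1)] by auto
      then have "\<not> close_points (\<lambda>i. x (\<sigma> i)) K \<rho>" using * unfolding isolated_cluster_def by blast
      then show "\<not> close_points x L \<rho>" using close K(2) by simp
    qed
  next
    assume *: "isolated_cluster k n x (\<sigma> ` J) \<rho>"
    show "isolated_cluster k n (\<lambda>i. x (\<sigma> i)) J \<rho>"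
      unfolding isolated_cluster_def
    proof
      fix K assume K: "K \<in> {J'. J' \<subseteq> {..<n} \<and> card J' = k + 2 \<and> J' \<noteq> J}"
      then have "K \<subseteq> {..<n}" by blast
      then have "\<sigma> ` K \<subseteq> \<sigma> ` {..<n}" by (rule image_mono)
      then have "\<sigma> ` K \<in> {J'. J' \<subseteq> {..<n} \<and> card J' = k + 2 \<and> J' \<noteq> \<sigma> ` J}"
        using K card[OF \<open>K \<subseteq> {..<n}\<close>] neq[OF \<open>K \<subseteq> {..<n}\<close>] unfolding im by simp
      then show "\<not> close_points (\<lambda>i. x (\<sigma> i)) K \<rho>" using * close unfolding isolated_cluster_def by blast
    qed
  qed
qed

lemma ex_permutation_onto:
  assumes J: "J \<subseteq> {..<n}" "card J = m"
  obtains \<sigma> where "bij_betw \<sigma> {..<n} {..<n}" "\<sigma> ` {..<m} = J" "{..<m} \<subseteq> {..<n}"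
proof -
  have fin: "finite J" using J finite_subset by blast
  have "m \<le> n" using J card_mono[OF finite_lessThan J(1)] by simp
  then have sub: "{..<m} \<subseteq> {..<n}" by simp
  obtain g where g: "bij_betw g {..<m} J"
    using finite_same_card_bij[of "{..<m}" J] fin J by auto
  have "card ({..<n} - {..<m}) = card ({..<n} - J)"
    using fin J sub by (simp add: card_Diff_subset)
  then obtain h where h: "bij_betw h ({..<n} - {..<m}) ({..<n} - J)"
    using finite_same_card_bij[of "{..<n} - {..<m}" "{..<n} - J"] by auto
  define \<sigma> where "\<sigma> i = (if i < m then g i else h i)" for i
  have 1: "bij_betw \<sigma> {..<m} J" using g by (rule bij_betw_cong[THEN iffD1, rotated]) (simp add: \<sigma>_def)
  have "bij_betw \<sigma> ({..<n} - {..<m}) ({..<n} - J)"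
    using h by (rule bij_betw_cong[THEN iffD1, rotated]) (auto simp: \<sigma>_def)
  from bij_betw_combine[OF 1 this] have "bij_betw \<sigma> ({..<m} \<union> ({..<n} - {..<m})) (J \<union> ({..<n} - J))" by auto
  moreover have "{..<m} \<union> ({..<n} - {..<m}) = {..<n}" "J \<union> ({..<n} - J) = {..<n}" using sub J by auto
  ultimately show ?thesis using that[of \<sigma>] 1 sub by (simp add: bij_betw_def)
qed

lemma sets_close_points:
  fixes X :: "'i \<Rightarrow> 'w \<Rightarrow> 'a::euclidean_space"
  assumes "finite J" "\<And>i. i \<in> J \<Longrightarrow> X i \<in> borel_measurable N"
  shows "{\<omega>\<in>space N. close_points (\<lambda>i. X i \<omega>) J \<rho>} \<in> sets N"
  unfolding close_points_def
proof (intro sets.sets_Collect_finite_All assms(1))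
  fix i j assume "i \<in> J" "j \<in> J"
  have [measurable]: "X i \<in> borel_measurable N" "X j \<in> borel_measurable N" using assms(2) \<open>i \<in> J\<close> \<open>j \<in> J\<close> by auto
  show "{\<omega>\<in>space N. dist (X i \<omega>) (X j \<omega>) \<le> \<rho>} \<in> sets N" by measurable
qed

lemma sets_isolated_cluster:
  fixes X :: "nat \<Rightarrow> 'w \<Rightarrow> 'a::euclidean_space"
  assumes "\<And>i. i < n \<Longrightarrow> X i \<in> borel_measurable N"
  shows "{\<omega>\<in>space N. isolated_cluster k n (\<lambda>i. X i \<omega>) J \<rho>} \<in> sets N"
  unfolding isolated_cluster_def
proof (rule sets.sets_Collect_finite_All)
  show "finite {J'. J' \<subseteq> {..<n} \<and> card J' = k + 2 \<and> J' \<noteq> J}"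
    by (rule finite_subset[of _ "Pow {..<n}"]) auto
  fix J' assume "J' \<in> {J'. J' \<subseteq> {..<n} \<and> card J' = k + 2 \<and> J' \<noteq> J}"
  then have J': "J' \<subseteq> {..<n}" by blast
  have "{\<omega>\<in>space N. close_points (\<lambda>i. X i \<omega>) J' \<rho>} \<in> sets N"
    by (rule sets_close_points) (use J' assms finite_subset in auto)
  then show "{\<omega>\<in>space N. \<not> close_points (\<lambda>i. X i \<omega>) J' \<rho>} \<in> sets N" by (rule sets.sets_Collect_neg)
qed

section \<open>Elementary limits\<close>

lemma integral_scale_measure:
  fixes g :: "'b \<Rightarrow> real"
  assumes "g \<in> borel_measurable N" "0 \<le> c"
  shows "(\<integral>x. g x \<partial>scale_measure (ennreal c) N) = c * (\<integral>x. g x \<partial>N)"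
proof -
  have "scale_measure (ennreal c) N = density N (\<lambda>_. ennreal c)"
    by (rule measure_eqI) (simp_all add: emeasure_density_const)
  then show ?thesis using assms by (simp add: integral_density)
qed

lemma tendsto_perturbation:
  fixes x y e :: "nat \<Rightarrow> real"
  assumes "x \<longlonglongrightarrow> l" "e \<longlonglongrightarrow> 0" "\<forall>\<^sub>F n in sequentially. \<bar>y n - x n\<bar> \<le> e n"
  shows "y \<longlonglongrightarrow> l"
proof -
  have "(\<lambda>n. y n - x n) \<longlonglongrightarrow> 0"
    by (rule Lim_null_comparison[OF _ assms(2)]) (use assms(3) in simp)
  from tendsto_add[OF assms(1) this] show ?thesis by simp
qed

text \<open>Applied with \<open>N = n\<close> and with \<open>s\<close>, \<open>t\<close> the
  \<open>DIM('a)\<close>-th powers of \<open>r n\<close>, \<open>T n\<close>. It extracts the factor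
  \<open>s ^ (k + 1)\<close> of the normalisation and leaves \<open>N * s\<close> and
  \<open>N ^ (k + 2) * s ^ (k + 1)\<close>, the two quantities assumed to tend to zero.\<close>

lemma crowding_bound_scaling:
  fixes N K s t :: real
  shows "N * (K * s * t) ^ (k + 2) + N ^ (k + 2) * (K * s * t) ^ (2 * k + 2) =
    s ^ (k + 1) * (K ^ (k + 2) * (t ^ (k + 2) * (N * s)) + K ^ (2 * k + 2) * (t ^ (2 * k + 2) * (N ^ (k + 2) * s ^ (k + 1))))"
proof -
  have "s ^ (k + 2) = s ^ (k + 1) * s" "s ^ (2 * k + 2) = s ^ (k + 1) * s ^ (k + 1)"
    by (simp_all add: power_add[symmetric] mult_2)
  then show ?thesis unfolding power_mult_distrib by (simp only: distrib_left mult_ac)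
qed

text \<open>With \<open>m = k + 2\<close> this supplies the factorial of the limiting
  constant.\<close>

lemma binomial_asymptotics: "(\<lambda>n. real (n choose m) / real n ^ m) \<longlonglongrightarrow> 1 / fact m"
proof -
  have "(\<lambda>n. 1 - real i / real n) \<longlonglongrightarrow> 1 - 0" for i
    by (intro tendsto_intros lim_const_over_n)
  then have "(\<lambda>n. (\<Prod>i=0..<m. 1 - real i / real n) / fact m) \<longlonglongrightarrow> (\<Prod>i=0..<m. 1 - 0) / fact m"
    by (intro tendsto_divide tendsto_prod) auto
  moreover have "\<forall>\<^sub>F n in sequentially. (\<Prod>i=0..<m. 1 - real i / real n) / fact m = real (n choose m) / real n ^ m"
  proof (rule eventually_sequentiallyI[of 1])
    fix n :: nat assume n: "1 \<le> n"
    have "real (n choose m) = (\<Prod>i=0..<m. real n - real i) / fact m"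
      unfolding binomial_gbinomial gbinomial_prod_rev by simp
    also have "(\<Prod>i=0..<m. real n - real i) = (\<Prod>i=0..<m. real n * (1 - real i / real n))"
      using n by (intro prod.cong) (auto simp: field_simps)
    also have "\<dots> = real n ^ m * (\<Prod>i=0..<m. 1 - real i / real n)" by (simp add: prod.distrib)
    finally show "(\<Prod>i=0..<m. 1 - real i / real n) / fact m = real (n choose m) / real n ^ m"
      using n by simp
  qed
  ultimately show ?thesis by (simp add: tendsto_cong)
qed

text \<open>For \<open>T = p ^ (-1 / (2 D))\<close> the product \<open>T ^ D * p\<close> is the
  square root of \<open>p\<close>, hence tends to zero. Here \<open>p\<close> is \<open>q\<close>
  plus a positive null sequence, because \<open>q\<close> may vanish.\<close>

lemma slowly_growing_sequence:
  fixes q :: "nat \<Rightarrow> real"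
  assumes q: "q \<longlonglongrightarrow> 0" "\<And>n. 0 \<le> q n" and D: "D > 0"
  obtains T where "\<And>n. 0 < T n" "filterlim T at_top sequentially" "(\<lambda>n. T n ^ D * q n) \<longlonglongrightarrow> 0"
proof -
  define p where "p n = q n + inverse (real (Suc n))" for n
  have p0: "0 < p n" for n unfolding p_def using q(2)[of n] by (intro add_nonneg_pos) auto
  have "p \<longlonglongrightarrow> 0 + 0" unfolding p_def by (intro tendsto_add q(1) LIMSEQ_inverse_real_of_nat)
  then have p: "p \<longlonglongrightarrow> 0" by simp
  define t where "t n = root (2 * D) (p n)" for n
  have t0: "0 < t n" for n using p0 D by (simp add: t_def)
  have "t \<longlonglongrightarrow> root (2 * D) 0" unfolding t_def by (rule tendsto_real_root[OF p])
  then have t: "t \<longlonglongrightarrow> 0" by simp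
  have sq: "(t n ^ D) ^ 2 = p n" for n
  proof -
    have "(t n ^ D) ^ 2 = t n ^ (2 * D)" by (simp add: power_mult[symmetric] mult.commute)
    also have "\<dots> = p n" unfolding t_def using p0[of n] D by (intro real_root_pow_pos2) auto
    finally show ?thesis .
  qed
  show ?thesis
  proof (rule that[of "\<lambda>n. inverse (t n)"])
    show "0 < inverse (t n)" for n using t0 by simp
    show "filterlim (\<lambda>n. inverse (t n)) at_top sequentially"
      using t0 by (intro filterlim_inverse_at_top t) simp
    have "(0::real) ^ D = 0" using D by simp
    then have lim: "(\<lambda>n. t n ^ D) \<longlonglongrightarrow> 0" using tendsto_power[OF t, of D] by (simp only:)
    show "(\<lambda>n. inverse (t n) ^ D * q n) \<longlonglongrightarrow> 0"
    proof (rule tendsto_sandwich[OF _ _ tendsto_const lim])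
      show "\<forall>\<^sub>F n in sequentially. 0 \<le> inverse (t n) ^ D * q n"
        using q(2) t0 by (intro always_eventually allI mult_nonneg_nonneg zero_le_power) (auto intro: less_imp_le)
      show "\<forall>\<^sub>F n in sequentially. inverse (t n) ^ D * q n \<le> t n ^ D"
      proof (intro always_eventually allI)
        fix n
        have "q n \<le> p n" by (simp add: p_def)
        then have "inverse (t n) ^ D * q n \<le> inverse (t n) ^ D * p n"
          using t0[of n] by (intro mult_left_mono) auto
        also have "\<dots> = t n ^ D"
          unfolding sq[of n, symmetric] using t0[of n] by (simp add: power2_eq_square power_inverse field_simps)
        finally show "inverse (t n) ^ D * q n \<le> t n ^ D" .
      qed
    qed
  qed
qed

section \<open>Convergence of expectations\<close>

context iid_points
begin

section \<open>Reduction to the first \<open>k + 2\<close> points\<close>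

text \<open>The truth value \<open>c\<close> treats isolated and crowded configurations at
  once.\<close>

lemma borel_measurable_cluster_functional:
  fixes \<Psi> :: "'a set \<Rightarrow> real"
  assumes n: "k + 2 \<le> n"
    and \<Psi>: "(\<lambda>x. \<Psi> (x ` {..<n})) \<in> borel_measurable (PiM {..<n} (\<lambda>_. borel))"
  shows "(\<lambda>x. if close_points x {..<k + 2} \<rho>0 \<and> (isolated_cluster k n x {..<k + 2} \<rho> = c) then \<Psi> (x ` {..<n}) else 0)
    \<in> borel_measurable (PiM {..<n} (\<lambda>_. borel))"
proof (intro measurable_If \<Psi> borel_measurable_const)
  have comp: "(\<lambda>x. x i) \<in> borel_measurable (PiM {..<n} (\<lambda>_. borel))" if "i < n" for i
    using that by (intro measurable_component_singleton) simp
  have "{x\<in>space (PiM {..<n} (\<lambda>_. borel)). close_points (\<lambda>i. x i) {..<k + 2} \<rho>0} \<in> sets (PiM {..<n} (\<lambda>_. borel :: 'a measure))"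
    by (rule sets_close_points) (use n comp in auto)
  moreover have "{x\<in>space (PiM {..<n} (\<lambda>_. borel)). isolated_cluster k n (\<lambda>i. x i) {..<k + 2} \<rho>} \<in> sets (PiM {..<n} (\<lambda>_. borel :: 'a measure))"
    by (rule sets_isolated_cluster) (use comp in auto)
  ultimately show "{x\<in>space (PiM {..<n} (\<lambda>_. borel)). close_points x {..<k + 2} \<rho>0 \<and> (isolated_cluster k n x {..<k + 2} \<rho> = c)} \<in> sets (PiM {..<n} (\<lambda>_. borel :: 'a measure))"
    by (cases c) (auto intro!: sets.sets_Collect)
qed

lemma cluster_functional_cong:
  fixes x y :: "nat \<Rightarrow> 'a"
  assumes n: "k + 2 \<le> n" and xy: "\<And>i. i < n \<Longrightarrow> x i = y i"
  shows "(if close_points x {..<k + 2} \<rho>0 \<and> (isolated_cluster k n x {..<k + 2} \<rho> = c) then \<Psi> (x ` {..<n}) else 0) =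
    (if close_points y {..<k + 2} \<rho>0 \<and> (isolated_cluster k n y {..<k + 2} \<rho> = c) then \<Psi> (y ` {..<n}) else 0)"
proof -
  have close: "close_points x K \<rho>' = close_points y K \<rho>'" if K: "K \<subseteq> {..<n}" for K \<rho>'
  proof -
    have "x i = y i" if "i \<in> K" for i using K that xy by auto
    then show ?thesis by (simp add: close_points_def)
  qed
  have "isolated_cluster k n x {..<k + 2} \<rho> = isolated_cluster k n y {..<k + 2} \<rho>"
    unfolding isolated_cluster_def using close by (intro ball_cong) auto
  moreover have "x ` {..<n} = y ` {..<n}" using xy by (intro image_cong) auto
  moreover have "close_points x {..<k + 2} \<rho>0 = close_points y {..<k + 2} \<rho>0" using n by (intro close) auto
  ultimately show ?thesis by (simp only:)
qed

text \<open>A permutation that carries the first \<open>k + 2\<close> indices onto \<open>J\<close>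
  leaves the point set, and with it the value of \<Psi>, unchanged.\<close>

lemma integral_cluster_permute:
  fixes \<Psi> :: "'a set \<Rightarrow> real"
  assumes J: "J \<subseteq> {..<n}" "card J = k + 2"
    and \<Psi>: "(\<lambda>x. \<Psi> (x ` {..<n})) \<in> borel_measurable (PiM {..<n} (\<lambda>_. borel))"
  shows "(\<integral>\<omega>. (if close_points (\<lambda>i. X i \<omega>) J \<rho>0 \<and> (isolated_cluster k n (\<lambda>i. X i \<omega>) J \<rho> = c)
        then \<Psi> ((\<lambda>i. X i \<omega>) ` {..<n}) else 0) \<partial>M) =
    (\<integral>\<omega>. (if close_points (\<lambda>i. X i \<omega>) {..<k + 2} \<rho>0 \<and> (isolated_cluster k n (\<lambda>i. X i \<omega>) {..<k + 2} \<rho> = c)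
        then \<Psi> ((\<lambda>i. X i \<omega>) ` {..<n}) else 0) \<partial>M)"
proof -
  obtain \<sigma> where \<sigma>: "bij_betw \<sigma> {..<n} {..<n}" "\<sigma> ` {..<k + 2} = J" "{..<k + 2} \<subseteq> {..<n}"
    using ex_permutation_onto[OF J] .
  then have n: "k + 2 \<le> n" by simp
  define G :: "(nat \<Rightarrow> 'a) \<Rightarrow> real" where "G x = (if close_points x {..<k + 2} \<rho>0 \<and> (isolated_cluster k n x {..<k + 2} \<rho> = c)
        then \<Psi> (x ` {..<n}) else 0)" for x
  have m: "G \<in> borel_measurable (PiM {..<n} (\<lambda>_. borel))"
    unfolding G_def by (rule borel_measurable_cluster_functional[OF n \<Psi>])
  have dep: "G x = G y" if "\<And>i. i < n \<Longrightarrow> x i = y i" for x y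
    unfolding G_def using that by (rule cluster_functional_cong[OF n])
  have G\<sigma>: "G (\<lambda>i. x (\<sigma> i)) = (if close_points x J \<rho>0 \<and> (isolated_cluster k n x J \<rho> = c) then \<Psi> (x ` {..<n}) else 0)" for x
  proof -
    have "(\<lambda>i. x (\<sigma> i)) ` {..<n} = x ` {..<n}" using \<sigma>(1) by (simp add: image_image[symmetric] bij_betw_def)
    moreover have "close_points (\<lambda>i. x (\<sigma> i)) {..<k + 2} \<rho>0 \<longleftrightarrow> close_points x J \<rho>0"
      unfolding \<sigma>(2)[symmetric] by (simp add: close_points_def)
    moreover have "isolated_cluster k n (\<lambda>i. x (\<sigma> i)) {..<k + 2} \<rho> \<longleftrightarrow> isolated_cluster k n x J \<rho>"
      using isolated_cluster_permute[OF \<sigma>(1,3)] unfolding \<sigma>(2) .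
    ultimately show ?thesis by (simp only: G_def)
  qed
  have inj: "inj_on \<sigma> {..<n}" using \<sigma>(1) by (simp add: bij_betw_def)
  have "(\<integral>\<omega>. G (\<lambda>i. X (\<sigma> i) \<omega>) \<partial>M) = (\<integral>\<omega>. G (\<lambda>i. X i \<omega>) \<partial>M)"
    by (rule expectation_permute[OF inj m]) (rule dep)
  moreover have "G (\<lambda>i. X (\<sigma> i) \<omega>) = (if close_points (\<lambda>i. X i \<omega>) J \<rho>0 \<and> (isolated_cluster k n (\<lambda>i. X i \<omega>) J \<rho> = c)
        then \<Psi> ((\<lambda>i. X i \<omega>) ` {..<n}) else 0)" for \<omega>
    by (rule G\<sigma>[of "\<lambda>i. X i \<omega>"])
  ultimately show ?thesis by (simp only: G_def[of "\<lambda>i. X i _"])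
qed

text \<open>This integrates \<open>cluster_decomposition\<close>. By exchangeability all
  \<open>n choose (k + 2)\<close> index sets contribute equally, both to the main term and to the
  error.\<close>

lemma expectation_one_cluster:
  fixes \<Psi> :: "'a set \<Rightarrow> real"
  assumes n: "k + 2 \<le> n"
    and \<Psi>: "(\<lambda>x. \<Psi> (x ` {..<n})) \<in> borel_measurable (PiM {..<n} (\<lambda>_. borel))"
    and b: "\<And>S. finite S \<Longrightarrow> \<bar>\<Psi> S\<bar> \<le> b"
    and supp: "\<And>x. \<Psi> (x ` {..<n}) \<noteq> 0 \<Longrightarrow> \<exists>J\<subseteq>{..<n}. card J = k + 2 \<and> close_points x J \<rho>0"
    and \<rho>: "\<rho>0 \<le> \<rho>"
  shows "\<bar>(\<integral>\<omega>. \<Psi> ((\<lambda>i. X i \<omega>) ` {..<n}) \<partial>M) - real (n choose (k + 2)) *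
      (\<integral>\<omega>. (if close_points (\<lambda>i. X i \<omega>) {..<k + 2} \<rho>0 \<and> isolated_cluster k n (\<lambda>i. X i \<omega>) {..<k + 2} \<rho>
        then \<Psi> ((\<lambda>i. X i \<omega>) ` {..<n}) else 0) \<partial>M)\<bar> \<le>
    real (n choose (k + 2)) * (b * prob {\<omega>\<in>space M. close_points (\<lambda>i. X i \<omega>) {..<k + 2} \<rho>0 \<and> \<not> isolated_cluster k n (\<lambda>i. X i \<omega>) {..<k + 2} \<rho>})"
proof -
  define \<J> where "\<J> = {J. J \<subseteq> {..<n} \<and> card J = k + 2}"
  define E where "E c J = {\<omega>\<in>space M. close_points (\<lambda>i. X i \<omega>) J \<rho>0 \<and> (isolated_cluster k n (\<lambda>i. X i \<omega>) J \<rho> = c)}" for c J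
  let ?P = "\<lambda>\<omega>. \<Psi> ((\<lambda>i. X i \<omega>) ` {..<n})"
  define A where "A c v J \<omega> = (if close_points (\<lambda>i. X i \<omega>) J \<rho>0 \<and> (isolated_cluster k n (\<lambda>i. X i \<omega>) J \<rho> = c) then v \<omega> else (0::real))" for c v J \<omega>
  have E: "E c J \<in> sets M" if "J \<in> \<J>" for c J
  proof -
    have "{\<omega>\<in>space M. close_points (\<lambda>i. X i \<omega>) J \<rho>0} \<in> sets M"
      using that finite_subset[of J "{..<n}"] by (intro sets_close_points) (auto simp: \<J>_def)
    moreover have "{\<omega>\<in>space M. isolated_cluster k n (\<lambda>i. X i \<omega>) J \<rho>} \<in> sets M"
      by (rule sets_isolated_cluster) simp
    ultimately show ?thesis unfolding E_def by (cases c) (auto intro!: sets.sets_Collect)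
  qed
  have mX: "(\<lambda>\<omega>. \<lambda>i\<in>{..<n}. X i \<omega>) \<in> measurable M (PiM {..<n} (\<lambda>_. borel))"
    by (intro measurable_restrict X_measurable)
  have im: "(\<lambda>i\<in>{..<n}. x i) ` {..<n} = x ` {..<n}" for x :: "nat \<Rightarrow> 'a" by (intro image_cong) auto
  have P: "?P \<in> borel_measurable M" using measurable_compose[OF mX \<Psi>] by (simp only: im)
  have bP: "\<bar>?P \<omega>\<bar> \<le> b" for \<omega> by (intro b) simp
  have b0: "0 \<le> b" using b[of "{}"] by simp
  have Aeq: "A c v J \<omega> = indicator (E c J) \<omega> * v \<omega>" if "\<omega> \<in> space M" for c v J \<omega>
    using that by (simp add: A_def E_def indicator_def)
  have intA: "integrable M (A c v J)" if "J \<in> \<J>" "v \<in> borel_measurable M" "\<And>\<omega>. \<bar>v \<omega>\<bar> \<le> b" for c v J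
  proof -
    have "integrable M (\<lambda>\<omega>. indicator (E c J) \<omega> * v \<omega>)"
    proof (rule integrable_const_bound[where B=b])
      show "AE \<omega> in M. norm (indicator (E c J) \<omega> * v \<omega>) \<le> b" using that(3) b0 by (auto simp: indicator_def)
      show "(\<lambda>\<omega>. indicator (E c J) \<omega> * v \<omega>) \<in> borel_measurable M"
        using E[OF that(1)] that(2) by (intro borel_measurable_times borel_measurable_indicator) auto
    qed
    moreover have "integrable M (A c v J) \<longleftrightarrow> integrable M (\<lambda>\<omega>. indicator (E c J) \<omega> * v \<omega>)"
      by (intro Bochner_Integration.integrable_cong refl Aeq)
    ultimately show ?thesis by simp
  qed
  have fin: "finite \<J>" unfolding \<J>_def by (rule finite_subset[of _ "Pow {..<n}"]) auto
  have card: "card \<J> = n choose (k + 2)" unfolding \<J>_def using n_subsets[of "{..<n}" "k + 2"] by simp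
  have I0: "{..<k + 2} \<in> \<J>" using n by (auto simp: \<J>_def)
  have perm: "(\<integral>\<omega>. A True ?P J \<omega> \<partial>M) = (\<integral>\<omega>. A True ?P {..<k + 2} \<omega> \<partial>M)" if "J \<in> \<J>" for J
    unfolding A_def using that by (intro integral_cluster_permute \<Psi>) (auto simp: \<J>_def)
  have perm': "(\<integral>\<omega>. A False (\<lambda>_. b) J \<omega> \<partial>M) = (\<integral>\<omega>. A False (\<lambda>_. b) {..<k + 2} \<omega> \<partial>M)" if "J \<in> \<J>" for J
    unfolding A_def using that integral_cluster_permute[of J n k "\<lambda>_. b" \<rho>0 \<rho> False] by (auto simp: \<J>_def)
  have "(\<integral>\<omega>. A False (\<lambda>_. b) {..<k + 2} \<omega> \<partial>M) = (\<integral>\<omega>. indicator (E False {..<k + 2}) \<omega> * b \<partial>M)"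
    using Aeq by (intro Bochner_Integration.integral_cong) auto
  also have "\<dots> = b * prob (E False {..<k + 2})" using E[OF I0] by simp
  finally have Ab: "(\<integral>\<omega>. A False (\<lambda>_. b) {..<k + 2} \<omega> \<partial>M) = b * prob (E False {..<k + 2})" .
  have intP: "integrable M ?P" by (rule integrable_const_bound[where B=b]) (use P bP in auto)
  have intAb: "integrable M (A False (\<lambda>_. b) J)" if "J \<in> \<J>" for J
    by (rule intA[OF that]) (use b0 in auto)
  have sumP: "(\<integral>\<omega>. (\<Sum>J\<in>\<J>. A True ?P J \<omega>) \<partial>M) = real (n choose (k + 2)) * (\<integral>\<omega>. A True ?P {..<k + 2} \<omega> \<partial>M)"
    using intA[OF _ P bP] perm card by (subst Bochner_Integration.integral_sum) auto
  have sumb: "(\<integral>\<omega>. (\<Sum>J\<in>\<J>. A False (\<lambda>_. b) J \<omega>) \<partial>M) = real (n choose (k + 2)) * (\<integral>\<omega>. A False (\<lambda>_. b) {..<k + 2} \<omega> \<partial>M)"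
    using intAb perm' card by (subst Bochner_Integration.integral_sum) auto
  have int1: "integrable M (\<lambda>\<omega>. \<Sum>J\<in>\<J>. A True ?P J \<omega>)" using intA[OF _ P bP] by (intro Bochner_Integration.integrable_sum) auto
  have int2: "integrable M (\<lambda>\<omega>. \<Sum>J\<in>\<J>. A False (\<lambda>_. b) J \<omega>)" using intAb by (intro Bochner_Integration.integrable_sum) auto
  have "\<bar>(\<integral>\<omega>. ?P \<omega> \<partial>M) - (\<integral>\<omega>. (\<Sum>J\<in>\<J>. A True ?P J \<omega>) \<partial>M)\<bar> = \<bar>\<integral>\<omega>. ?P \<omega> - (\<Sum>J\<in>\<J>. A True ?P J \<omega>) \<partial>M\<bar>"
    using intP int1 by simp
  also have "\<dots> \<le> (\<integral>\<omega>. \<bar>?P \<omega> - (\<Sum>J\<in>\<J>. A True ?P J \<omega>)\<bar> \<partial>M)" by (rule integral_abs_bound)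
  also have "\<dots> \<le> (\<integral>\<omega>. (\<Sum>J\<in>\<J>. A False (\<lambda>_. b) J \<omega>) \<partial>M)"
  proof (rule integral_mono)
    show "integrable M (\<lambda>\<omega>. \<bar>?P \<omega> - (\<Sum>J\<in>\<J>. A True ?P J \<omega>)\<bar>)"
      using intP int1 by (intro integrable_abs Bochner_Integration.integrable_diff)
    show "\<bar>?P \<omega> - (\<Sum>J\<in>\<J>. A True ?P J \<omega>)\<bar> \<le> (\<Sum>J\<in>\<J>. A False (\<lambda>_. b) J \<omega>)" for \<omega>
      using cluster_decomposition[OF supp[of "\<lambda>i. X i \<omega>"] bP[of \<omega>] \<rho>] by (simp add: A_def \<J>_def)
  qed (rule int2)
  finally have *: "\<bar>(\<integral>\<omega>. ?P \<omega> \<partial>M) - (\<integral>\<omega>. (\<Sum>J\<in>\<J>. A True ?P J \<omega>) \<partial>M)\<bar> \<le>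
    (\<integral>\<omega>. (\<Sum>J\<in>\<J>. A False (\<lambda>_. b) J \<omega>) \<partial>M)" .
  have "A True ?P {..<k + 2} = (\<lambda>\<omega>. if close_points (\<lambda>i. X i \<omega>) {..<k + 2} \<rho>0 \<and>
      isolated_cluster k n (\<lambda>i. X i \<omega>) {..<k + 2} \<rho> then ?P \<omega> else 0)"
    by (simp add: A_def fun_eq_iff)
  moreover have "E False {..<k + 2} = {\<omega>\<in>space M. close_points (\<lambda>i. X i \<omega>) {..<k + 2} \<rho>0 \<and>
      \<not> isolated_cluster k n (\<lambda>i. X i \<omega>) {..<k + 2} \<rho>}"
    by (simp add: E_def)
  ultimately show ?thesis using * unfolding sumP sumb Ab by (simp only:)
qed

section \<open>Domination and factorisation on the rescaled space\<close>

lemma rescaled_space_component: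
  assumes "q \<in> space (rescaled_space m)"
  shows "fst (snd q) \<in> space (PiM {..<m} (\<lambda>_. lborel))"
  using assms by (auto simp: rescaled_space_def space_pair_measure)

lemma rescaled_eq_affine:
  assumes "i < m + 1"
  shows "rescaled r m q i = fst q + r *\<^sub>R case_nat 0 (fst (snd q)) i"
  using assms by (cases i) (auto simp: rescaled_def)

lemma close_points_rescaled:
  assumes r: "r > 0"
  shows "close_points (rescaled r m q) {..<m + 1} (r * R) \<longleftrightarrow> close_points (case_nat 0 (fst (snd q))) {..<m + 1} R"
proof -
  let ?y = "case_nat 0 (fst (snd q))"
  have "dist (rescaled r m q i) (rescaled r m q j) = r * dist (?y i) (?y j)" if "i < m + 1" "j < m + 1" for i j
  proof -
    have "(fst q + r *\<^sub>R ?y i) - (fst q + r *\<^sub>R ?y j) = r *\<^sub>R (?y i - ?y j)" by (simp add: scaleR_diff_right)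
    then show ?thesis unfolding rescaled_eq_affine[OF that(1)] rescaled_eq_affine[OF that(2)] dist_norm
      using r by (simp only: norm_scaleR abs_of_pos)
  qed
  then show ?thesis using r unfolding close_points_def by simp
qed

lemma rescaled_density_le:
  "rescaled_density r m q \<le> f (fst q) * B ^ m"
proof -
  have "(\<Prod>j<m. f (fst q + r *\<^sub>R fst (snd q) j)) \<le> (\<Prod>j<m. B)"
    by (intro prod_mono) (use nonneg bound in auto)
  then show ?thesis unfolding rescaled_density_def using nonneg by (intro mult_left_mono) auto
qed

text \<open>The integrable majorant: one density factor is kept to integrate over the base point,
  the others are bounded by \<open>B\<close>, and closeness confines the entries of \<open>y\<close>
  to balls.\<close>

definition ball_weight :: "nat \<Rightarrow> real \<Rightarrow> 'a \<times> (nat \<Rightarrow> 'a) \<times> 'w \<Rightarrow> real" where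
  "ball_weight m R q = f (fst q) * B ^ m * indicator (PiE {..<m} (\<lambda>_. cball 0 R)) (fst (snd q))"

lemma integrable_ball_weight: "integrable (rescaled_space m) (ball_weight m R)"
proof -
  let ?K = "PiE {..<m} (\<lambda>_. cball 0 R) :: (nat \<Rightarrow> 'a) set"
  interpret L: product_sigma_finite "\<lambda>_ :: nat. lborel :: 'a measure"
    by (intro product_sigma_finite.intro sigma_finite_lborel)
  have K: "?K \<in> sets (PiM {..<m} (\<lambda>_. borel))" by (intro sets_PiM_I_finite) auto
  have K': "?K \<in> sets (PiM {..<m} (\<lambda>_. lborel))" by (intro sets_PiM_I_finite) auto
  have y: "(\<lambda>q. fst (snd q)) \<in> measurable (rescaled_space m) (PiM {..<m} (\<lambda>_. borel))" by measurable
  have ind: "(\<lambda>q. indicator ?K (fst (snd q)) :: real) \<in> borel_measurable (rescaled_space m)"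
    by (rule measurable_compose[OF y borel_measurable_indicator[OF K]])
  have m: "ball_weight m R \<in> borel_measurable (rescaled_space m)"
    unfolding ball_weight_def by (intro borel_measurable_times ind) measurable
  have nn: "0 \<le> ball_weight m R q" for q
    unfolding ball_weight_def using nonneg B_nonneg by (simp add: indicator_def)
  have em: "emeasure (PiM {..<m} (\<lambda>_. lborel)) ?K = (\<Prod>i<m. emeasure lborel (cball (0::'a) R))"
    by (intro L.emeasure_PiM) auto
  have fin: "emeasure (PiM {..<m} (\<lambda>_. lborel)) ?K < \<infinity>"
    unfolding em using emeasure_lborel_cball_finite[of "0::'a" R] by (simp add: power_less_top_ennreal)
  have "(\<integral>\<^sup>+q. ennreal (ball_weight m R q) \<partial>rescaled_space m) =
      (\<integral>\<^sup>+x. \<integral>\<^sup>+y. \<integral>\<^sup>+\<omega>. ennreal (ball_weight m R (x, y, \<omega>)) \<partial>M \<partial>PiM {..<m} (\<lambda>_. lborel) \<partial>lborel)"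
    by (rule nn_integral_rescaled_space, rule measurable_compose[OF m measurable_ennreal])
  also have "\<dots> = (\<integral>\<^sup>+x. \<integral>\<^sup>+y. ennreal (f x) * ennreal (B ^ m) * indicator ?K y \<partial>PiM {..<m} (\<lambda>_. lborel) \<partial>lborel)"
    using nonneg B_nonneg by (intro nn_integral_cong) (auto simp: ball_weight_def emeasure_space_1 ennreal_mult indicator_def)
  also have "\<dots> = (\<integral>\<^sup>+x. ennreal (f x) * (ennreal (B ^ m) * emeasure (PiM {..<m} (\<lambda>_. lborel)) ?K) \<partial>lborel)"
    unfolding mult.assoc[symmetric] by (intro nn_integral_cong nn_integral_cmult_indicator K')
  also have "\<dots> = ennreal (B ^ m) * emeasure (PiM {..<m} (\<lambda>_. lborel)) ?K"
    using integral_f by (subst nn_integral_multc) auto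
  also have "\<dots> < \<infinity>" using fin by (simp add: ennreal_mult_less_top)
  finally show ?thesis by (intro integrableI_nonneg m) (use nn in auto)
qed

text \<open>The rescaled tuple contains 0 as its first point, so closeness at scale \<open>R\<close>
  places every \<open>y j\<close> in \<open>cball 0 R\<close>.\<close>

lemma ball_weight_ge:
  assumes q: "q \<in> space (rescaled_space m)" and R: "0 \<le> R"
    and v: "v \<noteq> 0 \<Longrightarrow> close_points (case_nat 0 (fst (snd q))) {..<m + 1} R" "\<bar>v\<bar> \<le> b"
  shows "\<bar>rescaled_density r m q * v\<bar> \<le> b * ball_weight m R q"
proof (cases "v = 0")
  case True
  then show ?thesis using v(2) nonneg B_nonneg by (auto simp: ball_weight_def indicator_def)
next
  case False
  have "fst (snd q) j \<in> cball 0 R" if "j < m" for j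
  proof -
    have "dist (case_nat 0 (fst (snd q)) 0) (case_nat 0 (fst (snd q)) (Suc j)) \<le> R"
      by (rule close_pointsD[OF v(1)[OF False]]) (use that in auto)
    then show ?thesis by simp
  qed
  moreover have "fst (snd q) \<in> extensional {..<m}"
    using rescaled_space_component[OF q] by (simp add: space_PiM PiE_def)
  ultimately have "fst (snd q) \<in> PiE {..<m} (\<lambda>_. cball 0 R)" by (simp add: PiE_iff)
  then have "ball_weight m R q = f (fst q) * B ^ m" by (simp add: ball_weight_def)
  moreover have "\<bar>rescaled_density r m q * v\<bar> \<le> (f (fst q) * B ^ m) * b"
    unfolding abs_mult using rescaled_density_le rescaled_density_nonneg v(2) nonneg B_nonneg
    by (intro mult_mono) auto
  ultimately show ?thesis by (simp add: mult.commute)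
qed

text \<open>The limiting integrand does not depend on the sample, whose probability measure
  integrates to 1.\<close>

lemma integral_rescaled_space_product:
  fixes a :: "'a \<Rightarrow> real" and h :: "(nat \<Rightarrow> 'a) \<Rightarrow> real"
  assumes int: "integrable (rescaled_space m) (\<lambda>q. a (fst q) * h (fst (snd q)))"
    and h: "h \<in> borel_measurable (PiM {..<m} (\<lambda>_. lborel))"
  shows "(\<integral>q. a (fst q) * h (fst (snd q)) \<partial>rescaled_space m) = (\<integral>x. a x \<partial>lborel) * (\<integral>y. h y \<partial>PiM {..<m} (\<lambda>_. lborel))"
proof -
  let ?Y = "PiM {..<m} (\<lambda>_. lborel) :: (nat \<Rightarrow> 'a) measure"
  interpret P: pair_sigma_finite "lborel :: 'a measure" "?Y \<Otimes>\<^sub>M M"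
    by (intro pair_sigma_finite.intro sigma_finite_lborel sigma_finite_rescaled_factor)
  have inner: "(\<integral>z. a x * h (fst z) \<partial>(?Y \<Otimes>\<^sub>M M)) = a x * (\<integral>y. h y \<partial>?Y)" for x
  proof -
    have "(\<integral>y. h y \<partial>?Y) = (\<integral>y. h y \<partial>distr (?Y \<Otimes>\<^sub>M M) ?Y fst)" by (simp only: distr_pair_fst)
    also have "\<dots> = (\<integral>z. h (fst z) \<partial>(?Y \<Otimes>\<^sub>M M))" using h by (intro integral_distr) auto
    finally show ?thesis by simp
  qed
  have "(\<integral>q. a (fst q) * h (fst (snd q)) \<partial>rescaled_space m) = (\<integral>x. (\<integral>z. a x * h (fst z) \<partial>(?Y \<Otimes>\<^sub>M M)) \<partial>lborel)"
    using P.integral_fst'[of "\<lambda>q. a (fst q) * h (fst (snd q))"] int by (simp add: rescaled_space_def)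
  also have "\<dots> = (\<integral>x. a x * (\<integral>y. h y \<partial>?Y) \<partial>lborel)" by (simp only: inner)
  finally show ?thesis by simp
qed

lemma AE_rescaled_space:
  assumes "AE x in lborel. P x"
  shows "AE q in rescaled_space m. P (fst q)"
proof -
  let ?Z = "PiM {..<m} (\<lambda>_. lborel :: 'a measure) \<Otimes>\<^sub>M M"
  interpret Z: sigma_finite_measure ?Z by (rule sigma_finite_rescaled_factor)
  obtain N where N: "{x\<in>space lborel. \<not> P x} \<subseteq> N" "emeasure lborel N = 0" "N \<in> sets lborel"
    using AE_E[OF assms] by metis
  show ?thesis
  proof (rule AE_I)
    show "{q \<in> space (rescaled_space m). \<not> P (fst q)} \<subseteq> N \<times> space ?Z"
      using N(1) by (auto simp: rescaled_space_def space_pair_measure)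
    show "emeasure (rescaled_space m) (N \<times> space ?Z) = 0"
      unfolding rescaled_space_def using N by (subst Z.emeasure_pair_measure_Times) auto
    show "N \<times> space ?Z \<in> sets (rescaled_space m)"
      unfolding rescaled_space_def using N(3) by (intro pair_measureI) auto
  qed
qed

lemma prob_crowded_le:
  assumes \<rho>0: "\<rho>0 \<le> \<rho>" and \<rho>: "0 \<le> \<rho>"
  defines "c \<equiv> B * unit_ball_vol (real DIM('a)) * (2 * \<rho>) ^ DIM('a)"
  shows "prob {\<omega>\<in>space M. close_points (\<lambda>i. X i \<omega>) {..<k + 2} \<rho>0 \<and> \<not> isolated_cluster k n (\<lambda>i. X i \<omega>) {..<k + 2} \<rho>}
    \<le> real n * c ^ (k + 2) + real n ^ (k + 2) * c ^ (2 * k + 2)"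
proof -
  let ?E = "{\<omega>\<in>space M. close_points (\<lambda>i. X i \<omega>) {..<k + 2} \<rho> \<and>
      (\<exists>J\<subseteq>{..<n}. card J = k + 2 \<and> J \<noteq> {..<k + 2} \<and> close_points (\<lambda>i. X i \<omega>) J \<rho>)}"
  have c: "0 \<le> c" unfolding c_def using B_nonneg \<rho> by simp
  have eq: "?E = {\<omega>\<in>space M. close_points (\<lambda>i. X i \<omega>) {..<k + 2} \<rho>} \<inter>
      (space M - {\<omega>\<in>space M. isolated_cluster k n (\<lambda>i. X i \<omega>) {..<k + 2} \<rho>})"
    by (auto simp: isolated_cluster_def)
  have "?E \<in> sets M"
    unfolding eq by (intro sets.Int sets.compl_sets sets_close_points sets_isolated_cluster) auto
  moreover have "{\<omega>\<in>space M. close_points (\<lambda>i. X i \<omega>) {..<k + 2} \<rho>0 \<and> \<not> isolated_cluster k n (\<lambda>i. X i \<omega>) {..<k + 2} \<rho>} \<subseteq> ?E"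
    unfolding eq using close_points_mono[OF _ \<rho>0] by auto
  ultimately have "prob {\<omega>\<in>space M. close_points (\<lambda>i. X i \<omega>) {..<k + 2} \<rho>0 \<and> \<not> isolated_cluster k n (\<lambda>i. X i \<omega>) {..<k + 2} \<rho>} \<le> prob ?E"
    by (intro finite_measure_mono)
  also have "\<dots> \<le> real n * c ^ (k + 2) + real n ^ (k + 2) * c ^ (2 * k + 2)"
    by (rule prob_two_clusters_le[OF c _ \<rho>]) (use emeasure_cball_le[of "2 * \<rho>"] \<rho> in \<open>simp add: c_def\<close>)
  finally show ?thesis .
qed

lemma expectation_convergence:
  fixes F :: "'f::field itself" and r :: "nat \<Rightarrow> real"
  assumes k: "k \<ge> 1" and \<rho>: "vague_metric DeltaL \<rho>" and \<phi>: "\<phi> \<in> C0_functions DeltaL"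
    and r: "\<And>n. r n > 0"
    and lim1: "(\<lambda>n. real n * r n ^ DIM('a)) \<longlonglongrightarrow> 0"
    and lim2: "(\<lambda>n. real n ^ (k + 2) * r n ^ (DIM('a) * (k + 1))) \<longlonglongrightarrow> 0"
    and contf: "AE x in lborel. isCont f x"
  shows "(\<lambda>n. inverse (real n ^ (k + 2) * r n ^ (DIM('a) * (k + 1))) *
      (\<integral>\<omega>. \<phi> (cech_diagram F k (r n) ((\<lambda>i. X i \<omega>) ` {..<n})) \<partial>M)) \<longlonglongrightarrow>
    1 / fact (k + 2) * (\<integral>x. f x ^ (k + 2) \<partial>lborel) *
      (\<integral>y. \<phi> (tuple_diagram F k (case_nat 0 y)) \<partial>PiM {..<k + 1} (\<lambda>_. lborel :: 'a measure))"
proof -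
  let ?d = "DIM('a)" and ?m = "k + 1" and ?Q = "rescaled_space (k + 1)"
  let ?I0 = "{..<k + 2}"
  have m1: "{..<?m + 1} = ?I0" by simp
  obtain b where b: "\<And>N. N \<in> radon_point_measures DeltaL \<Longrightarrow> \<bar>\<phi> N\<bar> \<le> b"
    using \<phi> unfolding C0_functions_def bounded_iff by auto
  have b0: "0 \<le> b" using b[OF null_point_measure_radon] by linarith
  have \<phi>cont: "continuous_map (vague_topology DeltaL) euclideanreal \<phi>" using \<phi> by (simp add: C0_functions_def)
  then have \<phi>m: "\<phi> \<in> borel_measurable (borel_of (vague_topology DeltaL))" by (rule continuous_map_measurable)
  obtain U where U: "openin (vague_topology DeltaL) U" "null_point_measure DeltaL \<in> U" "\<And>N. N \<in> U \<Longrightarrow> \<phi> N = 0"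
    using \<phi> by (auto simp: C0_functions_def)
  obtain T1 where T1: "\<forall>N\<in>radon_point_measures DeltaL. agree_up_to T1 N (null_point_measure DeltaL) \<longrightarrow> N \<in> U"
    using vague_open_agree[OF U(1,2)] by blast
  define T0 where "T0 = max T1 0"
  have T0: "0 \<le> T0" by (simp add: T0_def)
  have vanish: "\<phi> N = 0" if "N \<in> radon_point_measures DeltaL" "agree_up_to T0 N (null_point_measure DeltaL)" for N
    using agree_up_to_mono[OF that(2), of T1] T1 that(1) U(3) by (simp add: T0_def)
  define a where "a n = real n ^ (k + 2) * r n ^ (?d * ?m)" for n
  \<comment> \<open>\<open>q\<close> dominates both null sequences of the hypotheses, so one growth
    condition on \<open>T\<close> handles both error terms.\<close>
  define q where "q n = real n * r n ^ ?d + a n" for n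
  have q0: "0 \<le> q n" for n using r[of n] by (simp add: q_def a_def)
  have "q \<longlonglongrightarrow> 0 + 0" unfolding q_def a_def by (intro tendsto_add lim1 lim2)
  then have q: "q \<longlonglongrightarrow> 0" by simp
  \<comment> \<open>The crowding bound contains \<open>T n ^ DIM('a)\<close> to the power at most
    \<open>2 * k + 2\<close>.\<close>
  define D where "D = ?d * (2 * k + 2)"
  have D: "0 < D" by (simp add: D_def)
  obtain T where T: "\<And>n. 0 < T n" "filterlim T at_top sequentially" "(\<lambda>n. T n ^ D * q n) \<longlonglongrightarrow> 0"
    by (rule slowly_growing_sequence[OF q q0 D]) (rule that)
  have T_ge: "\<forall>\<^sub>F n in sequentially. t \<le> T n" for t
    using T(2) by (simp add: filterlim_at_top)
  \<comment> \<open>\<open>\<rho>0\<close> is the cluster scale that a nonzero value of \<phi>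
    forces, \<open>\<rho>1\<close> the growing scale of isolation. The factor 2 is that of
    \<open>persistence_mult_close\<close> and \<open>persistent_betti_isolated\<close>.\<close>
  define \<rho>0 where "\<rho>0 n = r n * (2 * T0)" for n
  define \<rho>1 where "\<rho>1 n = r n * (2 * T n)" for n
  have \<rho>1: "0 \<le> \<rho>1 n" for n using r[of n] T(1)[of n] by (simp add: \<rho>1_def)
  have \<rho>01: "\<rho>0 n \<le> \<rho>1 n" if "T0 \<le> T n" for n using that r[of n] by (simp add: \<rho>0_def \<rho>1_def)

  define R where "R n = rescaled (r n) ?m" for n
  define w where "w n = rescaled_density (r n) ?m" for n
  define \<xi> where "\<xi> n q = cech_diagram F k (r n) (R n q ` {..<n})" for n q
  define \<delta> where "\<delta> q = tuple_diagram F k (case_nat 0 (fst (snd q)))" for q :: "'a \<times> (nat \<Rightarrow> 'a) \<times> 'w"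
  define cl where "cl q = close_points (case_nat 0 (fst (snd q))) ?I0 (2 * T0)" for q :: "'a \<times> (nat \<Rightarrow> 'a) \<times> 'w"
  define iso where "iso n q = isolated_cluster k n (R n q) ?I0 (\<rho>1 n)" for n q

  have Rm: "(\<lambda>q. R n q i) \<in> borel_measurable ?Q" for n i unfolding R_def by (rule rescaled_measurable)
  have ym: "(\<lambda>q. case_nat 0 (fst (snd q)) i) \<in> borel_measurable ?Q" if "i < k + 2" for i
    using that rescaled_coordinate_measurable[of "i - 1" ?m] by (cases i) auto
  have \<xi>m: "(\<lambda>q. \<phi> (\<xi> n q)) \<in> borel_measurable ?Q" for n
    unfolding \<xi>_def by (rule measurable_compose[OF measurable_cech_diagram[OF \<rho> finite_lessThan r Rm] \<phi>m])
  have \<delta>m: "(\<lambda>q. \<phi> (\<delta> q)) \<in> borel_measurable ?Q"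
    unfolding \<delta>_def by (rule measurable_compose[OF measurable_tuple_diagram[OF \<rho> k ym] \<phi>m])
  have wm: "w n \<in> borel_measurable ?Q" for n unfolding w_def by (rule rescaled_density_measurable)
  have clS: "{q\<in>space ?Q. cl q} \<in> sets ?Q" unfolding cl_def by (rule sets_close_points) (use ym in auto)
  have isoS: "{q\<in>space ?Q. iso n q} \<in> sets ?Q" for n
    unfolding iso_def by (rule sets_isolated_cluster) (rule Rm)
  have \<xi>r: "\<xi> n q \<in> radon_point_measures DeltaL" for n q
    unfolding \<xi>_def by (intro cech_diagram_radon r) simp
  have \<delta>r: "\<delta> q \<in> radon_point_measures DeltaL" for q unfolding \<delta>_def by (rule tuple_diagram_radon[OF k])
  have clR: "close_points (R n q) ?I0 (\<rho>0 n) \<longleftrightarrow> cl q" for n q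
    using close_points_rescaled[OF r, of n ?m q "2 * T0"] unfolding m1 R_def \<rho>0_def cl_def .
  have w0: "0 \<le> w n q" for n q unfolding w_def by (rule rescaled_density_nonneg)

  define J where "J n = (\<integral>q. w n q * (if cl q \<and> iso n q then \<phi> (\<xi> n q) else 0) \<partial>?Q)" for n
  define \<gamma> where "\<gamma> n = (\<integral>q. w n q * (if cl q \<and> \<not> iso n q then 1 else 0) \<partial>?Q)" for n
  \<comment> \<open>For fixed \<open>q\<close> isolation need not hold eventually. On crowded
    configurations the integrand is therefore replaced by its limit, so that \<open>u\<close>
    converges pointwise; the change costs at most \<open>b * \<gamma> n\<close>.\<close>
  define u where "u n q = w n q * (if cl q then (if iso n q then \<phi> (\<xi> n q) else \<phi> (\<delta> q)) else 0)" for n q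
  define L where "L = (\<integral>x. f x ^ (k + 2) \<partial>lborel) * (\<integral>y. \<phi> (tuple_diagram F k (case_nat 0 y)) \<partial>PiM {..<?m} (\<lambda>_. lborel :: 'a measure))"

  have dominated: "\<bar>w n q * v\<bar> \<le> c * ball_weight ?m (2 * T0) q"
    if "q \<in> space ?Q" "v \<noteq> 0 \<Longrightarrow> cl q" "\<bar>v\<bar> \<le> c" for n q v c
    unfolding w_def using T0 that by (intro ball_weight_ge) (auto simp: cl_def)
  have integrable: "integrable ?Q (\<lambda>q. w n q * v q)"
    if "v \<in> borel_measurable ?Q" "\<And>q. v q \<noteq> 0 \<Longrightarrow> cl q" "\<And>q. \<bar>v q\<bar> \<le> c" for n v c
  proof (rule Bochner_Integration.integrable_bound)
    show "integrable ?Q (\<lambda>q. c * ball_weight ?m (2 * T0) q)"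
      by (intro integrable_mult_right integrable_ball_weight)
    show "(\<lambda>q. w n q * v q) \<in> borel_measurable ?Q" using wm that(1) by (rule borel_measurable_times)
    show "AE q in ?Q. norm (w n q * v q) \<le> norm (c * ball_weight ?m (2 * T0) q)"
    proof (rule AE_I2)
      fix q assume "q \<in> space ?Q"
      then have "\<bar>w n q * v q\<bar> \<le> c * ball_weight ?m (2 * T0) q" by (rule dominated[OF _ that(2,3)])
      then show "norm (w n q * v q) \<le> norm (c * ball_weight ?m (2 * T0) q)"
        by (simp only: real_norm_def)
    qed
  qed
  have S1: "{q\<in>space ?Q. cl q \<and> iso n q} \<in> sets ?Q" for n
    using clS isoS by (intro sets.sets_Collect_conj)
  have S2: "{q\<in>space ?Q. cl q \<and> \<not> iso n q} \<in> sets ?Q" for n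
    using clS isoS by (intro sets.sets_Collect_conj sets.sets_Collect_neg)
  have int1: "integrable ?Q (\<lambda>q. w n q * (if cl q \<and> iso n q then \<phi> (\<xi> n q) else 0))" for n
  proof (rule integrable)
    show "(\<lambda>q. if cl q \<and> iso n q then \<phi> (\<xi> n q) else 0) \<in> borel_measurable ?Q"
      using S1 \<xi>m by (intro measurable_If borel_measurable_const)
    show "\<bar>if cl q \<and> iso n q then \<phi> (\<xi> n q) else 0\<bar> \<le> b" for q
      using b[OF \<xi>r] b0 by simp
  qed (simp split: if_splits)
  have int2: "integrable ?Q (\<lambda>q. w n q * (if cl q \<and> \<not> iso n q then 1 else 0))" for n
  proof (rule integrable)
    show "(\<lambda>q. if cl q \<and> \<not> iso n q then 1 else 0 :: real) \<in> borel_measurable ?Q"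
      using S2 by (intro measurable_If borel_measurable_const)
    show "\<bar>if cl q \<and> \<not> iso n q then 1 else 0 :: real\<bar> \<le> 1" for q by simp
  qed (simp split: if_splits)
  have um: "(\<lambda>q. if cl q then (if iso n q then \<phi> (\<xi> n q) else \<phi> (\<delta> q)) else 0) \<in> borel_measurable ?Q" for n
    using clS isoS \<xi>m \<delta>m by (intro measurable_If borel_measurable_const)
  have bu: "\<bar>if cl q then (if iso n q then \<phi> (\<xi> n q) else \<phi> (\<delta> q)) else 0\<bar> \<le> b" for n q
    using b[OF \<xi>r] b[OF \<delta>r] b0 by simp
  have int3: "integrable ?Q (u n)" for n
    unfolding u_def[abs_def] by (rule integrable[OF um _ bu]) (simp split: if_splits)

  have comp: "(\<lambda>x. x i) \<in> borel_measurable (PiM {..<n} (\<lambda>_. borel :: 'a measure))" if "i \<in> {..<n}" for i n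
    using that by (rule measurable_component_singleton)
  have \<Psi>m: "(\<lambda>x. \<phi> (cech_diagram F k (r n) (x ` {..<n}))) \<in> borel_measurable (PiM {..<n} (\<lambda>_. borel :: 'a measure))" for n
    using measurable_compose[OF measurable_cech_diagram[OF \<rho> finite_lessThan r, of n "\<lambda>i x. x i", OF comp] \<phi>m] .

  have J_eq: "(\<integral>\<omega>. (if close_points (\<lambda>i. X i \<omega>) ?I0 (\<rho>0 n) \<and> isolated_cluster k n (\<lambda>i. X i \<omega>) ?I0 (\<rho>1 n)
        then \<phi> (cech_diagram F k (r n) ((\<lambda>i. X i \<omega>) ` {..<n})) else 0) \<partial>M) = r n ^ (?d * ?m) * J n"
    if n: "k + 2 \<le> n" for n
  proof -
    let ?G = "\<lambda>x :: nat \<Rightarrow> 'a. if close_points x ?I0 (\<rho>0 n) \<and> (isolated_cluster k n x ?I0 (\<rho>1 n) = True)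
        then \<phi> (cech_diagram F k (r n) (x ` {..<n})) else 0"
    have "(\<integral>\<omega>. ?G (\<lambda>i. X i \<omega>) \<partial>M) =
      r n ^ (?d * ?m) * (\<integral>q. rescaled_density (r n) ?m q * ?G (rescaled (r n) ?m q) \<partial>rescaled_space ?m)"
    proof (rule expectation_rescaled[OF r])
      show "?m < n" using n by simp
      show "?G \<in> borel_measurable (PiM {..<n} (\<lambda>_. borel))"
        by (rule borel_measurable_cluster_functional[where \<Psi>="\<lambda>S. \<phi> (cech_diagram F k (r n) S)", OF n \<Psi>m])
      show "?G x = ?G y" if "\<And>i. i < n \<Longrightarrow> x i = y i" for x y
        using that by (rule cluster_functional_cong[where \<Psi>="\<lambda>S. \<phi> (cech_diagram F k (r n) S)", OF n])
    qed
    then show ?thesis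
      unfolding simp_thms(12) R_def[symmetric] w_def[symmetric] clR iso_def[symmetric] \<xi>_def[symmetric] J_def[symmetric] by simp
  qed
  have \<gamma>_eq: "prob {\<omega>\<in>space M. close_points (\<lambda>i. X i \<omega>) ?I0 (\<rho>0 n) \<and> \<not> isolated_cluster k n (\<lambda>i. X i \<omega>) ?I0 (\<rho>1 n)} =
      r n ^ (?d * ?m) * \<gamma> n"
    if n: "k + 2 \<le> n" for n
  proof -
    let ?G = "\<lambda>x :: nat \<Rightarrow> 'a. if close_points x ?I0 (\<rho>0 n) \<and> (isolated_cluster k n x ?I0 (\<rho>1 n) = False) then (\<lambda>_ :: 'a set. 1 :: real) (x ` {..<n}) else 0"
    let ?E = "{\<omega>\<in>space M. close_points (\<lambda>i. X i \<omega>) ?I0 (\<rho>0 n) \<and> \<not> isolated_cluster k n (\<lambda>i. X i \<omega>) ?I0 (\<rho>1 n)}"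
    have E: "?E \<in> sets M"
      by (intro sets.sets_Collect_conj sets.sets_Collect_neg sets_close_points sets_isolated_cluster) auto
    have "prob ?E = (\<integral>\<omega>. indicator ?E \<omega> \<partial>M)" using E by simp
    also have "\<dots> = (\<integral>\<omega>. ?G (\<lambda>i. X i \<omega>) \<partial>M)" by (intro Bochner_Integration.integral_cong) auto
    also have "\<dots> = r n ^ (?d * ?m) * (\<integral>q. rescaled_density (r n) ?m q * ?G (rescaled (r n) ?m q) \<partial>rescaled_space ?m)"
    proof (rule expectation_rescaled[OF r])
      show "?m < n" using n by simp
      show "?G \<in> borel_measurable (PiM {..<n} (\<lambda>_. borel))"
        by (rule borel_measurable_cluster_functional[where \<Psi>="\<lambda>_. 1", OF n]) simp
      show "?G x = ?G y" if "\<And>i. i < n \<Longrightarrow> x i = y i" for x y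
        using that by (rule cluster_functional_cong[where \<Psi>="\<lambda>_. 1", OF n])
    qed
    also have "(\<integral>q. rescaled_density (r n) ?m q * ?G (rescaled (r n) ?m q) \<partial>rescaled_space ?m) = \<gamma> n"
      unfolding R_def[symmetric] w_def[symmetric] clR iso_def[symmetric] \<gamma>_def by simp
    finally show ?thesis .
  qed

  have \<gamma>0: "0 \<le> \<gamma> n" for n unfolding \<gamma>_def using w0 by (intro Bochner_Integration.integral_nonneg) simp
  define K where "K = B * unit_ball_vol (real ?d) * 4 ^ ?d"
  have K: "0 \<le> K" unfolding K_def using B_nonneg by simp
  \<comment> \<open>The Jacobian power of \<open>r n\<close> cancels against the factor extracted by
    \<open>crowding_bound_scaling\<close>; \<open>1 \<le> T n\<close> allows the exponent
    \<open>k + 2\<close> to be raised to \<open>2 * k + 2\<close>.\<close>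
  have \<gamma>_le: "\<gamma> n \<le> (K ^ (k + 2) + K ^ (2 * k + 2)) * (T n ^ D * q n)" if n: "k + 2 \<le> n" "T0 \<le> T n" "1 \<le> T n" for n
  proof -
    let ?c = "B * unit_ball_vol (real ?d) * (2 * \<rho>1 n) ^ ?d"
    let ?s = "r n ^ ?d" and ?t = "T n ^ ?d"
    have "2 * \<rho>1 n = 4 * (r n * T n)" by (simp add: \<rho>1_def)
    then have c: "?c = K * ?s * ?t" by (simp only: K_def power_mult_distrib mult_ac)
    have s: "0 < ?s" using r by simp
    have t: "1 \<le> ?t" using n(3) by simp
    have "r n ^ (?d * ?m) * \<gamma> n \<le> real n * ?c ^ (k + 2) + real n ^ (k + 2) * ?c ^ (2 * k + 2)"
      unfolding \<gamma>_eq[OF n(1), symmetric] by (rule prob_crowded_le[OF \<rho>01[OF n(2)] \<rho>1])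
    also have "\<dots> = ?s ^ ?m * (K ^ (k + 2) * (?t ^ (k + 2) * (real n * ?s)) + K ^ (2 * k + 2) * (?t ^ (2 * k + 2) * (real n ^ (k + 2) * ?s ^ ?m)))"
      unfolding c by (rule crowding_bound_scaling)
    also have "\<dots> \<le> ?s ^ ?m * (K ^ (k + 2) * (?t ^ (2 * k + 2) * q n) + K ^ (2 * k + 2) * (?t ^ (2 * k + 2) * q n))"
    proof (intro mult_left_mono add_mono mult_mono)
      show "?t ^ (k + 2) \<le> ?t ^ (2 * k + 2)" using t by (intro power_increasing) auto
      show "real n * ?s \<le> q n" using r[of n] by (simp add: q_def a_def)
      show "real n ^ (k + 2) * ?s ^ ?m \<le> q n" unfolding q_def a_def power_mult using r[of n] by simp
    qed (use s t K q0[of n] in auto)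
    also have "\<dots> = r n ^ (?d * ?m) * ((K ^ (k + 2) + K ^ (2 * k + 2)) * (T n ^ D * q n))"
      unfolding D_def power_mult by (simp only: distrib_right)
    finally show ?thesis by (rule mult_left_le_imp_le) (use r[of n] in simp)
  qed
  have \<gamma>lim: "\<gamma> \<longlonglongrightarrow> 0"
  proof (rule Lim_null_comparison)
    show "\<forall>\<^sub>F n in sequentially. norm (\<gamma> n) \<le> (K ^ (k + 2) + K ^ (2 * k + 2)) * (T n ^ D * q n)"
      using eventually_ge_at_top[of "k + 2"] T_ge[of T0] T_ge[of 1]
      by eventually_elim (use \<gamma>_le \<gamma>0 in simp)
    show "(\<lambda>n. (K ^ (k + 2) + K ^ (2 * k + 2)) * (T n ^ D * q n)) \<longlonglongrightarrow> 0"
      using tendsto_mult_left[OF T(3), of "K ^ (k + 2) + K ^ (2 * k + 2)"] by simp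
  qed

  have r_lim: "r \<longlonglongrightarrow> 0"
  proof -
    have "(\<lambda>n. r n ^ ?d) \<longlonglongrightarrow> 0"
    proof (rule Lim_null_comparison[OF _ lim1])
      show "\<forall>\<^sub>F n in sequentially. norm (r n ^ ?d) \<le> real n * r n ^ ?d"
        using eventually_ge_at_top[of 1]
      proof eventually_elim
        case (elim n)
        then show ?case using r[of n] mult_right_mono[of 1 "real n" "r n ^ ?d"] by simp
      qed
    qed
    then have "(\<lambda>n. root ?d (r n ^ ?d)) \<longlonglongrightarrow> root ?d 0" by (rule tendsto_real_root)
    moreover have "root ?d (r n ^ ?d) = r n" for n using r[of n] by (intro real_root_power_cancel) auto
    ultimately show ?thesis by simp
  qed

  let ?g = "\<lambda>q. f (fst q) ^ (k + 2) * (if cl q then \<phi> (\<delta> q) else 0)"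
  have pointwise: "(\<lambda>n. u n q) \<longlonglongrightarrow> ?g q" if cont: "isCont f (fst q)" for q
  proof -
    have "(\<lambda>n. fst q + r n *\<^sub>R fst (snd q) j) \<longlonglongrightarrow> fst q + 0 *\<^sub>R fst (snd q) j" for j
      by (intro tendsto_intros r_lim)
    then have lim: "(\<lambda>n. fst q + r n *\<^sub>R fst (snd q) j) \<longlonglongrightarrow> fst q" for j by simp
    have "(\<lambda>n. f (fst q + r n *\<^sub>R fst (snd q) j)) \<longlonglongrightarrow> f (fst q)" for j
      by (rule isCont_tendsto_compose[OF cont lim])
    then have "(\<lambda>n. w n q) \<longlonglongrightarrow> f (fst q) * (\<Prod>j<?m. f (fst q))"
      unfolding w_def rescaled_density_def by (intro tendsto_mult tendsto_const tendsto_prod)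
    then have wlim: "(\<lambda>n. w n q) \<longlonglongrightarrow> f (fst q) ^ (k + 2)" by simp
    have "(\<lambda>n. if cl q then (if iso n q then \<phi> (\<xi> n q) else \<phi> (\<delta> q)) else 0) \<longlonglongrightarrow> (if cl q then \<phi> (\<delta> q) else 0)"
    proof (cases "cl q")
      case True
      have "(\<lambda>n. if iso n q then \<phi> (\<xi> n q) else \<phi> (\<delta> q)) \<longlonglongrightarrow> \<phi> (\<delta> q)"
      proof (rule tendstoI)
        fix e :: real assume e: "e > 0"
        \<comment> \<open>\<open>T2\<close> depends on \<open>q\<close> and \<open>e\<close> but not
          on \<open>n\<close>, and \<open>T n\<close> exceeds it eventually. This is where the
          growth of the isolation scale is used.\<close>
        obtain T2 where T2: "\<forall>N\<in>radon_point_measures DeltaL. agree_up_to T2 N (\<delta> q) \<longrightarrow> \<bar>\<phi> N - \<phi> (\<delta> q)\<bar> < e"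
          using vague_continuous_agree[OF \<phi>cont \<delta>r e] by blast
        show "\<forall>\<^sub>F n in sequentially. dist (if iso n q then \<phi> (\<xi> n q) else \<phi> (\<delta> q)) (\<phi> (\<delta> q)) < e"
          using T_ge[of T2] eventually_ge_at_top[of "k + 2"]
        proof eventually_elim
          case (elim n)
          show ?case
          proof (cases "iso n q")
            case True
            have "agree_up_to (T n) (\<xi> n q) (\<delta> q)"
              unfolding \<xi>_def \<delta>_def
            proof (rule cech_diagram_agree_tuple[OF k finite_lessThan _ _ r])
              show "?I0 \<subseteq> {..<n}" using elim(2) by simp
              show "K = ?I0" if "K \<subseteq> {..<n}" "card K = k + 2" "close_points (R n q) K (2 * (r n * T n))" for K
                using True that unfolding iso_def isolated_cluster_def \<rho>1_def by (auto simp: mult.left_commute)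
              show "R n q i = fst q + r n *\<^sub>R case_nat 0 (fst (snd q)) i" if "i < k + 2" for i
                unfolding R_def by (rule rescaled_eq_affine) (use that in simp)
            qed
            then have "\<bar>\<phi> (\<xi> n q) - \<phi> (\<delta> q)\<bar> < e" using T2 \<xi>r agree_up_to_mono[OF _ elim(1)] by blast
            then show ?thesis using True by (simp add: dist_real_def)
          qed (use e in simp)
        qed
      qed
      then show ?thesis using True by simp
    qed simp
    from tendsto_mult[OF wlim this] show ?thesis unfolding u_def .
  qed
  have gm: "?g \<in> borel_measurable ?Q"
  proof -
    have "(\<lambda>q. fst q) \<in> borel_measurable ?Q" by measurable
    then have "(\<lambda>q. f (fst q)) \<in> borel_measurable ?Q" by (rule measurable_compose[OF _ f_measurable])
    then show ?thesis using clS \<delta>m by (intro borel_measurable_times borel_measurable_power measurable_If borel_measurable_const)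
  qed
  have AEu: "AE q in ?Q. (\<lambda>n. u n q) \<longlonglongrightarrow> ?g q"
    using AE_rescaled_space[OF contf, of ?m] by eventually_elim (rule pointwise)
  have AEb: "AE q in ?Q. norm (u n q) \<le> b * ball_weight ?m (2 * T0) q" for n
    unfolding u_def real_norm_def by (rule AE_I2, rule dominated[OF _ _ bu]) (simp_all split: if_splits)
  have intw: "integrable ?Q (\<lambda>q. b * ball_weight ?m (2 * T0) q)" by (intro integrable_mult_right integrable_ball_weight)
  have u_meas: "u n \<in> borel_measurable ?Q" for n using int3 by (rule borel_measurable_integrable)
  have intg: "integrable ?Q ?g"
    by (rule integrable_dominated_convergence[OF gm u_meas intw AEu AEb])
  have ulim: "(\<lambda>n. \<integral>q. u n q \<partial>?Q) \<longlonglongrightarrow> (\<integral>q. ?g q \<partial>?Q)"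
    by (rule integral_dominated_convergence[OF gm u_meas intw AEu AEb])
  \<comment> \<open>The restriction to close tuples disappears in the limit: a spread above
    \<open>2 * T0\<close> forces a birth after \<open>T0\<close>, and \<phi> vanishes on such a
    diagram.\<close>
  have cl_phi: "(if cl q then \<phi> (\<delta> q) else 0) = \<phi> (\<delta> q)" for q
  proof (cases "cl q")
    case False
    then obtain i j where ij: "i < k + 2" "j < k + 2"
        "2 * T0 < dist (case_nat 0 (fst (snd q)) i) (case_nat 0 (fst (snd q)) j)"
      unfolding cl_def close_points_def by (auto simp: not_le)
    have "T0 < tuple_birth k (case_nat 0 (fst (snd q)))"
      using ij(3) dist_le_tuple_birth[OF k ij(1,2), of "case_nat 0 (fst (snd q))"] T0 by linarith
    then have "\<phi> (\<delta> q) = 0" using vanish[OF \<delta>r] tuple_diagram_agree_null[OF k] unfolding \<delta>_def by blast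
    then show ?thesis by simp
  qed simp
  have "(\<integral>q. ?g q \<partial>?Q) = L"
    unfolding cl_phi unfolding \<delta>_def L_def
  proof (rule integral_rescaled_space_product[where a="\<lambda>x. f x ^ (k + 2)" and h="\<lambda>y. \<phi> (tuple_diagram F k (case_nat 0 y))"])
    show "integrable ?Q (\<lambda>q. f (fst q) ^ (k + 2) * \<phi> (tuple_diagram F k (case_nat 0 (fst (snd q)))))"
      using intg unfolding cl_phi unfolding \<delta>_def .
    have "(\<lambda>y. case_nat 0 y i) \<in> borel_measurable (PiM {..<?m} (\<lambda>_. lborel :: 'a measure))" if "i < k + 2" for i
    proof (cases i)
      case (Suc j)
      then have "(\<lambda>y. y j) \<in> measurable (PiM {..<?m} (\<lambda>_. lborel :: 'a measure)) lborel"
        using that by (intro measurable_component_singleton) simp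
      then show ?thesis using Suc by simp
    qed simp
    then show "(\<lambda>y. \<phi> (tuple_diagram F k (case_nat 0 y))) \<in> borel_measurable (PiM {..<?m} (\<lambda>_. lborel :: 'a measure))"
      by (intro measurable_compose[OF measurable_tuple_diagram[OF \<rho> k] \<phi>m])
  qed
  then have ulim': "(\<lambda>n. \<integral>q. u n q \<partial>?Q) \<longlonglongrightarrow> L" using ulim by simp
  have Ju: "\<bar>J n - (\<integral>q. u n q \<partial>?Q)\<bar> \<le> b * \<gamma> n" for n
  proof -
    have "\<bar>J n - (\<integral>q. u n q \<partial>?Q)\<bar> = \<bar>\<integral>q. w n q * (if cl q \<and> iso n q then \<phi> (\<xi> n q) else 0) - u n q \<partial>?Q\<bar>"
      unfolding J_def by (subst Bochner_Integration.integral_diff[OF int1 int3]) simp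
    also have "\<dots> \<le> (\<integral>q. \<bar>w n q * (if cl q \<and> iso n q then \<phi> (\<xi> n q) else 0) - u n q\<bar> \<partial>?Q)"
      by (rule integral_abs_bound)
    \<comment> \<open>On isolated configurations the two integrands are equal; on crowded close ones
      they differ by the weight times \<open>\<phi> (\<delta> q)\<close>.\<close>
    also have "\<dots> \<le> (\<integral>q. b * (w n q * (if cl q \<and> \<not> iso n q then 1 else 0)) \<partial>?Q)"
    proof (rule integral_mono)
      show "integrable ?Q (\<lambda>q. \<bar>w n q * (if cl q \<and> iso n q then \<phi> (\<xi> n q) else 0) - u n q\<bar>)"
        by (intro integrable_abs Bochner_Integration.integrable_diff int1 int3)
      show "integrable ?Q (\<lambda>q. b * (w n q * (if cl q \<and> \<not> iso n q then 1 else 0)))"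
        by (intro integrable_mult_right int2)
      show "\<bar>w n q * (if cl q \<and> iso n q then \<phi> (\<xi> n q) else 0) - u n q\<bar> \<le> b * (w n q * (if cl q \<and> \<not> iso n q then 1 else 0))" for q
        using w0[of n q] b[OF \<delta>r, of q] mult_left_mono[OF b[OF \<delta>r, of q] w0[of n q]]
        by (simp add: u_def abs_mult mult.commute)
    qed
    also have "\<dots> = b * \<gamma> n" by (simp add: \<gamma>_def)
    finally show ?thesis .
  qed
  have b\<gamma>: "(\<lambda>n. b * \<gamma> n) \<longlonglongrightarrow> 0" using tendsto_mult_left[OF \<gamma>lim, of b] by simp
  have Jlim: "J \<longlonglongrightarrow> L"
    by (rule tendsto_perturbation[OF ulim' b\<gamma>]) (use Ju in simp)

  \<comment> \<open>Stated for plain reals, so that the powers of \<open>n\<close> and of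
    \<open>r n\<close> are cancelled as atoms.\<close>
  have cancel1: "inverse (N * P) * (x * (c * (P * g))) = x / N * (c * g)" if "P \<noteq> 0" "N \<noteq> 0" for N P x c g :: real
    using that by (simp add: field_simps)
  have cancel2: "inverse (N * P) * (v - x * (P * j)) = inverse (N * P) * v - x / N * j" if "P \<noteq> 0" "N \<noteq> 0" for N P v x j :: real
    using that by (simp add: field_simps)
  define C where "C n = real (n choose (k + 2)) / real n ^ (k + 2)" for n
  have C: "C \<longlonglongrightarrow> 1 / fact (k + 2)" unfolding C_def by (rule binomial_asymptotics)
  define V where "V n = (\<integral>\<omega>. \<phi> (cech_diagram F k (r n) ((\<lambda>i. X i \<omega>) ` {..<n})) \<partial>M)" for n
  have main: "\<bar>inverse (a n) * V n - C n * J n\<bar> \<le> C n * (b * \<gamma> n)" if n: "k + 2 \<le> n" "T0 \<le> T n" for n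
  proof -
    have "\<bar>V n - real (n choose (k + 2)) * (r n ^ (?d * ?m) * J n)\<bar> \<le> real (n choose (k + 2)) * (b * (r n ^ (?d * ?m) * \<gamma> n))"
      unfolding V_def J_eq[OF n(1), symmetric] \<gamma>_eq[OF n(1), symmetric]
    proof (rule expectation_one_cluster[where \<Psi>="\<lambda>S. \<phi> (cech_diagram F k (r n) S)", OF n(1) \<Psi>m _ _ \<rho>01[OF n(2)]])
      show "\<bar>\<phi> (cech_diagram F k (r n) S)\<bar> \<le> b" if "finite S" for S :: "'a set"
        by (intro b cech_diagram_radon that r)
      show "\<exists>J\<subseteq>{..<n}. card J = k + 2 \<and> close_points x J (\<rho>0 n)"
        if "\<phi> (cech_diagram F k (r n) (x ` {..<n})) \<noteq> 0" for x :: "nat \<Rightarrow> 'a"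
      proof (rule ccontr)
        assume none: "\<not> ?thesis"
        \<comment> \<open>Without a close set at scale \<open>\<rho>0 n\<close> no pair is born up
          to \<open>T0\<close>, so \<phi> cannot tell the diagram from the null measure.\<close>
        have "agree_up_to T0 (cech_diagram F k (r n) (x ` {..<n})) (null_point_measure DeltaL)"
          by (rule cech_diagram_agree_null[OF k finite_lessThan r])
            (use none in \<open>auto simp: \<rho>0_def mult.left_commute\<close>)
        then have "\<phi> (cech_diagram F k (r n) (x ` {..<n})) = 0"
          by (intro vanish cech_diagram_radon r) auto
        then show False using that by simp
      qed
    qed
    then have "inverse (a n) * \<bar>V n - real (n choose (k + 2)) * (r n ^ (?d * ?m) * J n)\<bar> \<le>
        inverse (a n) * (real (n choose (k + 2)) * (b * (r n ^ (?d * ?m) * \<gamma> n)))"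
      using r[of n] by (intro mult_left_mono) (auto simp: a_def)
    moreover have pos: "0 < r n ^ (?d * ?m)" "0 < real n ^ (k + 2)" using r[of n] n by auto
    moreover have "inverse (a n) * (real (n choose (k + 2)) * (b * (r n ^ (?d * ?m) * \<gamma> n))) = C n * (b * \<gamma> n)"
      unfolding a_def C_def by (rule cancel1[OF less_imp_neq[OF pos(1), THEN not_sym] less_imp_neq[OF pos(2), THEN not_sym]])
    moreover have "inverse (a n) * \<bar>V n - real (n choose (k + 2)) * (r n ^ (?d * ?m) * J n)\<bar> = \<bar>inverse (a n) * V n - C n * J n\<bar>"
    proof -
      have "inverse (a n) * \<bar>V n - real (n choose (k + 2)) * (r n ^ (?d * ?m) * J n)\<bar> =
          \<bar>inverse (a n) * (V n - real (n choose (k + 2)) * (r n ^ (?d * ?m) * J n))\<bar>"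
        unfolding abs_mult using pos by (simp only: a_def abs_of_pos mult_pos_pos inverse_positive_iff_positive)
      also have "inverse (a n) * (V n - real (n choose (k + 2)) * (r n ^ (?d * ?m) * J n)) = inverse (a n) * V n - C n * J n"
        unfolding a_def C_def by (rule cancel2[OF less_imp_neq[OF pos(1), THEN not_sym] less_imp_neq[OF pos(2), THEN not_sym]])
      finally show ?thesis .
    qed
    ultimately show ?thesis by (simp only:)
  qed
  have "(\<lambda>n. inverse (a n) * V n) \<longlonglongrightarrow> 1 / fact (k + 2) * L"
  proof (rule tendsto_perturbation)
    show "(\<lambda>n. C n * J n) \<longlonglongrightarrow> 1 / fact (k + 2) * L" by (intro tendsto_mult C Jlim)
    show "(\<lambda>n. C n * (b * \<gamma> n)) \<longlonglongrightarrow> 0" using tendsto_mult[OF C b\<gamma>] by simp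
    show "\<forall>\<^sub>F n in sequentially. \<bar>inverse (a n) * V n - C n * J n\<bar> \<le> C n * (b * \<gamma> n)"
      using eventually_ge_at_top[of "k + 2"] T_ge[of T0] by eventually_elim (rule main)
  qed
  then show ?thesis unfolding a_def V_def L_def by (simp only: mult.assoc)
qed

end

theorem theorem3p3:
  fixes F :: "'f::field itself"
    and M :: "'w measure"
    and X :: "nat \<Rightarrow> 'w \<Rightarrow> 'a::euclidean_space"
    and f :: "'a \<Rightarrow> real"
    and r :: "nat \<Rightarrow> real"
    and k :: nat
    and \<rho> :: "(real \<times> ereal) measure \<Rightarrow> (real \<times> ereal) measure \<Rightarrow> real"
  assumes "k \<ge> 1"
    and "prob_space M"
    and "prob_space.indep_vars M (\<lambda>_. borel) X UNIV"
    and "\<And>i. distributed M lborel (X i) (\<lambda>x. ennreal (f x))"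
    and "\<And>x. 0 \<le> f x"
    and "bounded (range f)"
    and "AE x in lborel. isCont f x"
    and "\<And>n. r n > 0"
    and "(\<lambda>n. real n * r n ^ DIM('a)) \<longlonglongrightarrow> 0"
    and "(\<lambda>n. real n ^ (k + 2) * r n ^ (DIM('a) * (k + 1))) \<longlonglongrightarrow> 0"
    and "vague_metric DeltaL \<rho>"
  shows "M0_converges DeltaL \<rho>
    (\<lambda>n. scale_measure (ennreal (inverse (real n ^ (k + 2) * r n ^ (DIM('a) * (k + 1)))))
      (distr M (borel_of (vague_topology DeltaL))
        (\<lambda>\<omega>. cech_diagram F k (r n) ((\<lambda>i. X i \<omega>) ` {..<n}))))
    (scale_measure (ennreal (1 / fact (k + 2) * (\<integral>x. f x ^ (k + 2) \<partial>lborel)))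
      (distr (\<Pi>\<^sub>M i\<in>{..<k + 1}. (lborel :: 'a measure)) (borel_of (vague_topology DeltaL))
        (\<lambda>y. tuple_diagram F k (case_nat 0 y))))"
proof -
  interpret prob_space M by fact
  obtain B where B: "\<And>x. \<bar>f x\<bar> \<le> B" using assms(6) by (auto simp: bounded_iff)
  interpret iid_points M X f B
    by unfold_locales (use assms(3,4,5) B abs_le_D1 in auto)
  interpret R: Metric_space "radon_point_measures DeltaL" \<rho> using assms(11) by (simp add: vague_metric_def)
  interpret L: product_sigma_finite "\<lambda>_ :: nat. lborel :: 'a measure"
    by (intro product_sigma_finite.intro sigma_finite_lborel)
  let ?V = "borel_of (vague_topology DeltaL)"
  let ?Y = "\<Pi>\<^sub>M i\<in>{..<k + 1}. (lborel :: 'a measure)"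
  let ?a = "\<lambda>n. inverse (real n ^ (k + 2) * r n ^ (DIM('a) * (k + 1)))"
  let ?c = "1 / fact (k + 2) * (\<integral>x. f x ^ (k + 2) \<partial>lborel)"
  have a0: "0 \<le> ?a n" for n using assms(8)[of n] by (auto intro!: mult_nonneg_nonneg)
  have c0: "0 \<le> ?c" using nonneg by (intro mult_nonneg_nonneg Bochner_Integration.integral_nonneg) auto
  have m1: "(\<lambda>\<omega>. cech_diagram F k (r n) ((\<lambda>i. X i \<omega>) ` {..<n})) \<in> measurable M ?V" for n
    by (rule measurable_cech_diagram[OF assms(11) finite_lessThan assms(8)]) (rule X_measurable)
  have ym: "(\<lambda>y. case_nat 0 y i) \<in> borel_measurable ?Y" if "i < k + 2" for i
  proof (cases i)
    case (Suc j)
    then have "(\<lambda>y. y j) \<in> measurable ?Y lborel"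
      using that by (intro measurable_component_singleton) simp
    then show ?thesis using Suc by simp
  qed simp
  have m2: "(\<lambda>y. tuple_diagram F k (case_nat 0 y)) \<in> measurable ?Y ?V"
    by (rule measurable_tuple_diagram[OF assms(11,1) ym])
  show ?thesis
    unfolding M0_converges_def
  proof (intro conjI allI ballI)
    fix n
    \<comment> \<open>A scaled probability law is a finite measure; for \<open>n = 0\<close> the
      factor is \<open>inverse 0 = 0\<close>.\<close>
    have "emeasure (scale_measure (ennreal (?a n)) (distr M ?V (\<lambda>\<omega>. cech_diagram F k (r n) ((\<lambda>i. X i \<omega>) ` {..<n})))) A < \<infinity>" for A
    proof -
      have "emeasure (distr M ?V (\<lambda>\<omega>. cech_diagram F k (r n) ((\<lambda>i. X i \<omega>) ` {..<n}))) A \<le> 1"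
        using prob_space.emeasure_le_1[OF prob_space_distr[OF m1]] .
      then show ?thesis by (simp add: ennreal_mult_less_top le_less_trans[OF _ ennreal_one_less_top])
    qed
    then show "scale_measure (ennreal (?a n)) (distr M ?V (\<lambda>\<omega>. cech_diagram F k (r n) ((\<lambda>i. X i \<omega>) ` {..<n}))) \<in> M0_measures DeltaL \<rho>"
      by (simp add: M0_measures_def)
  next
    have "emeasure (scale_measure (ennreal ?c) (distr ?Y ?V (\<lambda>y. tuple_diagram F k (case_nat 0 y))))
        (radon_point_measures DeltaL - R.mball (null_point_measure DeltaL) s) < \<infinity>" if s: "s > 0" for s
    proof -
      let ?U = "R.mball (null_point_measure DeltaL) s"
      have U: "openin (vague_topology DeltaL) ?U"
        using assms(11) R.openin_mball unfolding vague_metric_def by metis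
      have "null_point_measure DeltaL \<in> ?U" using s by (simp add: null_point_measure_radon)
      then obtain T0 where T0: "\<forall>N\<in>radon_point_measures DeltaL. agree_up_to T0 N (null_point_measure DeltaL) \<longrightarrow> N \<in> ?U"
        using vague_open_agree[OF U] by blast
      have "space ?V - ?U \<in> sets ?V" using openin_sets_borel_of[OF U] by (rule sets.compl_sets)
      then have A: "radon_point_measures DeltaL - ?U \<in> sets ?V" by simp
      \<comment> \<open>Outside the ball around the null measure the birth is at most
        \<open>T0\<close>. Since 0 is a point of the tuple, all entries of \<open>y\<close> then lie
        in \<open>cball 0 T0\<close>, which leaves a set of finite Lebesgue measure.\<close>
      let ?K = "PiE {..<k + 1} (\<lambda>_. cball 0 T0) :: (nat \<Rightarrow> 'a) set"
      have K: "?K \<in> sets ?Y" by (intro sets_PiM_I_finite) auto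
      have "(\<lambda>y. tuple_diagram F k (case_nat 0 y)) -` (radon_point_measures DeltaL - ?U) \<inter> space ?Y \<subseteq> ?K"
      proof
        fix y assume y: "y \<in> (\<lambda>y. tuple_diagram F k (case_nat 0 y)) -` (radon_point_measures DeltaL - ?U) \<inter> space ?Y"
        have birth: "tuple_birth k (case_nat 0 y) \<le> T0"
        proof (rule ccontr)
          assume "\<not> ?thesis"
          then have "agree_up_to T0 (tuple_diagram F k (case_nat 0 y)) (null_point_measure DeltaL)"
            by (intro tuple_diagram_agree_null assms(1)) simp
          then have "tuple_diagram F k (case_nat 0 y) \<in> ?U" using T0 tuple_diagram_radon[OF assms(1)] by blast
          then show False using y by simp
        qed
        have "y j \<in> cball 0 T0" if "j < k + 1" for j
        proof -
          have "dist (case_nat 0 y 0) (case_nat 0 y (Suc j)) \<le> tuple_birth k (case_nat 0 y)"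
            using that by (intro dist_le_tuple_birth assms(1)) auto
          then show ?thesis using birth by simp
        qed
        moreover have "y \<in> extensional {..<k + 1}" using y by (simp add: space_PiM PiE_def)
        ultimately show "y \<in> ?K" by (simp add: PiE_iff)
      qed
      then have "emeasure (distr ?Y ?V (\<lambda>y. tuple_diagram F k (case_nat 0 y))) (radon_point_measures DeltaL - ?U) \<le> emeasure ?Y ?K"
        using K unfolding emeasure_distr[OF m2 A] by (intro emeasure_mono)
      also have "\<dots> = (\<Prod>i<k + 1. emeasure lborel (cball (0::'a) T0))" by (intro L.emeasure_PiM) auto
      also have "\<dots> < \<infinity>" using emeasure_lborel_cball_finite[of "0::'a" T0]
        by (simp add: power_less_top_ennreal ennreal_mult_less_top)
      finally show ?thesis by (simp add: ennreal_mult_less_top)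
    qed
    then show "scale_measure (ennreal ?c) (distr ?Y ?V (\<lambda>y. tuple_diagram F k (case_nat 0 y))) \<in> M0_measures DeltaL \<rho>"
      by (simp add: M0_measures_def)
  next
    fix \<phi> assume \<phi>: "\<phi> \<in> C0_functions DeltaL"
    then have \<phi>m: "\<phi> \<in> borel_measurable ?V" by (auto simp: C0_functions_def intro: continuous_map_measurable)
    have 1: "(\<integral>N. \<phi> N \<partial>scale_measure (ennreal (?a n)) (distr M ?V (\<lambda>\<omega>. cech_diagram F k (r n) ((\<lambda>i. X i \<omega>) ` {..<n})))) =
        ?a n * (\<integral>\<omega>. \<phi> (cech_diagram F k (r n) ((\<lambda>i. X i \<omega>) ` {..<n})) \<partial>M)" for n
      using integral_scale_measure[OF _ a0, of \<phi> "distr M ?V (\<lambda>\<omega>. cech_diagram F k (r n) ((\<lambda>i. X i \<omega>) ` {..<n}))" n]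
        integral_distr[OF m1 \<phi>m] \<phi>m by simp
    have 2: "(\<integral>N. \<phi> N \<partial>scale_measure (ennreal ?c) (distr ?Y ?V (\<lambda>y. tuple_diagram F k (case_nat 0 y)))) =
        ?c * (\<integral>y. \<phi> (tuple_diagram F k (case_nat 0 y)) \<partial>?Y)"
      using integral_scale_measure[OF _ c0, of \<phi> "distr ?Y ?V (\<lambda>y. tuple_diagram F k (case_nat 0 y))"]
        integral_distr[OF m2 \<phi>m] \<phi>m by simp
    show "(\<lambda>n. \<integral>N. \<phi> N \<partial>scale_measure (ennreal (?a n)) (distr M ?V (\<lambda>\<omega>. cech_diagram F k (r n) ((\<lambda>i. X i \<omega>) ` {..<n})))) \<longlonglongrightarrow>
        (\<integral>N. \<phi> N \<partial>scale_measure (ennreal ?c) (distr ?Y ?V (\<lambda>y. tuple_diagram F k (case_nat 0 y))))"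
      unfolding 1 2 by (rule expectation_convergence[OF assms(1,11) \<phi> assms(8,9,10,7)])
  qed
qed

end
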